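(* Let $G$ be a finitely generated group of polynomial volume growth and $N$ a normal nilpotent subgroup of finite index. Let $S=(s_1,\dots,s_k)$ be a tuple generating $G$ and $\mathbf v\in(1/2,\infty)^k$, and let $(S_N,\mathbf v_N)$ be the associated weighted tuple in $N$; put $M=\langle S_N\rangle$. Let $\mathcal I$ be a descending series of $M$ satisfying the conditions in the context, and let $(\Xi,\mathbf u)$ be a weighted generating tuple of $M$ constructed from $\mathcal I$ as in the context. Let $\Xi_1$ be a finite subset of $G$ such that $\Xi\sqcup\Xi_1$ generates $G$. If $\mathrm{Red}(\mathcal N_{S_N,\mathbf v_N})=\mathcal I$ (as series of $M$ indexed by weights), then $$\mathcal E_{\mu_{S,1/\mathbf v}}\asymp\mathcal E_{\mu_{\Xi,1/\mathbf u}+\kappa_{\Xi_1}},$$ where $\kappa_{\Xi_1}$ is the uniform measure on $\Xi_1$.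
   Context: Tuple $S_N$. Let $X=\{x_0=e,x_1,\dots,x_p\}$ be coset representatives of $N$ in $G$. For each $i$ with $\langle s_i\rangle$ infinite let $\epsilon_i\ge1$ be such that $\langle s_i\rangle\cap N=\langle s_i^{\epsilon_i}\rangle$. $S_N$ is the tuple of all $x_js_i^{\epsilon_i}x_j^{-1}$ ($0\le j\le p$, $i$ with $\langle s_i\rangle$ infinite), and $\mathbf v_N$ gives weight $v_i$ to $x_js_i^{\epsilon_i}x_j^{-1}$. $M=\langle S_N\rangle$ is a finitely generated nilpotent group, possibly a proper subgroup of $N$. Reduced series (in $M$) of $(T,\mathbf t)$, $T=(t_i)$ generating $M$, $\mathbf t=(\tau_i)$ positive weights. $\mathcal C(T)$ is the set of formal commutators over $T\cup T^{-1}$ (each letter is one; $[c_1,c_2]$ is one if $c_1,c_2$ are), with $w(t_i^{\pm1})=\tau_i$, $w([c_1,c_2])=w(c_1)+w(c_2)$. Let $w_1<w_2<\dots$ be the distinct values of $w$, $M_{w_i}$ the subgroup generated by evaluations of all $c$ with $w(c)\ge w_i$, $j_*$ minimal with $M_{w_{j_*+1}}=\{e\}$; $\mathcal N_{T,\mathbf t}$ is the series $(M_{w_i})$. For $K\le M$, $I(K)=\{g\in M:\exists n\ge1,\ g^n\in K\}$, a subgroup. In $I(M_{w_1})\supseteq\dots\supseteq I(M_{w_{j_*}})\supseteq I(\{e\})=\mathrm{Tor}(M)$, among identical subgroups keep only the last occurrence; the result is $\mathrm{Red}(\mathcal N_{T,\mathbf t})=\{I(M_{w_{l_1}})\supset\dots\supset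 I(M_{w_{l_r}})\supset\mathrm{Tor}(M)\}$ with remaining weights $(w_{l_1},\dots,w_{l_r})$. Conditions on $\mathcal I$. $U=\{u_1<u_2<\dots\}$ is a set of reals $>1/2$ that is a semigroup under addition, and $\mathcal I=\{I_{u_1}\supset\dots\supset I_{u_m}\supset\mathrm{Tor}(M)=I_{u_{m+1}}\supseteq\{e\}=I_{u_{m+2}}=\dots\}$ is a central series of subgroups of $M$ indexed by $U$ such that: $[I_{u_i},I_{u_j}]\subseteq I_{u_i+u_j}$; $I_{u_1}$ has finite index in $M$; for $1\le i\le m$, $I_{u_i}/I_{u_{i+1}}$ is nontrivial and torsion-free. $\mathrm{Red}(\mathcal N_{S_N,\mathbf v_N})=\mathcal I$ means that the retained weights are $(u_1,\dots,u_m)$ and the corresponding subgroups coincide. Construction of $(\Xi,\mathbf u)$. $\mathfrak u(s)=\infty$ if $s\in\mathrm{Tor}(M)$ and $\mathfrak u(s)=\max\{u_i:1\le i\le m,\ s\in I_{u_i}\}$ otherwise (with $\max\emptyset=-\infty$). For $1\le i\le m$, $C_{u_i}$ is the subgroup generated by all $[I_{u_a},I_{u_b}]$ with $u_a+u_b=u_i$, $a,b<i$, and $\Xi_{u_i}\subset I_{u_i}$ is a finite subset whose image generates $(I_{u_i}/I_{u_{i+1}})\big/\bigl((C_{u_i}I_{u_{i+1}})/I_{u_{i+1}}\bigr)$. $\Xi_0=(\xi_1,\dots,\xi_n)$ is a tuple in $M$ such that $\Xi=\bigl(\bigsqcup_{i=1}^m\Xi_{u_i}\bigr)\sqcup\Xi_0$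 generates $M$, and $a_i>1/2$ satisfy $a_i\le\mathfrak u(\xi_i)$. $\mathbf u$ assigns weight $u_i$ to each element of $\Xi_{u_i}$ and $a_i$ to $\xi_i$. Dirichlet forms. For a tuple $T=(t_1,\dots,t_q)$ in $G$ and $\boldsymbol\alpha\in(0,2)^q$, $\mu_{T,\boldsymbol\alpha}$ is any symmetric probability measure on $G$ with $\mu_{T,\boldsymbol\alpha}(g)\asymp\sum_{j=1}^q\sum_{a\in\mathbb Z}\mathbf 1_{\{t_j^a\}}(g)(1+|a|)^{-1-\alpha_j}$; $1/\mathbf v$ denotes componentwise reciprocals. For a finite measure $\mu$ on $G$, $\mathcal E_\mu(f,f)=\frac12\sum_{g,h\in G}|f(gh)-f(g)|^2\mu(h)$. $\asymp$ means two-sided comparison up to positive finite constants; for Dirichlet forms, over all finitely supported $f:G\to\mathbb R$. *)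

theory Defs
  imports "HOL-Algebra.Generated_Groups" "HOL-Probability.Probability_Mass_Function"
begin

section \<open>Nilpotency, torsion, growth\<close>

text \<open>Commutators follow the convention of \<^const>\<open>derived\<close>: \<open>[h, k] = h k h\<inverse> k\<inverse>\<close>.\<close>

definition gcomm :: "('a, 'b) monoid_scheme \<Rightarrow> 'a \<Rightarrow> 'a \<Rightarrow> 'a" where
  "gcomm G h k = h \<otimes>\<^bsub>G\<^esub> k \<otimes>\<^bsub>G\<^esub> inv\<^bsub>G\<^esub> h \<otimes>\<^bsub>G\<^esub> inv\<^bsub>G\<^esub> k"

definition comm_subgroup :: "('a, 'b) monoid_scheme \<Rightarrow> 'a set \<Rightarrow> 'a set \<Rightarrow> 'a set" where
  "comm_subgroup G H K = generate G {gcomm G h k | h k. h \<in> H \<and> k \<in> K}"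

primrec lower_central :: "('a, 'b) monoid_scheme \<Rightarrow> nat \<Rightarrow> 'a set" where
  "lower_central G 0 = carrier G"
| "lower_central G (Suc n) = comm_subgroup G (lower_central G n) (carrier G)"

definition nilpotent_group :: "('a, 'b) monoid_scheme \<Rightarrow> bool" where
  "nilpotent_group G \<longleftrightarrow> group G \<and> (\<exists>n. lower_central G n = {\<one>\<^bsub>G\<^esub>})"

definition torsion_free :: "('a, 'b) monoid_scheme \<Rightarrow> bool" where
  "torsion_free G \<longleftrightarrow>
     (\<forall>x \<in> carrier G. \<forall>n::nat. n \<ge> 1 \<longrightarrow> x [^]\<^bsub>G\<^esub> n = \<one>\<^bsub>G\<^esub> \<longrightarrow> x = \<one>\<^bsub>G\<^esub>)"

definition word_ball :: "('a, 'b) monoid_scheme \<Rightarrow> 'a set \<Rightarrow> nat \<Rightarrow> 'a set" where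
  "word_ball G A n =
     {foldr (\<otimes>\<^bsub>G\<^esub>) xs \<one>\<^bsub>G\<^esub> | xs. set xs \<subseteq> A \<union> m_inv G ` A \<and> length xs \<le> n}"

definition polynomial_growth :: "('a, 'b) monoid_scheme \<Rightarrow> bool" where
  "polynomial_growth G \<longleftrightarrow>
     (\<exists>A. finite A \<and> A \<subseteq> carrier G \<and> generate G A = carrier G \<and>
        (\<exists>(C::real) (d::nat). \<forall>n\<ge>1. real (card (word_ball G A n)) \<le> C * real n ^ d))"

definition isolator :: "('a, 'b) monoid_scheme \<Rightarrow> 'a set \<Rightarrow> 'a set \<Rightarrow> 'a set" where
  "isolator G M K = {g \<in> M. \<exists>n::nat. n \<ge> 1 \<and> g [^]\<^bsub>G\<^esub> n \<in> K}"

abbreviation torsion_part :: "('a, 'b) monoid_scheme \<Rightarrow> 'a set \<Rightarrow> 'a set" where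
  "torsion_part G M \<equiv> isolator G M {\<one>\<^bsub>G\<^esub>}"


section \<open>Weighted tuples\<close>

text \<open>A weighted tuple is the list of its entries, each paired with its weight.\<close>

type_synonym 'a wtuple = "('a \<times> real) list"

definition wgroup :: "('a, 'b) monoid_scheme \<Rightarrow> 'a wtuple \<Rightarrow> 'a set" where
  "wgroup G T = generate G (fst ` set T)"

definition coset_reps :: "('a, 'b) monoid_scheme \<Rightarrow> 'a set \<Rightarrow> 'a list \<Rightarrow> bool" where
  "coset_reps G N X \<longleftrightarrow>
     X \<noteq> [] \<and> X ! 0 = \<one>\<^bsub>G\<^esub> \<and> set X \<subseteq> carrier G \<and>
     bij_betw (\<lambda>j. N #>\<^bsub>G\<^esub> X ! j) {..<length X} (rcosets\<^bsub>G\<^esub> N)"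

text \<open>The pair of \<open>S\<^sub>N\<close> and its weights; \<open>X\<close> lists the coset representatives.\<close>

definition conj_power_tuple ::
  "('a, 'b) monoid_scheme \<Rightarrow> 'a list \<Rightarrow> (nat \<Rightarrow> nat) \<Rightarrow> 'a list \<Rightarrow> real list \<Rightarrow> 'a wtuple" where
  "conj_power_tuple G X \<epsilon> S v =
     [(X ! j \<otimes>\<^bsub>G\<^esub> (S ! i [^]\<^bsub>G\<^esub> \<epsilon> i) \<otimes>\<^bsub>G\<^esub> inv\<^bsub>G\<^esub> (X ! j), v ! i).
        j \<leftarrow> [0..<length X], i \<leftarrow> [0..<length S], infinite (generate G {S ! i})]"


section \<open>The reduced series of a weighted tuple\<close>

text \<open>Letters are positions in the tuple, so that equal entries with different weights are
  kept apart; \<open>Letter i True\<close> stands for \<open>t\<^sub>i\<close> and \<open>Letter i False\<close> for its formal inverse.\<close>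

datatype 'i fcomm = Letter 'i bool | Br "'i fcomm" "'i fcomm"

definition fcomms :: "'a wtuple \<Rightarrow> nat fcomm set" where
  "fcomms T = {c. set_fcomm c \<subseteq> {..<length T}}"

primrec fc_weight :: "'a wtuple \<Rightarrow> nat fcomm \<Rightarrow> real" where
  "fc_weight T (Letter i b) = snd (T ! i)"
| "fc_weight T (Br c d) = fc_weight T c + fc_weight T d"

primrec fc_eval :: "('a, 'b) monoid_scheme \<Rightarrow> 'a wtuple \<Rightarrow> nat fcomm \<Rightarrow> 'a" where
  "fc_eval G T (Letter i b) = (if b then fst (T ! i) else inv\<^bsub>G\<^esub> (fst (T ! i)))"
| "fc_eval G T (Br c d) = gcomm G (fc_eval G T c) (fc_eval G T d)"

text \<open>\<open>weight_value T j\<close> is the \<open>(j+1)\<close>-st smallest weight: all sequences of weights are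
  indexed from \<open>0\<close> here. (If \<open>T\<close> is empty there are no weights, but then every
  \<open>weight_subgroup\<close> is trivial and \<open>weight_length\<close> is \<open>0\<close>.)\<close>

primrec weight_value :: "'a wtuple \<Rightarrow> nat \<Rightarrow> real" where
  "weight_value T 0 = (LEAST w. w \<in> fc_weight T ` fcomms T)"
| "weight_value T (Suc j) = (LEAST w. w \<in> fc_weight T ` fcomms T \<and> weight_value T j < w)"

definition weight_subgroup :: "('a, 'b) monoid_scheme \<Rightarrow> 'a wtuple \<Rightarrow> real \<Rightarrow> 'a set" where
  "weight_subgroup G T w = generate G (fc_eval G T ` {c \<in> fcomms T. w \<le> fc_weight T c})"

text \<open>With indices from \<open>0\<close>, this is the number \<open>j\<^sub>*\<close> of weights before the series of
  weight subgroups becomes trivial.\<close>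

definition weight_length :: "('a, 'b) monoid_scheme \<Rightarrow> 'a wtuple \<Rightarrow> nat" where
  "weight_length G T = (LEAST j. weight_subgroup G T (weight_value T j) = {\<one>\<^bsub>G\<^esub>})"

definition isolated_term :: "('a, 'b) monoid_scheme \<Rightarrow> 'a wtuple \<Rightarrow> nat \<Rightarrow> 'a set" where
  "isolated_term G T j = isolator G (wgroup G T) (weight_subgroup G T (weight_value T j))"

text \<open>The chain of isolated terms with indices \<open>0, \<dots>, weight_length G T\<close>, whose last member is
  the torsion subgroup, keeping only the last occurrence of each subgroup. The final torsion
  subgroup, which carries no weight, is omitted from the list.\<close>

definition reduced_series :: "('a, 'b) monoid_scheme \<Rightarrow> 'a wtuple \<Rightarrow> (real \<times> 'a set) list" where
  "reduced_series G T =
     [(weight_value T l, isolated_term G T l).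
        l \<leftarrow> [0..<weight_length G T],
        \<forall>l' \<in> {l<..weight_length G T}. isolated_term G T l' \<noteq> isolated_term G T l]"


section \<open>Graded series and adapted weighted tuples\<close>

text \<open>\<open>u\<close> enumerates the index semigroup \<open>U = range u\<close> in increasing order, starting with
  \<open>u 0\<close>, and \<open>I w\<close> is the term of the series of index \<open>w \<in> U\<close>. The proper part of the series
  consists of \<open>I (u 0), \<dots>, I (u (m - 1))\<close>, followed by the torsion subgroup \<open>I (u m)\<close>.\<close>

definition graded_series ::
  "('a, 'b) monoid_scheme \<Rightarrow> 'a set \<Rightarrow> (nat \<Rightarrow> real) \<Rightarrow> nat \<Rightarrow> (real \<Rightarrow> 'a set) \<Rightarrow> bool" where
  "graded_series G M u m I \<longleftrightarrow>
     strict_mono u \<and> (\<forall>i. u i > 1/2) \<and> (\<forall>i j. u i + u j \<in> range u) \<and>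
     (\<forall>i. subgroup (I (u i)) (G\<lparr>carrier := M\<rparr>)) \<and>
     (\<forall>i<m. I (u (Suc i)) \<subset> I (u i)) \<and>
     I (u m) = torsion_part G M \<and>
     (\<forall>i>m. I (u i) = {\<one>\<^bsub>G\<^esub>}) \<and>
     (\<forall>i. comm_subgroup G M (I (u i)) \<subseteq> I (u (Suc i))) \<and>
     (\<forall>i j. comm_subgroup G (I (u i)) (I (u j)) \<subseteq> I (u i + u j)) \<and>
     finite (rcosets\<^bsub>G\<lparr>carrier := M\<rparr>\<^esub> (I (u 0))) \<and>
     (\<forall>i<m. let Q = G\<lparr>carrier := I (u i)\<rparr> Mod I (u (Suc i))
            in carrier Q \<noteq> {\<one>\<^bsub>Q\<^esub>} \<and> torsion_free Q)"

text \<open>Since \<open>Sup {} = -\<infinity>\<close> in \<^typ>\<open>ereal\<close>, the supremum is the maximum of a finite set, with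
  \<open>max {} = -\<infinity>\<close>.\<close>

definition series_weight ::
  "('a, 'b) monoid_scheme \<Rightarrow> 'a set \<Rightarrow> (nat \<Rightarrow> real) \<Rightarrow> nat \<Rightarrow> (real \<Rightarrow> 'a set) \<Rightarrow> 'a \<Rightarrow> ereal" where
  "series_weight G M u m I s =
     (if s \<in> torsion_part G M then \<infinity> else (SUP i \<in> {i. i < m \<and> s \<in> I (u i)}. ereal (u i)))"

definition series_comm ::
  "('a, 'b) monoid_scheme \<Rightarrow> (nat \<Rightarrow> real) \<Rightarrow> (real \<Rightarrow> 'a set) \<Rightarrow> nat \<Rightarrow> 'a set" where
  "series_comm G u I i =
     generate G (\<Union>{comm_subgroup G (I (u a)) (I (u b)) | a b. a < i \<and> b < i \<and> u a + u b = u i})"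

text \<open>The image of \<open>Y\<close> generates \<open>(I\<^sub>i / I\<^sub>i\<^sub>+\<^sub>1) / (C\<^sub>i I\<^sub>i\<^sub>+\<^sub>1 / I\<^sub>i\<^sub>+\<^sub>1)\<close>, where \<open>I\<^sub>i\<close> is \<open>I (u i)\<close> and
  \<open>C\<^sub>i\<close> is \<^const>\<open>series_comm\<close>.\<close>

definition generates_graded_piece ::
  "('a, 'b) monoid_scheme \<Rightarrow> (nat \<Rightarrow> real) \<Rightarrow> (real \<Rightarrow> 'a set) \<Rightarrow> nat \<Rightarrow> 'a set \<Rightarrow> bool" where
  "generates_graded_piece G u I i Y \<longleftrightarrow>
     (let J = I (u (Suc i));
          Q = G\<lparr>carrier := I (u i)\<rparr> Mod J;
          H = carrier (G\<lparr>carrier := series_comm G u I i <#>\<^bsub>G\<^esub> J\<rparr> Mod J)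
      in generate (Q Mod H) ((\<lambda>y. H #>\<^bsub>Q\<^esub> (J #>\<^bsub>G\<^esub> y)) ` Y) = carrier (Q Mod H))"

text \<open>The finite sets \<open>\<Xi>\<^sub>u\<^sub>i\<close> are given by repetition-free lists \<open>Y i\<close>; the disjoint union is
  concatenation.\<close>

definition series_tuple ::
  "(nat \<Rightarrow> real) \<Rightarrow> nat \<Rightarrow> (nat \<Rightarrow> 'a list) \<Rightarrow> 'a list \<Rightarrow> real list \<Rightarrow> 'a wtuple" where
  "series_tuple u m Y \<Xi>\<^sub>0 a = [(y, u i). i \<leftarrow> [0..<m], y \<leftarrow> Y i] @ zip \<Xi>\<^sub>0 a"

definition adapted_tuple ::
  "('a, 'b) monoid_scheme \<Rightarrow> 'a set \<Rightarrow> (nat \<Rightarrow> real) \<Rightarrow> nat \<Rightarrow> (real \<Rightarrow> 'a set) \<Rightarrow> 'a wtuple \<Rightarrow> bool"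
where
  "adapted_tuple G M u m I \<Xi> \<longleftrightarrow>
     (\<exists>Y \<Xi>\<^sub>0 a.
        (\<forall>i<m. distinct (Y i) \<and> set (Y i) \<subseteq> I (u i) \<and> generates_graded_piece G u I i (set (Y i))) \<and>
        set \<Xi>\<^sub>0 \<subseteq> M \<and> length a = length \<Xi>\<^sub>0 \<and>
        (\<forall>i<length \<Xi>\<^sub>0. a ! i > 1/2 \<and> ereal (a ! i) \<le> series_weight G M u m I (\<Xi>\<^sub>0 ! i)) \<and>
        \<Xi> = series_tuple u m Y \<Xi>\<^sub>0 a \<and>
        wgroup G \<Xi> = M)"


section \<open>Measures and Dirichlet forms\<close>

text \<open>Here the second components are the exponents \<open>\<alpha>\<^sub>j\<close>.\<close>

definition power_density :: "('a, 'b) monoid_scheme \<Rightarrow> ('a \<times> real) list \<Rightarrow> 'a \<Rightarrow> real" where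
  "power_density G T g =
     (\<Sum>(t, \<alpha>) \<leftarrow> T. \<Sum>\<^sub>\<infinity>a::int. of_bool (g = t [^]\<^bsub>G\<^esub> a) * (1 + real_of_int \<bar>a\<bar>) powr (- 1 - \<alpha>))"

definition power_measure :: "('a, 'b) monoid_scheme \<Rightarrow> ('a \<times> real) list \<Rightarrow> 'a pmf \<Rightarrow> bool" where
  "power_measure G T \<mu> \<longleftrightarrow>
     set_pmf \<mu> \<subseteq> carrier G \<and>
     (\<forall>g \<in> carrier G. pmf \<mu> (inv\<^bsub>G\<^esub> g) = pmf \<mu> g) \<and>
     (\<exists>c>0. \<exists>C>0. \<forall>g \<in> carrier G.
        c * power_density G T g \<le> pmf \<mu> g \<and> pmf \<mu> g \<le> C * power_density G T g)"

definition reciprocal_weights :: "'a wtuple \<Rightarrow> ('a \<times> real) list" where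
  "reciprocal_weights T = map (\<lambda>(t, w). (t, 1 / w)) T"

definition uniform_mass :: "'a set \<Rightarrow> 'a \<Rightarrow> real" where
  "uniform_mass A g = indicator A g / real (card A)"

text \<open>A finite measure on \<open>G\<close> is given by its mass function \<open>\<mu>\<close>. For finitely supported \<open>f\<close> the
  double sum converges.\<close>

definition dirichlet_form :: "('a, 'b) monoid_scheme \<Rightarrow> ('a \<Rightarrow> real) \<Rightarrow> ('a \<Rightarrow> real) \<Rightarrow> real" where
  "dirichlet_form G \<mu> f =
     1/2 * (\<Sum>\<^sub>\<infinity>(g, h) \<in> carrier G \<times> carrier G. \<bar>f (g \<otimes>\<^bsub>G\<^esub> h) - f g\<bar>\<^sup>2 * \<mu> h)"

definition dirichlet_comparable ::
  "('a, 'b) monoid_scheme \<Rightarrow> ('a \<Rightarrow> real) \<Rightarrow> ('a \<Rightarrow> real) \<Rightarrow> bool" where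
  "dirichlet_comparable G \<mu> \<nu> \<longleftrightarrow>
     (\<exists>c>0. \<exists>C>0. \<forall>f. finite {g \<in> carrier G. f g \<noteq> 0} \<longrightarrow>
        c * dirichlet_form G \<nu> f \<le> dirichlet_form G \<mu> f \<and>
        dirichlet_form G \<mu> f \<le> C * dirichlet_form G \<nu> f)"

end

theory Submission
  imports Defs
begin

text \<open>
  Let \<open>N(h)\<close> be the squared \<open>\<ell>\<^sup>2\<close> distance between \<open>f\<close> and its right translate by \<open>h\<close>. The Dirichlet form of a
  measure with density \<open>(1 + |a|)\<^sup>-\<^sup>1\<^sup>-\<^sup>1\<^sup>/\<^sup>w\<close> on the powers \<open>t\<^sup>a\<close> is comparable with the sum over \<open>k\<close> of \<open>2\<^sup>-\<^sup>k\<close>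
  times the maximum of \<open>N(t\<^sup>b)\<close> over \<open>|b| \<le> r\<^sup>w\<close>, where \<open>r = 2\<^sup>k\<close>: since \<open>N(g h) \<le> 2 N(g) + 2 N(h)\<close>, the
  maximum over such a window is comparable with a mean over it (\<open>energy_le_peaks\<close>,
  \<open>peaks_le_energy\<close>). In this form all letters of a tuple share the scale \<open>r\<close>, whatever their weights.
  So one tuple has a smaller form than another as soon as every power \<open>t\<^sup>n\<close> with \<open>|n| \<le> r\<^sup>w\<close> of one of its
  letters is a product of a bounded number of powers \<open>t'\<^sup>b\<close> with \<open>|b| \<le> K r\<^sup>w\<^sup>'\<close> of letters of the other,
  with bounds independent of \<open>r\<close> (\<open>dominated_power_energy\<close>).

  What remains is algebra in the nilpotent group \<open>M\<close>. For a filtration whose weights add under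
  commutators, collection shows that \<open>(g h)\<^sup>n = h\<^sup>n g\<^sup>n\<close> and \<open>[x\<^sup>n, y\<^sup>k] = [x, y]\<^sup>n\<^sup>k\<close> hold up to bounded products
  of admissible powers of larger weight (\<open>pow_mult_collect\<close>, \<open>gcomm_pow_collect\<close>). Passing through the
  weights in increasing order, admissible powers of all elements of a term are obtained from
  admissible powers of any set that generates the terms modulo larger weights and commutators
  (\<open>power_families_generated\<close>).

  This is applied to two filtrations. For the one given by formal commutators over \<open>S\<^sub>N\<close> the
  generators are the letters of \<open>S\<^sub>N\<close>, whose powers are conjugates of powers of entries of \<open>S\<close> by fixed
  elements. Bounded remainders being harmless, the conclusion passes from a subgroup to its isolator,
  hence to the terms of the reduced series, hence to \<open>\<Xi>\<close>. For the series \<open>I\<close> the generators are the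
  elements of \<open>\<Xi>\<close> and torsion elements, and a power of an entry of \<open>S\<close> of weight \<open>v\<close> lies in a term of
  weight at least \<open>v\<close> because the reduced series retains the last occurrence of each isolator.
\<close>

section \<open>Commutators and generated subgroups\<close>

context group begin

lemma cancel_left [simp]:
  assumes "x \<in> carrier G" "y \<in> carrier G"
  shows "x \<otimes> (inv x \<otimes> y) = y" and "inv x \<otimes> (x \<otimes> y) = y"
  using assms by (simp_all flip: m_assoc)

lemma gcomm_closed [simp, intro]:
  "x \<in> carrier G \<Longrightarrow> y \<in> carrier G \<Longrightarrow> gcomm G x y \<in> carrier G"
  by (simp add: gcomm_def)

lemma conj_eq_gcomm:
  "x \<in> carrier G \<Longrightarrow> y \<in> carrier G \<Longrightarrow> x \<otimes> y \<otimes> inv x = gcomm G x y \<otimes> y"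
  by (simp add: gcomm_def m_assoc)

lemma inv_gcomm:
  "x \<in> carrier G \<Longrightarrow> y \<in> carrier G \<Longrightarrow> inv (gcomm G x y) = gcomm G y x"
  by (simp add: gcomm_def inv_mult_group m_assoc)

lemma gcomm_one [simp]:
  "x \<in> carrier G \<Longrightarrow> gcomm G x \<one> = \<one>" "x \<in> carrier G \<Longrightarrow> gcomm G \<one> x = \<one>"
  by (simp_all add: gcomm_def)

lemma gcomm_mult_left:
  assumes "x \<in> carrier G" "y \<in> carrier G" "z \<in> carrier G"
  shows "gcomm G (x \<otimes> y) z = gcomm G x (gcomm G y z) \<otimes> gcomm G y z \<otimes> gcomm G x z"
  using assms by (simp add: gcomm_def inv_mult_group m_assoc)

lemma gcomm_mult_right:
  assumes "x \<in> carrier G" "y \<in> carrier G" "z \<in> carrier G"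
  shows "gcomm G x (y \<otimes> z) = gcomm G x y \<otimes> gcomm G y (gcomm G x z) \<otimes> gcomm G x z"
  using assms by (simp add: gcomm_def inv_mult_group m_assoc)

lemma gcomm_mult_left':
  assumes "x \<in> carrier G" "y \<in> carrier G" "z \<in> carrier G"
  shows "gcomm G (x \<otimes> y) z = x \<otimes> gcomm G y z \<otimes> inv x \<otimes> gcomm G x z"
  using assms by (simp add: gcomm_def inv_mult_group m_assoc)

lemma gcomm_mult_right':
  assumes "x \<in> carrier G" "y \<in> carrier G" "z \<in> carrier G"
  shows "gcomm G x (y \<otimes> z) = gcomm G x y \<otimes> (y \<otimes> gcomm G x z \<otimes> inv y)"
  using assms by (simp add: gcomm_def inv_mult_group m_assoc)

text \<open>Used to see that the terms of a filtration, which are given by generators, are normal in each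
  other: conjugation is an automorphism, so it is enough to conjugate generators by generators.\<close>

lemma generate_normalizes:
  assumes X: "X \<subseteq> carrier G" and Z: "Z \<subseteq> carrier G"
    and conj: "\<And>x z. x \<in> X \<Longrightarrow> z \<in> Z \<Longrightarrow> x \<otimes> z \<otimes> inv x \<in> generate G Z"
    and conj_inv: "\<And>x z. x \<in> X \<Longrightarrow> z \<in> Z \<Longrightarrow> inv x \<otimes> z \<otimes> x \<in> generate G Z"
    and p: "p \<in> generate G X" and h: "h \<in> generate G Z"
  shows "p \<otimes> h \<otimes> inv p \<in> generate G Z"
proof -
  interpret H: subgroup "generate G Z" G by (rule generate_is_subgroup[OF Z])
  have conj_gen: "q \<otimes> k \<otimes> inv q \<in> generate G Z"
    if q: "q \<in> carrier G" and base: "\<And>z. z \<in> Z \<Longrightarrow> q \<otimes> z \<otimes> inv q \<in> generate G Z"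
      and k: "k \<in> generate G Z" for q k
    using k
  proof induction
    case one
    then show ?case using q by simp
  next
    case (incl z)
    then show ?case by (rule base)
  next
    case (inv z)
    have "q \<otimes> inv z \<otimes> inv q = inv (q \<otimes> z \<otimes> inv q)"
      using q inv Z by (simp add: inv_mult_group m_assoc subset_iff)
    then show ?case using base[OF inv] by simp
  next
    case (eng k1 k2)
    have "k1 \<in> carrier G" "k2 \<in> carrier G" using eng H.subset by auto
    then have "q \<otimes> (k1 \<otimes> k2) \<otimes> inv q = (q \<otimes> k1 \<otimes> inv q) \<otimes> (q \<otimes> k2 \<otimes> inv q)"
      using q by (simp add: m_assoc)
    moreover have "(q \<otimes> k1 \<otimes> inv q) \<otimes> (q \<otimes> k2 \<otimes> inv q) \<in> generate G Z"
      using eng by (metis generate.eng)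
    ultimately show ?case by (simp only:)
  qed
  from p h show ?thesis
  proof (induction arbitrary: h)
    case one
    then show ?case using H.mem_carrier by simp
  next
    case (incl x)
    then have "x \<in> carrier G" using X by auto
    then show ?case by (rule conj_gen[OF _ conj[OF incl(1)] incl(2)])
  next
    case (inv x)
    have "x \<in> carrier G" using inv X by auto
    then have "inv x \<in> carrier G" "\<And>z. z \<in> Z \<Longrightarrow> inv x \<otimes> z \<otimes> inv (inv x) \<in> generate G Z"
      using conj_inv[OF inv(1)] by auto
    then show ?case by (rule conj_gen[OF _ _ inv(2)])
  next
    case (eng p1 p2)
    have c: "p1 \<in> carrier G" "p2 \<in> carrier G" "h \<in> carrier G"
      using eng generate_in_carrier[OF X] H.mem_carrier by auto
    have "p1 \<otimes> p2 \<otimes> h \<otimes> inv (p1 \<otimes> p2) = p1 \<otimes> (p2 \<otimes> h \<otimes> inv p2) \<otimes> inv p1"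
      using c by (simp add: inv_mult_group m_assoc)
    then show ?case using eng.IH eng.prems by (simp only:)
  qed
qed

text \<open>Commutators are multiplicative in each argument up to conjugation, so a subgroup that is
  normalized by both groups and contains the commutators of generators contains all commutators.\<close>

lemma gcomm_generate:
  assumes X: "X \<subseteq> carrier G" and Y: "Y \<subseteq> carrier G" and H: "subgroup H G"
    and norm: "\<And>p h. p \<in> generate G X \<union> generate G Y \<Longrightarrow> h \<in> H \<Longrightarrow> p \<otimes> h \<otimes> inv p \<in> H"
    and base: "\<And>x y. x \<in> X \<Longrightarrow> y \<in> Y \<Longrightarrow> gcomm G x y \<in> H"
    and p: "p \<in> generate G X" and q: "q \<in> generate G Y"
  shows "gcomm G p q \<in> H"
proof -
  interpret H: subgroup H G by fact
  have *: "gcomm G x q \<in> H" if x: "x \<in> X" for x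
    using q
  proof induction
    case one
    then show ?case using x X by auto
  next
    case (incl y)
    then show ?case using base x by simp
  next
    case (inv y)
    have c: "x \<in> carrier G" "y \<in> carrier G" using x X Y inv by auto
    have "inv y \<in> generate G Y" using inv by (simp add: generate.inv)
    moreover have "inv (gcomm G x y) \<in> H" using base[OF x inv] by simp
    ultimately have "inv y \<otimes> inv (gcomm G x y) \<otimes> inv (inv y) \<in> H" by (intro norm) auto
    moreover have "inv y \<otimes> inv (gcomm G x y) \<otimes> inv (inv y) = gcomm G x (inv y)"
      using c by (simp add: gcomm_def inv_mult_group m_assoc)
    ultimately show ?case by simp
  next
    case (eng y z)
    have c: "x \<in> carrier G" "y \<in> carrier G" "z \<in> carrier G"
      using x X eng generate_in_carrier[OF Y] by auto
    then show ?case using eng norm by (simp add: gcomm_mult_right')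
  qed
  have qc: "q \<in> carrier G" using q generate_in_carrier[OF Y] by auto
  from p show ?thesis
  proof induction
    case one
    then show ?case using qc by simp
  next
    case (incl x)
    then show ?case by (rule *)
  next
    case (inv x)
    have c: "x \<in> carrier G" using X inv by auto
    have "inv x \<in> generate G X" using inv by (simp add: generate.inv)
    moreover have "inv (gcomm G x q) \<in> H" using *[OF inv] by simp
    ultimately have "inv x \<otimes> inv (gcomm G x q) \<otimes> inv (inv x) \<in> H" by (intro norm) auto
    moreover have "inv x \<otimes> inv (gcomm G x q) \<otimes> inv (inv x) = gcomm G (inv x) q"
      using c qc by (simp add: gcomm_def inv_mult_group m_assoc)
    ultimately show ?case by simp
  next
    case (eng y z)
    have c: "y \<in> carrier G" "z \<in> carrier G"
      using eng generate_in_carrier[OF X] by auto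
    then show ?case using eng qc norm by (simp add: gcomm_mult_left')
  qed
qed

end

section \<open>Collecting bounded products in a filtered nilpotent group\<close>

text \<open>The sorted products along the list \<open>L\<close> of letters \<open>(g, a)\<close>, in which the exponent of a letter of
  weight \<open>a\<close> is at most \<open>c r\<^sup>a\<close>: at scale \<open>r\<close> a letter of weight \<open>a\<close> may be repeated \<open>r\<^sup>a\<close> times.
  The number of factors is fixed by the list, so membership with \<open>L\<close> and \<open>c\<close> independent of \<open>r\<close>
  means that an element is a bounded product of admissible powers. A constant \<open>c\<close> may depend on
  \<open>r\<close>; small values such as \<open>r\<^sup>-\<^sup>a\<close> are needed to record single letters.\<close>

fun pbox :: "('a, 'b) monoid_scheme \<Rightarrow> ('a \<times> real) list \<Rightarrow> real \<Rightarrow> real \<Rightarrow> 'a set" where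
  "pbox G [] c r = {\<one>\<^bsub>G\<^esub>}"
| "pbox G ((g, a) # L) c r =
     {g [^]\<^bsub>G\<^esub> n \<otimes>\<^bsub>G\<^esub> x | n x. \<bar>real_of_int n\<bar> \<le> c * r powr a \<and> x \<in> pbox G L c r}"

primrec pprod :: "('a, 'b) monoid_scheme \<Rightarrow> (nat \<Rightarrow> 'a) \<Rightarrow> nat \<Rightarrow> 'a" where
  "pprod G h 0 = \<one>\<^bsub>G\<^esub>"
| "pprod G h (Suc n) = pprod G h n \<otimes>\<^bsub>G\<^esub> h n"

context group begin

lemma pprod_closed [simp, intro]: "(\<And>i. i < n \<Longrightarrow> h i \<in> carrier G) \<Longrightarrow> pprod G h n \<in> carrier G"
  by (induction n) auto

lemma pprod_cong: "(\<And>i. i < n \<Longrightarrow> h i = h' i) \<Longrightarrow> pprod G h n = pprod G h' n"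
  by (induction n) auto

lemma pprod_const: "x \<in> carrier G \<Longrightarrow> pprod G (\<lambda>_. x) n = x [^] n"
  by (induction n) auto

text \<open>The basic collection step: moving all factors \<open>q\<^sub>i\<close> of a long product to the right conjugates
  each \<open>p\<^sub>i\<close> by the part of the second product that has passed over it.\<close>

lemma pprod_collect:
  assumes "\<And>i. i < n \<Longrightarrow> p i \<in> carrier G" "\<And>i. i < n \<Longrightarrow> q i \<in> carrier G"
  shows "pprod G (\<lambda>i. p i \<otimes> q i) n
    = pprod G (\<lambda>i. pprod G q i \<otimes> p i \<otimes> inv (pprod G q i)) n \<otimes> pprod G q n"
  using assms
proof (induction n)
  case (Suc n)
  have "pprod G q i \<in> carrier G" if "i \<le> n" for i using that Suc.prems by auto
  moreover have "pprod G (\<lambda>i. pprod G q i \<otimes> p i \<otimes> inv (pprod G q i)) n \<in> carrier G"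
    using Suc.prems by auto
  ultimately show ?case using Suc by (simp add: m_assoc)
qed simp

lemma pbox_carrier: "fst ` set L \<subseteq> carrier G \<Longrightarrow> pbox G L c r \<subseteq> carrier G"
proof (induction L)
  case (Cons p L)
  then have "fst p \<in> carrier G" "pbox G L c r \<subseteq> carrier G" by auto
  then show ?case by (cases p) (auto simp: subset_iff)
qed simp

lemma pbox_closed: "x \<in> pbox G L c r \<Longrightarrow> fst ` set L \<subseteq> carrier G \<Longrightarrow> x \<in> carrier G"
  using pbox_carrier by blast

lemma pbox_mono:
  assumes "c \<le> c'" shows "pbox G L c r \<subseteq> pbox G L c' r"
proof (induction L)
  case (Cons p L)
  obtain g a where p: "p = (g, a)" by force
  have "c * r powr a \<le> c' * r powr a" using assms by (simp add: mult_right_mono)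
  then show ?case using Cons unfolding p by force
qed simp

lemma one_in_pbox: "0 \<le> c \<Longrightarrow> fst ` set L \<subseteq> carrier G \<Longrightarrow> \<one> \<in> pbox G L c r"
proof (induction L)
  case (Cons p L)
  obtain g a where p: "p = (g, a)" by force
  have "\<one> = g [^] (0::int) \<otimes> \<one>" by simp
  moreover have "\<one> \<in> pbox G L c r" using Cons by simp
  ultimately show ?case using Cons.prems unfolding p by (force intro!: exI[of _ "0::int"])
qed simp

lemma pbox_append:
  assumes "fst ` set L \<subseteq> carrier G" "fst ` set L' \<subseteq> carrier G"
    and "x \<in> pbox G L c r" "y \<in> pbox G L' c r"
  shows "x \<otimes> y \<in> pbox G (L @ L') c r"
  using assms(1,3)
proof (induction L arbitrary: x)
  case Nil
  then show ?case using assms(4) pbox_closed[OF assms(4,2)] by simp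
next
  case (Cons p L)
  obtain g a where p: "p = (g, a)" by force
  obtain n z where nz: "x = g [^] (n::int) \<otimes> z" "\<bar>real_of_int n\<bar> \<le> c * r powr a" "z \<in> pbox G L c r"
    using Cons.prems unfolding p by auto
  have "g \<in> carrier G" "z \<in> carrier G" "y \<in> carrier G"
    using Cons.prems p pbox_closed[OF nz(3)] pbox_closed[OF assms(4,2)] by auto
  then have "x \<otimes> y = g [^] n \<otimes> (z \<otimes> y)" using nz by (simp add: m_assoc)
  moreover have "z \<otimes> y \<in> pbox G (L @ L') c r" using Cons nz by simp
  ultimately show ?case using nz p by auto
qed

lemma pbox_single:
  assumes "g \<in> carrier G"
  shows "pbox G [(g, a)] c r = {g [^] n | n :: int. \<bar>real_of_int n\<bar> \<le> c * r powr a}"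
  using assms by auto

lemma pbox_inv:
  assumes "fst ` set L \<subseteq> carrier G" "x \<in> pbox G L c r"
  shows "inv x \<in> pbox G (rev L) c r"
  using assms
proof (induction L arbitrary: x)
  case (Cons p L)
  obtain g a where p: "p = (g, a)" by force
  obtain n z where nz: "x = g [^] (n::int) \<otimes> z" "\<bar>real_of_int n\<bar> \<le> c * r powr a" "z \<in> pbox G L c r"
    using Cons.prems unfolding p by auto
  have c: "g \<in> carrier G" "z \<in> carrier G"
    using Cons.prems p pbox_closed[OF nz(3)] by auto
  then have "inv x = inv z \<otimes> g [^] (- n)" using nz by (simp add: inv_mult_group int_pow_neg)
  moreover have "inv z \<in> pbox G (rev L) c r" using Cons nz by simp
  moreover have "g [^] (- n) \<in> pbox G [(g, a)] c r"
    using c nz by (force simp: pbox_single[OF c(1)])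
  ultimately show ?case using p c Cons.prems pbox_append[of "rev L" "[(g, a)]"] by simp
qed simp

lemma pbox_append1:
  assumes "fst ` set L \<subseteq> carrier G" "fst ` set L' \<subseteq> carrier G" "0 \<le> c"
    and "x \<in> pbox G L c r"
  shows "x \<in> pbox G (L @ L') c r"
  using pbox_append[OF assms(1,2,4) one_in_pbox[OF assms(3,2)]] assms pbox_closed[OF assms(4,1)] by simp

lemma pbox_append2:
  assumes "fst ` set L \<subseteq> carrier G" "fst ` set L' \<subseteq> carrier G" "0 \<le> c"
    and "x \<in> pbox G L' c r"
  shows "x \<in> pbox G (L @ L') c r"
  using pbox_append[OF assms(1,2) one_in_pbox[OF assms(3,1)] assms(4)] assms pbox_closed[OF assms(4,2)] by simp

text \<open>The two identities below turn powers into long products of conjugates. They replace the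
  Hall-Petrescu formula: the conjugates differ from a constant by commutators of higher weight, and
  the long products are treated by induction on the weight.\<close>

lemma gcomm_pow_eq_pprod:
  assumes "x \<in> carrier G" "y \<in> carrier G"
  shows "gcomm G y (x [^] (n::nat)) = pprod G (\<lambda>i. x [^] i \<otimes> gcomm G y x \<otimes> inv (x [^] i)) n"
proof (induction n)
  case (Suc n)
  then show ?case using assms by (simp add: gcomm_mult_right')
qed (use assms in simp)

lemma mult_pow_eq_pprod:
  assumes "x \<in> carrier G" "y \<in> carrier G"
  shows "(x \<otimes> y) [^] (n::nat) = pprod G (\<lambda>i. x [^] Suc i \<otimes> y \<otimes> inv (x [^] Suc i)) n \<otimes> x [^] n"
proof (induction n)
  case (Suc n)
  have "pprod G (\<lambda>i. x [^] Suc i \<otimes> y \<otimes> inv (x [^] Suc i)) n \<in> carrier G"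
    using assms by (intro pprod_closed) auto
  moreover have "x \<otimes> inv (x [^] n \<otimes> x) = inv (x [^] n)"
    using assms by (simp add: inv_mult_group)
  ultimately show ?case using Suc assms by (simp add: m_assoc inv_mult_group)
qed simp

end

text \<open>A filtration by subgroups whose weights add under commutators and which ends at the trivial
  group. Only finitely many weights lie below any bound, so that inductions on the weight end.\<close>

locale weight_filtration = group G for G :: "('a, 'b) monoid_scheme" (structure) +
  fixes U :: "real set" and J :: "real \<Rightarrow> 'a set"
  assumes weight_pos: "w \<in> U \<Longrightarrow> 0 < w"
    and weights_finite: "finite {w \<in> U. w \<le> t}"
    and weight_add: "a \<in> U \<Longrightarrow> b \<in> U \<Longrightarrow> a + b \<in> U"
    and term_subgroup: "w \<in> U \<Longrightarrow> subgroup (J w) G"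
    and term_antimono: "a \<in> U \<Longrightarrow> b \<in> U \<Longrightarrow> a \<le> b \<Longrightarrow> J b \<subseteq> J a"
    and term_gcomm: "a \<in> U \<Longrightarrow> b \<in> U \<Longrightarrow> x \<in> J a \<Longrightarrow> y \<in> J b \<Longrightarrow> gcomm G x y \<in> J (a + b)"
    and term_trivial: "\<exists>t. \<forall>w \<in> U. t \<le> w \<longrightarrow> J w = {\<one>}"
begin

lemma term_closed: "w \<in> U \<Longrightarrow> x \<in> J w \<Longrightarrow> x \<in> carrier G"
  using term_subgroup subgroup.mem_carrier by metis

text \<open>The weight attached to a letter is the index of a term containing it and need not be the
  largest one possible.\<close>

definition letters :: "real \<Rightarrow> ('a \<times> real) set" where
  "letters w = {(g, a). a \<in> U \<and> w \<le> a \<and> g \<in> J a}"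

lemma letters_antimono: "v \<le> w \<Longrightarrow> letters w \<subseteq> letters v"
  by (auto simp: letters_def)

lemma letters_carrier: "set L \<subseteq> letters w \<Longrightarrow> fst ` set L \<subseteq> carrier G"
  using term_closed by (fastforce simp: letters_def)

lemma letters_append: "set L \<subseteq> letters w \<Longrightarrow> set L' \<subseteq> letters w' \<Longrightarrow> v \<le> w \<Longrightarrow> v \<le> w' \<Longrightarrow>
    set (L @ L') \<subseteq> letters v"
  using letters_antimono by fastforce

text \<open>A positive lower bound of the weights, and so the gain in every induction step. If there are
  no weights, any positive number serves.\<close>

definition weight_gap :: real where
  "weight_gap = (SOME d. 0 < d \<and> (\<forall>w \<in> U. d \<le> w))"

lemma weight_gap: "0 < weight_gap" "w \<in> U \<Longrightarrow> weight_gap \<le> w"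
proof -
  have "\<exists>d. 0 < d \<and> (\<forall>w \<in> U. d \<le> w)"
  proof (cases "U = {}")
    case True
    then show ?thesis by (auto intro!: exI[of _ 1])
  next
    case False
    then obtain v where v: "v \<in> U" by auto
    let ?S = "{w \<in> U. w \<le> v}"
    have S: "finite ?S" "v \<in> ?S" using weights_finite v by auto
    then have "Min ?S \<in> ?S" by (metis (no_types, lifting) Min_in empty_iff)
    moreover have "Min ?S \<le> w" if "w \<in> U" for w
      using that S by (cases "w \<le> v") (auto intro: order_trans[OF Min_le[of _ v]])
    ultimately show ?thesis using weight_pos by auto
  qed
  then have "0 < weight_gap \<and> (\<forall>w \<in> U. weight_gap \<le> w)"
    unfolding weight_gap_def by (rule someI_ex)
  then show "0 < weight_gap" "w \<in> U \<Longrightarrow> weight_gap \<le> w" by auto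
qed

text \<open>Commutators of boxes of sizes \<open>\<rho>\<close> and \<open>\<sigma>\<close> lie in boxes of size of order
  \<open>\<rho>\<sigma>\<close>. That the sizes multiply is what makes long products of commutators manageable below.\<close>

definition comm_estimate :: "real \<Rightarrow> real \<Rightarrow> ('a \<times> real) list \<Rightarrow> ('a \<times> real) list \<Rightarrow> ('a \<times> real) list \<Rightarrow> bool" where
  "comm_estimate \<kappa> K L1 L2 L \<longleftrightarrow>
     (\<forall>r \<rho> \<sigma> x y. 1 \<le> r \<longrightarrow> 0 \<le> \<rho> \<longrightarrow> \<rho> \<le> \<kappa> \<longrightarrow> 0 \<le> \<sigma> \<longrightarrow> \<sigma> \<le> \<kappa> \<longrightarrow>
        x \<in> pbox G L1 \<rho> r \<longrightarrow> y \<in> pbox G L2 \<sigma> r \<longrightarrow> gcomm G x y \<in> pbox G L (K * (\<rho> * \<sigma>)) r)"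

text \<open>A product of \<open>N\<close> elements of a box of size \<open>\<rho>\<close> lies in a box of size of order \<open>N \<rho>\<close>, as it would
  in an abelian group, as long as \<open>N \<rho>\<close> stays bounded.\<close>

definition prod_estimate :: "real \<Rightarrow> real \<Rightarrow> ('a \<times> real) list \<Rightarrow> ('a \<times> real) list \<Rightarrow> bool" where
  "prod_estimate \<kappa> K L L' \<longleftrightarrow>
     (\<forall>r \<rho> N h. 1 \<le> r \<longrightarrow> 0 \<le> \<rho> \<longrightarrow> real N * \<rho> \<le> \<kappa> \<longrightarrow> (\<forall>i<N. h i \<in> pbox G L \<rho> r) \<longrightarrow>
        pprod G h N \<in> pbox G L' (K * (real N * \<rho>)) r)"

lemma comm_estimateD:
  "comm_estimate \<kappa> K L1 L2 L \<Longrightarrow> 1 \<le> r \<Longrightarrow> 0 \<le> \<rho> \<Longrightarrow> \<rho> \<le> \<kappa> \<Longrightarrow> 0 \<le> \<sigma> \<Longrightarrow> \<sigma> \<le> \<kappa> \<Longrightarrow>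
    x \<in> pbox G L1 \<rho> r \<Longrightarrow> y \<in> pbox G L2 \<sigma> r \<Longrightarrow> gcomm G x y \<in> pbox G L (K * (\<rho> * \<sigma>)) r"
  by (simp add: comm_estimate_def)

lemma prod_estimateD:
  "prod_estimate \<kappa> K L L' \<Longrightarrow> 1 \<le> r \<Longrightarrow> 0 \<le> \<rho> \<Longrightarrow> real N * \<rho> \<le> \<kappa> \<Longrightarrow>
    (\<And>i. i < N \<Longrightarrow> h i \<in> pbox G L \<rho> r) \<Longrightarrow> pprod G h N \<in> pbox G L' (K * (real N * \<rho>)) r"
  by (simp add: prod_estimate_def)

definition comm_ctrl :: "real \<Rightarrow> real \<Rightarrow> ('a \<times> real) list \<Rightarrow> ('a \<times> real) list \<Rightarrow> bool" where
  "comm_ctrl w \<kappa> L1 L2 \<longleftrightarrow> (\<exists>L K. set L \<subseteq> letters w \<and> 0 \<le> K \<and> comm_estimate \<kappa> K L1 L2 L)"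

definition comm_bound :: "real \<Rightarrow> real \<Rightarrow> bool" where
  "comm_bound a b \<longleftrightarrow>
     (\<forall>\<kappa> L1 L2. 0 \<le> \<kappa> \<longrightarrow> set L1 \<subseteq> letters a \<longrightarrow> set L2 \<subseteq> letters b \<longrightarrow> comm_ctrl (a + b) \<kappa> L1 L2)"

definition prod_bound :: "real \<Rightarrow> bool" where
  "prod_bound w \<longleftrightarrow> (\<forall>\<kappa> L. 0 \<le> \<kappa> \<longrightarrow> set L \<subseteq> letters w \<longrightarrow>
     (\<exists>L' K. set L' \<subseteq> letters w \<and> 0 \<le> K \<and> prod_estimate \<kappa> K L L'))"

lemma comm_ctrlE:
  assumes "comm_ctrl w \<kappa> L1 L2"
  obtains L K where "set L \<subseteq> letters w" "0 \<le> K" "comm_estimate \<kappa> K L1 L2 L"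
  using assms unfolding comm_ctrl_def by blast

lemma comm_boundE:
  assumes "comm_bound a b" "0 \<le> \<kappa>" "set L1 \<subseteq> letters a" "set L2 \<subseteq> letters b"
  obtains L K where "set L \<subseteq> letters (a + b)" "0 \<le> K" "comm_estimate \<kappa> K L1 L2 L"
  using assms unfolding comm_bound_def comm_ctrl_def by blast

lemma prod_boundE:
  assumes "prod_bound w" "0 \<le> \<kappa>" "set L \<subseteq> letters w"
  obtains L' K where "set L' \<subseteq> letters w" "0 \<le> K" "prod_estimate \<kappa> K L L'"
  using assms unfolding prod_bound_def by blast

lemma pbox_up: "x \<in> pbox G L c r \<Longrightarrow> c \<le> c' \<Longrightarrow> x \<in> pbox G L c' r"
  using pbox_mono by blast

lemma conj_in_pbox:
  assumes L: "set L \<subseteq> letters w" "set L' \<subseteq> letters w'"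
    and c: "gcomm G x y \<in> pbox G L c r" "y \<in> pbox G L' c' r" "0 \<le> c" "0 \<le> c'"
    and x: "x \<in> carrier G"
  shows "x \<otimes> y \<otimes> inv x \<in> pbox G (L @ L') (c + c') r"
proof -
  have "y \<in> carrier G" using pbox_closed[OF c(2) letters_carrier[OF L(2)]] .
  then show ?thesis
    unfolding conj_eq_gcomm[OF x \<open>y \<in> carrier G\<close>]
    using c by (intro pbox_append letters_carrier[OF L(1)] letters_carrier[OF L(2)])
      (auto elim: pbox_up)
qed

text \<open>Collecting the letters one at a time: the letter powers \<open>p\<^sub>i\<close> pass over prefixes of the
  remaining product. The commutators that arise have at least twice the weight and, because
  \<open>N \<rho>\<close> is bounded, size of order \<open>\<rho>\<close> again; there are \<open>N\<close> of them, so the hypothesis for the doubled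
  weight applies.\<close>

lemma prod_bound_step:
  assumes C: "comm_bound w w" "comm_bound w (w + w)" and P: "prod_bound (w + w)" and w: "0 < w"
  shows "prod_bound w"
proof -
  have "\<exists>L' K. set L' \<subseteq> letters w \<and> 0 \<le> K \<and> prod_estimate \<kappa> K L L'"
    if \<kappa>: "0 \<le> \<kappa>" and "set L \<subseteq> letters w" for \<kappa> L
    using that(2)
  proof (induction L)
    case Nil
    have "pprod G h N = \<one>" if "\<forall>i<N. h i = \<one>" for h N
      using that by (induction N) auto
    then show ?case by (auto simp: prod_estimate_def intro!: exI[of _ "[]"] exI[of _ "0::real"])
  next
    case (Cons q L)
    obtain g a where q: "q = (g, a)" by force
    have ga: "set [(g, a)] \<subseteq> letters w" and L: "set L \<subseteq> letters w" using Cons.prems q by auto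
    have g: "g \<in> carrier G" using letters_carrier[OF ga] by simp
    obtain L1 K1 where L1: "set L1 \<subseteq> letters w" and K1: "0 \<le> K1"
      and 1: "prod_estimate \<kappa> K1 L L1"
      using Cons.IH[OF L] by blast
    note 1 = prod_estimateD[OF 1]
    obtain L2 K2 where L2: "set L2 \<subseteq> letters (w + w)" and K2: "0 \<le> K2"
      and 2: "comm_estimate (K1 * \<kappa> + \<kappa>) K2 L1 [(g, a)] L2"
      using comm_boundE[OF C(1) _ L1 ga, of "K1 * \<kappa> + \<kappa>"] \<kappa> K1 by auto
    note 2 = comm_estimateD[OF 2]
    define k2 where "k2 = K2 * (K1 * \<kappa>)"
    have k2: "0 \<le> k2" using K1 K2 \<kappa> by (simp add: k2_def)
    obtain L3 K3 where L3: "set L3 \<subseteq> letters (w + (w + w))" and K3: "0 \<le> K3"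
      and 3: "comm_estimate (\<kappa> + k2 * \<kappa>) K3 [(g, a)] L2 L3"
      using comm_boundE[OF C(2) _ ga L2, of "\<kappa> + k2 * \<kappa>"] \<kappa> k2 by auto
    note 3 = comm_estimateD[OF 3]
    have L32: "set (L3 @ L2) \<subseteq> letters (w + w)" using letters_append[OF L3 L2] w by simp
    define k4 where "k4 = K3 * (\<kappa> * k2) + k2"
    have k4: "0 \<le> k4" using K3 \<kappa> k2 by (simp add: k4_def)
    obtain L5 K5 where L5: "set L5 \<subseteq> letters (w + w)" and K5: "0 \<le> K5"
      and 5: "prod_estimate (k4 * \<kappa>) K5 (L3 @ L2) L5"
      using prod_boundE[OF P _ L32, of "k4 * \<kappa>"] \<kappa> k4 by auto
    note 5 = prod_estimateD[OF 5]
    define K where "K = K5 * k4 + 1 + K1"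
    have K: "0 \<le> K" using K5 k4 K1 by (simp add: K_def)
    have main: "pprod G h N \<in> pbox G (L5 @ ([(g, a)] @ L1)) (K * (real N * \<rho>)) r"
      if r: "1 \<le> r" and \<rho>: "0 \<le> \<rho>" and N: "real N * \<rho> \<le> \<kappa>"
        and h: "\<And>i. i < N \<Longrightarrow> h i \<in> pbox G ((g, a) # L) \<rho> r" for r \<rho> N h
    proof -
      have "\<forall>i<N. \<exists>n z. h i = g [^] (n::int) \<otimes> z \<and> \<bar>real_of_int n\<bar> \<le> \<rho> * r powr a \<and> z \<in> pbox G L \<rho> r"
        using h by auto
      then obtain n z where nz: "\<And>i. i < N \<Longrightarrow> h i = g [^] (n i::int) \<otimes> z i"
          "\<And>i. i < N \<Longrightarrow> \<bar>real_of_int (n i)\<bar> \<le> \<rho> * r powr a" "\<And>i. i < N \<Longrightarrow> z i \<in> pbox G L \<rho> r"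
        by metis
      have zc: "z i \<in> carrier G" if "i < N" for i
        using pbox_closed[OF nz(3)[OF that] letters_carrier[OF L]] .
      \<comment> \<open>First the tail of each factor is collected to the right, then the letter powers \<open>p\<^sub>i\<close>.\<close>
      define p where "p i = g [^] n i" for i
      have pc: "p i \<in> carrier G" for i using g by (simp add: p_def)
      have sub: "real i * \<rho> \<le> real N * \<rho>" "real i * \<rho> \<le> \<kappa>" if "i \<le> N" for i
        using that \<rho> by (auto intro!: order_trans[OF _ N] mult_right_mono)
      have Qi: "pprod G z i \<in> pbox G L1 (K1 * (real N * \<rho>)) r" if "i \<le> N" for i
      proof (rule pbox_up)
        show "pprod G z i \<in> pbox G L1 (K1 * (real i * \<rho>)) r"
          using that by (intro 1 r \<rho> sub nz(3)) auto
        show "K1 * (real i * \<rho>) \<le> K1 * (real N * \<rho>)"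
          by (rule mult_left_mono[OF sub(1)[OF that] K1])
      qed
      have Qc: "pprod G z i \<in> carrier G" if "i \<le> N" for i
        using that zc by (intro pprod_closed) auto
      have Pi: "pprod G p i = g [^] (\<Sum>j<i. n j)" if "i \<le> N" for i
        using that by (induction i) (simp_all add: p_def int_pow_mult g)
      have Psum: "\<bar>real_of_int (\<Sum>j<i. n j)\<bar> \<le> (real N * \<rho>) * r powr a" if "i \<le> N" for i
      proof -
        have "\<bar>real_of_int (\<Sum>j<i. n j)\<bar> \<le> (\<Sum>j<i. \<bar>real_of_int (n j)\<bar>)" by simp
        also have "\<dots> \<le> (\<Sum>j<i. \<rho> * r powr a)" using that nz(2) by (intro sum_mono) auto
        also have "\<dots> = (real i * \<rho>) * r powr a" by simp
        also have "\<dots> \<le> (real N * \<rho>) * r powr a" by (rule mult_right_mono[OF sub(1)[OF that]]) simp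
        finally show ?thesis .
      qed
      have Pbox: "pprod G p i \<in> pbox G [(g, a)] (real N * \<rho>) r" if "i \<le> N" for i
        unfolding pbox_single[OF g] Pi[OF that] using Psum[OF that] by blast
      have P0: "0 \<le> real N * \<rho>" using \<rho> by simp
      have \<rho>': "\<rho> \<le> \<kappa>" if "0 < N"
        using sub(2)[of 1] that by simp
      define c where "c i = gcomm G (pprod G z i) (p i)" for i
      have ci: "c i \<in> pbox G L2 (k2 * \<rho>) r" if "i < N" for i
      proof -
        have "p i \<in> pbox G [(g, a)] \<rho> r" using nz(2)[OF that] unfolding p_def pbox_single[OF g] by blast
        moreover have "0 \<le> K1 * (real N * \<rho>)" "K1 * (real N * \<rho>) \<le> K1 * \<kappa> + \<kappa>" "\<rho> \<le> K1 * \<kappa> + \<kappa>"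
          using K1 P0 \<kappa> N mult_left_mono[OF N K1] \<rho>' that by (auto intro: add_increasing2 add_increasing)
        ultimately have "c i \<in> pbox G L2 (K2 * (K1 * (real N * \<rho>) * \<rho>)) r"
          unfolding c_def using that by (intro 2 r \<rho> Qi) auto
        moreover have "K2 * (K1 * (real N * \<rho>) * \<rho>) \<le> k2 * \<rho>"
          unfolding k2_def mult.assoc
          using mult_left_mono[OF mult_left_mono[OF mult_right_mono[OF N \<rho>] K1] K2] by (simp add: mult.assoc)
        ultimately show ?thesis by (rule pbox_up)
      qed
      have cc: "c i \<in> carrier G" if "i < N" for i using pbox_closed[OF ci[OF that] letters_carrier[OF L2]] .
      define e where "e i = pprod G p i \<otimes> c i \<otimes> inv (pprod G p i)" for i
      have ei: "e i \<in> pbox G (L3 @ L2) (k4 * \<rho>) r" if "i < N" for i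
      proof -
        have b: "0 \<le> k2 * \<rho>" "k2 * \<rho> \<le> \<kappa> + k2 * \<kappa>" "real N * \<rho> \<le> \<kappa> + k2 * \<kappa>"
          using k2 \<rho> \<rho>' that \<kappa> N by (auto intro: add_increasing add_increasing2 mult_left_mono)
        have "gcomm G (pprod G p i) (c i) \<in> pbox G L3 (K3 * ((real N * \<rho>) * (k2 * \<rho>))) r"
          using that b by (intro 3 r P0 Pbox ci) auto
        then have "e i \<in> pbox G (L3 @ L2) (K3 * ((real N * \<rho>) * (k2 * \<rho>)) + k2 * \<rho>) r"
          unfolding e_def using K3 P0 b pc by (intro conj_in_pbox[OF L3 L2] ci[OF that] pprod_closed) auto
        moreover have "K3 * ((real N * \<rho>) * (k2 * \<rho>)) \<le> K3 * (\<kappa> * k2) * \<rho>"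
          using mult_left_mono[OF mult_right_mono[OF N b(1)] K3] by (simp add: mult.assoc)
        ultimately show ?thesis
          unfolding k4_def distrib_right by (elim pbox_up) simp
      qed
      have "pprod G h N = pprod G (\<lambda>i. p i \<otimes> z i) N"
        using nz(1) by (intro pprod_cong) (simp add: p_def)
      also have "\<dots> = pprod G (\<lambda>i. pprod G z i \<otimes> p i \<otimes> inv (pprod G z i)) N \<otimes> pprod G z N"
        using pc zc by (intro pprod_collect) auto
      also have "pprod G (\<lambda>i. pprod G z i \<otimes> p i \<otimes> inv (pprod G z i)) N = pprod G (\<lambda>i. c i \<otimes> p i) N"
        unfolding c_def using Qc pc by (intro pprod_cong conj_eq_gcomm) auto
      also have "\<dots> = pprod G e N \<otimes> pprod G p N"
        unfolding e_def using cc pc by (intro pprod_collect) auto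
      finally have eq: "pprod G h N = (pprod G e N \<otimes> pprod G p N) \<otimes> pprod G z N" .
      have "real N * (k4 * \<rho>) \<le> k4 * \<kappa>"
        using mult_left_mono[OF N k4] by (simp add: mult.left_commute)
      then have eN: "pprod G e N \<in> pbox G L5 (K5 * (real N * (k4 * \<rho>))) r"
        using ei k4 \<rho> by (intro 5 r) auto
      have "pprod G e N \<otimes> (pprod G p N \<otimes> pprod G z N)
          \<in> pbox G (L5 @ ([(g, a)] @ L1)) (K * (real N * \<rho>)) r"
      proof (intro pbox_append letters_carrier[OF L5] letters_carrier[OF ga] letters_carrier[OF L1])
        show "pprod G e N \<in> pbox G L5 (K * (real N * \<rho>)) r"
          using K1 P0 by (intro pbox_up[OF eN]) (simp add: K_def algebra_simps)
        show "pprod G p N \<in> pbox G [(g, a)] (K * (real N * \<rho>)) r"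
          using K1 P0 K5 k4 by (intro pbox_up[OF Pbox]) (auto simp: K_def distrib_right)
        show "pprod G z N \<in> pbox G L1 (K * (real N * \<rho>)) r"
          using K1 P0 K5 k4 by (intro pbox_up[OF Qi]) (auto simp: K_def distrib_right)
        show "fst ` set ([(g, a)] @ L1) \<subseteq> carrier G"
          using letters_carrier[OF ga] letters_carrier[OF L1] by auto
      qed
      moreover have "pprod G e N \<in> carrier G"
        using pbox_closed[OF eN letters_carrier[OF L5]] .
      ultimately show ?thesis
        using eq pc zc by (simp add: m_assoc)
    qed
    have "set (L5 @ ([(g, a)] @ L1)) \<subseteq> letters w"
      using L5 ga L1 letters_antimono[of w "w + w"] w by auto
    then show ?case
      unfolding q prod_estimate_def using main K by blast
  qed
  then show ?thesis unfolding prod_bound_def by blast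
qed


definition power_estimate :: "real \<Rightarrow> real \<Rightarrow> 'a \<times> real \<Rightarrow> ('a \<times> real) list \<Rightarrow> ('a \<times> real) list \<Rightarrow> bool" where
  "power_estimate \<kappa> K = (\<lambda>(x, a) L L'. \<forall>r \<rho> \<tau> n y. 1 \<le> r \<longrightarrow> 0 \<le> \<rho> \<longrightarrow> \<rho> \<le> \<kappa> \<longrightarrow> 0 \<le> \<tau> \<longrightarrow> \<tau> \<le> \<kappa> \<longrightarrow>
     \<bar>real_of_int n\<bar> \<le> \<rho> * r powr a \<longrightarrow> \<bar>real_of_int n\<bar> * \<tau> \<le> \<kappa> \<longrightarrow> y \<in> carrier G \<longrightarrow>
     gcomm G y x \<in> pbox G L \<tau> r \<longrightarrow> gcomm G y (x [^] n) \<in> pbox G L' (K * (\<bar>real_of_int n\<bar> * \<tau>)) r)"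

lemma power_estimateD:
  "power_estimate \<kappa> K (x, a) L L' \<Longrightarrow> 1 \<le> r \<Longrightarrow> 0 \<le> \<rho> \<Longrightarrow> \<rho> \<le> \<kappa> \<Longrightarrow> 0 \<le> \<tau> \<Longrightarrow> \<tau> \<le> \<kappa> \<Longrightarrow>
    \<bar>real_of_int n\<bar> \<le> \<rho> * r powr a \<Longrightarrow> \<bar>real_of_int n\<bar> * \<tau> \<le> \<kappa> \<Longrightarrow> y \<in> carrier G \<Longrightarrow>
    gcomm G y x \<in> pbox G L \<tau> r \<Longrightarrow> gcomm G y (x [^] n) \<in> pbox G L' (K * (\<bar>real_of_int n\<bar> * \<tau>)) r"
  by (simp add: power_estimate_def)

text \<open>\<open>[y, x\<^sup>n]\<close> is a product of \<open>n\<close> conjugates of \<open>[y, x]\<close> by powers of \<open>x\<close>, and each of them is \<open>[y, x]\<close>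
  up to a commutator of higher weight. The element \<open>y\<close> is arbitrary, so the lemma can be applied first
  to a letter and then to a power of a letter.\<close>

lemma gcomm_pow_bound:
  assumes C: "comm_bound a w" and P: "prod_bound w" and a: "0 < a"
    and x: "(x, a') \<in> letters a" and L: "set L \<subseteq> letters w" and \<kappa>: "0 \<le> \<kappa>"
  obtains L' K where "set L' \<subseteq> letters w" "0 \<le> K" "power_estimate \<kappa> K (x, a') L L'"
proof -
  have x': "set [(x, a')] \<subseteq> letters a" using x by simp
  have xc: "x \<in> carrier G" using letters_carrier[OF x'] by simp
  obtain L5 K5 where L5: "set L5 \<subseteq> letters (a + w)" and K5: "0 \<le> K5"
    and 5: "comm_estimate \<kappa> K5 [(x, a')] L L5"
    using comm_boundE[OF C \<kappa> x' L] by blast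
  note 5 = comm_estimateD[OF 5]
  have L5L: "set (L5 @ L) \<subseteq> letters w" using letters_append[OF L5 L] a by simp
  define k where "k = K5 * \<kappa> + 1"
  have k: "0 \<le> k" using K5 \<kappa> by (simp add: k_def)
  obtain L6 K6 where L6: "set L6 \<subseteq> letters w" and K6: "0 \<le> K6"
    and 6: "prod_estimate (k * \<kappa>) K6 (L5 @ L) L6"
    using prod_boundE[OF P _ L5L, of "k * \<kappa>"] k \<kappa> by auto
  note 6 = prod_estimateD[OF 6]
  define K7 where "K7 = K6 * k"
  have K7: "0 \<le> K7" using K6 k by (simp add: K7_def)
  have pos: "gcomm G y (x [^] m) \<in> pbox G L6 (K7 * (real m * \<tau>)) r"
    if r: "1 \<le> r" and \<rho>: "0 \<le> \<rho>" "\<rho> \<le> \<kappa>" and \<tau>: "0 \<le> \<tau>" "\<tau> \<le> \<kappa>"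
      and m: "real m \<le> \<rho> * r powr a'" "real m * \<tau> \<le> \<kappa>" and y: "y \<in> carrier G"
      and yx: "gcomm G y x \<in> pbox G L \<tau> r" for r \<rho> \<tau> y and m :: nat
  proof -
    have "x [^] i \<otimes> gcomm G y x \<otimes> inv (x [^] i) \<in> pbox G (L5 @ L) (k * \<tau>) r" if i: "i < m" for i
    proof -
      have "x [^] i \<in> pbox G [(x, a')] \<rho> r"
        unfolding pbox_single[OF xc] using i m(1) by (intro CollectI exI[of _ "int i"]) (simp add: int_pow_int)
      then have "gcomm G (x [^] i) (gcomm G y x) \<in> pbox G L5 (K5 * (\<rho> * \<tau>)) r"
        using yx by (intro 5 r \<rho> \<tau>) auto
      then have "x [^] i \<otimes> gcomm G y x \<otimes> inv (x [^] i) \<in> pbox G (L5 @ L) (K5 * (\<rho> * \<tau>) + \<tau>) r"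
        using K5 \<rho> \<tau> xc by (intro conj_in_pbox[OF L5 L] yx) auto
      moreover have "K5 * (\<rho> * \<tau>) + \<tau> \<le> k * \<tau>"
        using mult_left_mono[OF mult_right_mono[OF \<rho>(2) \<tau>(1)] K5] by (simp add: k_def algebra_simps)
      ultimately show ?thesis by (rule pbox_up)
    qed
    moreover have "real m * (k * \<tau>) \<le> k * \<kappa>"
      using mult_left_mono[OF m(2) k] by (simp add: mult.left_commute)
    ultimately have "gcomm G y (x [^] m) \<in> pbox G L6 (K6 * (real m * (k * \<tau>))) r"
      unfolding gcomm_pow_eq_pprod[OF xc y] using k \<tau> by (intro 6 r) auto
    moreover have "K6 * (real m * (k * \<tau>)) = K7 * (real m * \<tau>)" by (simp add: K7_def)
    ultimately show ?thesis by simp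
  qed
  have rL6: "set (rev L6) \<subseteq> letters w" using L6 by simp
  obtain L8 K8 where L8: "set L8 \<subseteq> letters (a + w)" and K8: "0 \<le> K8"
    and 8: "comm_estimate (\<kappa> + K7 * \<kappa>) K8 [(x, a')] (rev L6) L8"
    using comm_boundE[OF C _ x' rL6, of "\<kappa> + K7 * \<kappa>"] K7 \<kappa> by auto
  note 8 = comm_estimateD[OF 8]
  define K where "K = K8 * \<kappa> * K7 + K7"
  have K: "K7 \<le> K" "0 \<le> K" using K8 K7 \<kappa> by (auto simp: K_def)
  have L8': "set (L8 @ rev L6) \<subseteq> letters w" using letters_append[OF L8 rL6] a by simp
  show ?thesis
  proof (rule that)
    show "set (L6 @ (L8 @ rev L6)) \<subseteq> letters w" using L6 L8' by auto
    show "0 \<le> K" by fact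
    show "power_estimate \<kappa> K (x, a') L (L6 @ (L8 @ rev L6))"
      unfolding power_estimate_def prod.case
    proof (intro allI impI)
      fix r \<rho> \<tau> :: real and n :: int and y
      assume r: "1 \<le> r" and \<rho>: "0 \<le> \<rho>" "\<rho> \<le> \<kappa>" and \<tau>: "0 \<le> \<tau>" "\<tau> \<le> \<kappa>"
        and n: "\<bar>real_of_int n\<bar> \<le> \<rho> * r powr a'" "\<bar>real_of_int n\<bar> * \<tau> \<le> \<kappa>" and y: "y \<in> carrier G"
        and yx: "gcomm G y x \<in> pbox G L \<tau> r"
      define m where "m = nat \<bar>n\<bar>"
      have m: "real m = \<bar>real_of_int n\<bar>" by (simp add: m_def)
      have m0: "0 \<le> real m * \<tau>" using \<tau> by simp
      have p: "gcomm G y (x [^] m) \<in> pbox G L6 (K7 * (real m * \<tau>)) r"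
        using n by (intro pos[OF r \<rho> \<tau> _ _ y yx]) (simp_all add: m)
      have le: "K7 * (real m * \<tau>) \<le> K * (real m * \<tau>)" using K m0 by (intro mult_right_mono) auto
      show "gcomm G y (x [^] n) \<in> pbox G (L6 @ (L8 @ rev L6)) (K * (\<bar>real_of_int n\<bar> * \<tau>)) r"
      proof (cases "0 \<le> n")
        case True
        then have "x [^] n = x [^] m" by (simp add: m_def flip: int_pow_int)
        moreover have "gcomm G y (x [^] m) \<in> pbox G (L6 @ (L8 @ rev L6)) (K * (real m * \<tau>)) r"
          using K m0 by (intro pbox_append1[OF letters_carrier[OF L6] letters_carrier[OF L8'] _ pbox_up[OF p le]]) auto
        ultimately show ?thesis by (simp add: m)
      next
        case False
        then have xn: "x [^] n = inv (x [^] m)"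
          using xc by (simp add: m_def flip: int_pow_int int_pow_neg)
        define z where "z = inv (gcomm G y (x [^] m))"
        have z: "z \<in> pbox G (rev L6) (K7 * (real m * \<tau>)) r"
          unfolding z_def by (rule pbox_inv[OF letters_carrier[OF L6] p])
        have xb: "x [^] n \<in> pbox G [(x, a')] \<rho> r"
          unfolding pbox_single[OF xc] using n(1) by blast
        have b: "0 \<le> K7 * (real m * \<tau>)" "K7 * (real m * \<tau>) \<le> K7 * \<kappa>"
          using K7 m0 n(2) by (auto intro: mult_left_mono simp: m)
        have "gcomm G (x [^] n) z \<in> pbox G L8 (K8 * (\<rho> * (K7 * (real m * \<tau>)))) r"
          using b \<rho> \<kappa> K7 by (intro 8 r xb z) (auto intro: add_increasing add_increasing2)
        then have "x [^] n \<otimes> z \<otimes> inv (x [^] n)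
            \<in> pbox G (L8 @ rev L6) (K8 * (\<rho> * (K7 * (real m * \<tau>))) + K7 * (real m * \<tau>)) r"
          using K8 \<rho> b xc by (intro conj_in_pbox[OF L8 rL6] z) auto
        moreover have "K8 * (\<rho> * (K7 * (real m * \<tau>))) + K7 * (real m * \<tau>) \<le> K * (real m * \<tau>)"
          using mult_left_mono[OF mult_right_mono[OF \<rho>(2) b(1)] K8] by (simp add: K_def algebra_simps)
        ultimately have "x [^] n \<otimes> z \<otimes> inv (x [^] n) \<in> pbox G (L8 @ rev L6) (K * (real m * \<tau>)) r"
          by (rule pbox_up)
        moreover have "x [^] n \<otimes> z \<otimes> inv (x [^] n) = gcomm G y (x [^] n)"
          using xc y unfolding z_def xn by (simp add: gcomm_def inv_mult_group m_assoc)
        ultimately have "gcomm G y (x [^] n) \<in> pbox G (L8 @ rev L6) (K * (real m * \<tau>)) r" by simp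
        then have "gcomm G y (x [^] n) \<in> pbox G (L6 @ (L8 @ rev L6)) (K * (real m * \<tau>)) r"
          using K m0 by (intro pbox_append2[OF letters_carrier[OF L6] letters_carrier[OF L8']]) auto
        then show ?thesis by (simp add: m)
      qed
    qed
  qed
qed

text \<open>The previous lemma is used once for each argument. It starts from \<open>[y, x]\<close>, a single letter of
  weight \<open>w = \<alpha> + \<beta>\<close>, which lies in a box of size \<open>r\<^sup>-\<^sup>w\<close>.\<close>

lemma comm_ctrl_letters:
  assumes C: "\<And>c d. weight_gap \<le> c \<Longrightarrow> weight_gap \<le> d \<Longrightarrow> a + b + weight_gap \<le> c + d \<Longrightarrow> comm_bound c d"
    and P: "\<And>w. a + b \<le> w \<Longrightarrow> prod_bound w"
    and ab: "weight_gap \<le> a" "weight_gap \<le> b"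
    and x: "(x, \<alpha>) \<in> letters a" and y: "(y, \<beta>) \<in> letters b" and \<kappa>: "0 \<le> \<kappa>"
  shows "comm_ctrl (a + b) \<kappa> [(x, \<alpha>)] [(y, \<beta>)]"
proof -
  define w where "w = \<alpha> + \<beta>"
  have U: "\<alpha> \<in> U" "\<beta> \<in> U" and J: "x \<in> J \<alpha>" "y \<in> J \<beta>" and le: "a \<le> \<alpha>" "b \<le> \<beta>"
    using x y by (auto simp: letters_def)
  have lw: "0 < weight_gap" by (rule weight_gap)
  have xc: "x \<in> carrier G" and yc: "y \<in> carrier G" using U J term_closed by auto
  have z: "set [(gcomm G y x, w)] \<subseteq> letters w"
    using U J term_gcomm[of \<beta> \<alpha> y x] weight_add by (auto simp: letters_def w_def add.commute)
  have pos: "0 < \<alpha>" "0 < \<beta>" using U weight_pos by auto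
  define \<kappa>1 where "\<kappa>1 = \<kappa> + 1"
  have \<kappa>1: "0 \<le> \<kappa>1" "\<kappa> \<le> \<kappa>1" "1 \<le> \<kappa>1" using \<kappa> by (auto simp: \<kappa>1_def)
  have x': "(x, \<alpha>) \<in> letters \<alpha>" and y': "(y, \<beta>) \<in> letters \<beta>" using U J by (auto simp: letters_def)
  have C1: "comm_bound \<alpha> w" and C2: "comm_bound \<beta> w" and P1: "prod_bound w"
    using ab le lw by (auto intro!: C P simp: w_def)
  obtain L1 K1 where L1: "set L1 \<subseteq> letters w" and K1: "0 \<le> K1"
    and 1: "power_estimate \<kappa>1 K1 (x, \<alpha>) [(gcomm G y x, w)] L1"
    by (rule gcomm_pow_bound[OF C1 P1 pos(1) x' z \<kappa>1(1)]) (rule that)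
  note 1 = power_estimateD[OF 1]
  define \<kappa>2 where "\<kappa>2 = \<kappa> + K1 * \<kappa> + K1 * (\<kappa> * \<kappa>)"
  have \<kappa>2: "0 \<le> \<kappa>2" "\<kappa> \<le> \<kappa>2" "K1 * \<kappa> \<le> \<kappa>2" "K1 * (\<kappa> * \<kappa>) \<le> \<kappa>2"
    using K1 \<kappa> by (auto simp: \<kappa>2_def)
  have rL1: "set (rev L1) \<subseteq> letters w" using L1 by simp
  obtain L2 K2 where L2: "set L2 \<subseteq> letters w" and K2: "0 \<le> K2"
    and 2: "power_estimate \<kappa>2 K2 (y, \<beta>) (rev L1) L2"
    by (rule gcomm_pow_bound[OF C2 P1 pos(2) y' rL1 \<kappa>2(1)]) (rule that)
  note 2 = power_estimateD[OF 2]
  have "gcomm G p q \<in> pbox G L2 (K2 * K1 * (\<rho> * \<sigma>)) r"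
    if r: "1 \<le> r" and \<rho>: "0 \<le> \<rho>" "\<rho> \<le> \<kappa>" and \<sigma>: "0 \<le> \<sigma>" "\<sigma> \<le> \<kappa>"
      and p: "p \<in> pbox G [(x, \<alpha>)] \<rho> r" and q: "q \<in> pbox G [(y, \<beta>)] \<sigma> r" for r \<rho> \<sigma> p q
  proof -
    obtain n where n: "p = x [^] (n::int)" "\<bar>real_of_int n\<bar> \<le> \<rho> * r powr \<alpha>"
      using p unfolding pbox_single[OF xc] by blast
    obtain k where k: "q = y [^] (k::int)" "\<bar>real_of_int k\<bar> \<le> \<sigma> * r powr \<beta>"
      using q unfolding pbox_single[OF yc] by blast
    define \<tau> where "\<tau> = r powr - w"
    have b1: "0 < \<beta>" "0 < w" using U weight_pos by (auto simp: w_def add_pos_pos)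
    have r1: "r powr - \<beta> \<le> 1" "\<tau> \<le> 1" "0 \<le> \<tau>"
      using r b1 by (auto simp: \<tau>_def powr_minus ge_one_powr_ge_zero inverse_le_1_iff)
    have n\<tau>: "\<bar>real_of_int n\<bar> * \<tau> \<le> \<rho> * r powr - \<beta>"
    proof -
      have "\<bar>real_of_int n\<bar> * \<tau> \<le> (\<rho> * r powr \<alpha>) * \<tau>" using n(2) r1 by (intro mult_right_mono)
      also have "\<dots> = \<rho> * r powr - \<beta>" by (simp add: \<tau>_def w_def flip: powr_add)
      finally show ?thesis .
    qed
    have \<rho>1: "\<rho> * r powr - \<beta> \<le> \<kappa>" using mult_mono[OF \<rho>(2) r1(1)] \<kappa> by simp
    have "gcomm G y x \<in> pbox G [(gcomm G y x, w)] \<tau> r"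
    proof -
      have "\<tau> * r powr w = 1" using r by (simp add: \<tau>_def flip: powr_add)
      then show ?thesis
        unfolding pbox_single[OF gcomm_closed[OF yc xc]] using xc yc
        by (intro CollectI exI[of _ 1]) auto
    qed
    then have "gcomm G y (x [^] n) \<in> pbox G L1 (K1 * (\<bar>real_of_int n\<bar> * \<tau>)) r"
      using \<rho> \<kappa>1 r1 n(2) n\<tau> \<rho>1 by (intro 1 r yc) auto
    then have "gcomm G y p \<in> pbox G L1 (K1 * (\<rho> * r powr - \<beta>)) r"
      using mult_left_mono[OF n\<tau> K1] n(1) by (auto elim: pbox_up)
    then have "inv (gcomm G y p) \<in> pbox G (rev L1) (K1 * (\<rho> * r powr - \<beta>)) r"
      by (rule pbox_inv[OF letters_carrier[OF L1]])
    then have py: "gcomm G p y \<in> pbox G (rev L1) (K1 * (\<rho> * r powr - \<beta>)) r"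
      using xc yc n by (simp add: inv_gcomm)
    let ?\<tau> = "K1 * (\<rho> * r powr - \<beta>)"
    have t0: "0 \<le> ?\<tau>" using K1 \<rho> by simp
    have t1: "?\<tau> \<le> \<kappa>2" using mult_left_mono[OF \<rho>1 K1] \<kappa>2 by simp
    have kt: "\<bar>real_of_int k\<bar> * ?\<tau> \<le> K1 * (\<rho> * \<sigma>)"
    proof -
      have "\<bar>real_of_int k\<bar> * ?\<tau> \<le> (\<sigma> * r powr \<beta>) * ?\<tau>" using k(2) t0 by (intro mult_right_mono)
      also have "\<dots> = K1 * (\<rho> * \<sigma>) * (r powr \<beta> * r powr - \<beta>)" by simp
      also have "\<dots> = K1 * (\<rho> * \<sigma>)" using r by (simp flip: powr_add)
      finally show ?thesis .
    qed
    have "K1 * (\<rho> * \<sigma>) \<le> \<kappa>2"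
      using mult_left_mono[OF mult_mono[OF \<rho>(2) \<sigma>(2)] K1] \<rho> \<sigma> \<kappa> \<kappa>2(4) by simp
    then have "gcomm G p (y [^] k) \<in> pbox G L2 (K2 * (\<bar>real_of_int k\<bar> * ?\<tau>)) r"
      using \<sigma> \<kappa>2 kt t0 t1 k n xc by (intro 2[of r \<sigma>] r py) auto
    moreover have "K2 * (\<bar>real_of_int k\<bar> * ?\<tau>) \<le> K2 * K1 * (\<rho> * \<sigma>)"
      using mult_left_mono[OF kt K2] by simp
    ultimately show ?thesis using k(1) by (auto elim: pbox_up)
  qed
  moreover have "set L2 \<subseteq> letters (a + b)" using L2 letters_antimono[of "a + b" w] le by (auto simp: w_def)
  ultimately show ?thesis
    unfolding comm_ctrl_def comm_estimate_def using K1 K2 by (intro exI[of _ L2] exI[of _ "K2 * K1"]) auto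
qed

lemma comm_ctrl_sym:
  assumes "comm_ctrl w \<kappa> L1 L2" and c: "fst ` set L1 \<subseteq> carrier G" "fst ` set L2 \<subseteq> carrier G"
  shows "comm_ctrl w \<kappa> L2 L1"
proof -
  obtain L K where L: "set L \<subseteq> letters w" and K: "0 \<le> K"
    and b: "comm_estimate \<kappa> K L1 L2 L"
    using assms(1) by (elim comm_ctrlE) (rule that)
  note b = comm_estimateD[OF b]
  have "gcomm G y x \<in> pbox G (rev L) (K * (\<sigma> * \<rho>)) r"
    if "1 \<le> r" "0 \<le> \<rho>" "\<rho> \<le> \<kappa>" "0 \<le> \<sigma>" "\<sigma> \<le> \<kappa>" "x \<in> pbox G L1 \<rho> r" "y \<in> pbox G L2 \<sigma> r"
    for r \<rho> \<sigma> x y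
    using pbox_inv[OF letters_carrier[OF L] b[OF that]] pbox_closed[OF that(6) c(1)]
      pbox_closed[OF that(7) c(2)] by (simp add: inv_gcomm mult.commute)
  then show ?thesis
    unfolding comm_ctrl_def comm_estimate_def using L K by (intro exI[of _ "rev L"] exI[of _ K]) auto
qed

lemma comm_ctrl_Nil: "fst ` set L \<subseteq> carrier G \<Longrightarrow> comm_ctrl w \<kappa> L []"
  using pbox_closed by (auto simp: comm_ctrl_def comm_estimate_def intro!: exI[of _ "[]"] exI[of _ "0::real"])

text \<open>\<open>[x, p z] = [x, p] [p, [x, z]] [x, z]\<close>, and the middle factor has higher weight.\<close>

lemma comm_ctrl_Cons:
  assumes C: "comm_bound b w" and b: "0 < b" and \<kappa>: "0 \<le> \<kappa>"
    and L1: "set L1 \<subseteq> letters a" and L2: "set (l # L2) \<subseteq> letters b"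
    and c: "comm_ctrl w \<kappa> L1 [l]" "comm_ctrl w \<kappa> L1 L2"
  shows "comm_ctrl w \<kappa> L1 (l # L2)"
proof -
  obtain g \<beta> where l: "l = (g, \<beta>)" by force
  have l': "set [l] \<subseteq> letters b" and L2': "set L2 \<subseteq> letters b" using L2 by auto
  have gc: "g \<in> carrier G" using letters_carrier[OF l'] l by simp
  obtain L3 K3 where L3: "set L3 \<subseteq> letters w" and K3: "0 \<le> K3"
    and 3: "comm_estimate \<kappa> K3 L1 [l] L3"
    using c(1) by (elim comm_ctrlE) (rule that)
  note 3 = comm_estimateD[OF 3]
  obtain L4 K4 where L4: "set L4 \<subseteq> letters w" and K4: "0 \<le> K4"
    and 4: "comm_estimate \<kappa> K4 L1 L2 L4"
    using c(2) by (elim comm_ctrlE) (rule that)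
  note 4 = comm_estimateD[OF 4]
  define \<kappa>' where "\<kappa>' = \<kappa> + K4 * (\<kappa> * \<kappa>)"
  have \<kappa>': "0 \<le> \<kappa>'" "\<kappa> \<le> \<kappa>'" "K4 * (\<kappa> * \<kappa>) \<le> \<kappa>'" using K4 \<kappa> by (simp_all add: \<kappa>'_def)
  obtain L5 K5 where L5: "set L5 \<subseteq> letters (b + w)" and K5: "0 \<le> K5"
    and 5: "comm_estimate \<kappa>' K5 [l] L4 L5"
    by (rule comm_boundE[OF C \<kappa>'(1) l' L4]) (rule that)
  note 5 = comm_estimateD[OF 5]
  define K where "K = K3 + K5 * (\<kappa> * K4) + K4"
  have K: "0 \<le> K" "K3 \<le> K" "K5 * (\<kappa> * K4) \<le> K" "K4 \<le> K"
    using K3 K4 K5 \<kappa> by (simp_all add: K_def)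
  have main: "gcomm G x y \<in> pbox G (L3 @ (L5 @ L4)) (K * (\<rho> * \<sigma>)) r"
    if r: "1 \<le> r" and \<rho>: "0 \<le> \<rho>" "\<rho> \<le> \<kappa>" and \<sigma>: "0 \<le> \<sigma>" "\<sigma> \<le> \<kappa>"
      and x: "x \<in> pbox G L1 \<rho> r" and y: "y \<in> pbox G (l # L2) \<sigma> r" for r \<rho> \<sigma> x y
  proof -
    obtain p z where pz: "y = p \<otimes> z" "p \<in> pbox G [l] \<sigma> r" "z \<in> pbox G L2 \<sigma> r"
      using y gc unfolding l by auto
    have xc: "x \<in> carrier G" "p \<in> carrier G" "z \<in> carrier G"
      using pbox_closed[OF x letters_carrier[OF L1]] pbox_closed[OF pz(2) letters_carrier[OF l']]
        pbox_closed[OF pz(3) letters_carrier[OF L2']] by auto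
    have \<rho>\<sigma>: "0 \<le> \<rho> * \<sigma>" "\<rho> * \<sigma> \<le> \<kappa> * \<kappa>" using \<rho> \<sigma> \<kappa> by (auto intro: mult_mono)
    have h3: "gcomm G x p \<in> pbox G L3 (K3 * (\<rho> * \<sigma>)) r" by (rule 3[OF r \<rho> \<sigma> x pz(2)])
    have h4: "gcomm G x z \<in> pbox G L4 (K4 * (\<rho> * \<sigma>)) r" by (rule 4[OF r \<rho> \<sigma> x pz(3)])
    have t: "0 \<le> K4 * (\<rho> * \<sigma>)" "K4 * (\<rho> * \<sigma>) \<le> \<kappa>'"
      using K4 \<rho>\<sigma> mult_left_mono[OF \<rho>\<sigma>(2) K4] \<kappa>' by auto
    have h5: "gcomm G p (gcomm G x z) \<in> pbox G L5 (K5 * (\<sigma> * (K4 * (\<rho> * \<sigma>)))) r"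
      using \<sigma> \<kappa>' t by (intro 5 r pz(2) h4) auto
    have "K5 * (\<sigma> * (K4 * (\<rho> * \<sigma>))) \<le> K5 * (\<kappa> * K4) * (\<rho> * \<sigma>)"
      using mult_left_mono[OF mult_right_mono[OF \<sigma>(2) t(1)] K5] by (simp add: mult.assoc)
    also have "\<dots> \<le> K * (\<rho> * \<sigma>)" using K \<rho>\<sigma> by (intro mult_right_mono) auto
    finally have t5: "K5 * (\<sigma> * (K4 * (\<rho> * \<sigma>))) \<le> K * (\<rho> * \<sigma>)" .
    have "gcomm G x p \<otimes> (gcomm G p (gcomm G x z) \<otimes> gcomm G x z) \<in> pbox G (L3 @ (L5 @ L4)) (K * (\<rho> * \<sigma>)) r"
    proof (intro pbox_append letters_carrier[OF L3] letters_carrier[OF L5] letters_carrier[OF L4])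
      show "gcomm G x p \<in> pbox G L3 (K * (\<rho> * \<sigma>)) r"
        using K \<rho>\<sigma> by (intro pbox_up[OF h3] mult_right_mono) auto
      show "gcomm G p (gcomm G x z) \<in> pbox G L5 (K * (\<rho> * \<sigma>)) r" by (rule pbox_up[OF h5 t5])
      show "gcomm G x z \<in> pbox G L4 (K * (\<rho> * \<sigma>)) r"
        using K \<rho>\<sigma> by (intro pbox_up[OF h4] mult_right_mono) auto
      show "fst ` set (L5 @ L4) \<subseteq> carrier G"
        using letters_carrier[OF L5] letters_carrier[OF L4] by auto
    qed
    then show ?thesis using xc pz(1) by (simp add: gcomm_mult_right m_assoc)
  qed
  have "set (L3 @ (L5 @ L4)) \<subseteq> letters w"
    using L3 L4 L5 letters_antimono[of w "b + w"] b by auto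
  then show ?thesis
    unfolding comm_ctrl_def comm_estimate_def using main K by (intro exI[of _ "L3 @ (L5 @ L4)"] exI[of _ K]) auto
qed

lemma comm_bound_step:
  assumes C: "\<And>c d. weight_gap \<le> c \<Longrightarrow> weight_gap \<le> d \<Longrightarrow> a + b + weight_gap \<le> c + d \<Longrightarrow> comm_bound c d"
    and P: "\<And>w. a + b \<le> w \<Longrightarrow> prod_bound w"
    and ab: "weight_gap \<le> a" "weight_gap \<le> b"
  shows "comm_bound a b"
  unfolding comm_bound_def
proof (intro allI impI)
  fix \<kappa> :: real and L1 L2 :: "('a \<times> real) list"
  assume \<kappa>: "0 \<le> \<kappa>" and L1: "set L1 \<subseteq> letters a" and L2: "set L2 \<subseteq> letters b"
  have lw: "0 < weight_gap" by (rule weight_gap)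
  have Cb: "comm_bound b (a + b)" and Ca: "comm_bound a (a + b)" using ab lw by (auto intro!: C)
  have pos: "0 < a" "0 < b" using ab lw by auto
  have row: "comm_ctrl (a + b) \<kappa> [l] L" if l: "set [l] \<subseteq> letters a" and "set L \<subseteq> letters b" for l L
    using that(2)
  proof (induction L)
    case Nil
    show ?case by (rule comm_ctrl_Nil[OF letters_carrier[OF l]])
  next
    case (Cons l' L)
    have "comm_ctrl (a + b) \<kappa> [l] [l']"
    proof -
      obtain x \<alpha> y \<beta> where xy: "l = (x, \<alpha>)" "l' = (y, \<beta>)" by force
      then have "(x, \<alpha>) \<in> letters a" "(y, \<beta>) \<in> letters b" using l Cons.prems by auto
      then show ?thesis unfolding xy
        by (intro comm_ctrl_letters[of a b, OF _ _ ab]) (rule C P \<kappa> | assumption)+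
    qed
    moreover have "comm_ctrl (a + b) \<kappa> [l] L" using Cons.prems by (intro Cons.IH) auto
    ultimately show ?case by (rule comm_ctrl_Cons[OF Cb pos(2) \<kappa> l Cons.prems])
  qed
  have "comm_ctrl (a + b) \<kappa> L2 L1"
    using L1
  proof (induction L1)
    case Nil
    show ?case by (rule comm_ctrl_Nil[OF letters_carrier[OF L2]])
  next
    case (Cons l L1)
    have l: "set [l] \<subseteq> letters a" using Cons.prems by simp
    have "comm_ctrl (a + b) \<kappa> L2 [l]"
      by (rule comm_ctrl_sym[OF row[OF l L2] letters_carrier[OF l] letters_carrier[OF L2]])
    moreover have "comm_ctrl (a + b) \<kappa> L2 L1" using Cons.prems by (intro Cons.IH) auto
    ultimately show ?case by (rule comm_ctrl_Cons[OF Ca pos(1) \<kappa> L2 Cons.prems])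
  qed
  then show "comm_ctrl (a + b) \<kappa> L1 L2"
    by (rule comm_ctrl_sym[OF _ letters_carrier[OF L2] letters_carrier[OF L1]])
qed

text \<open>Statements about the weight are proved from the top of the filtration downwards. Each step
  gains a fixed amount.\<close>

lemma downward_induct:
  fixes P :: "real \<Rightarrow> bool"
  assumes base: "\<And>s. t \<le> s \<Longrightarrow> P s" and step: "\<And>s. P (s + d) \<Longrightarrow> P s" and d: "0 < d"
  shows "P s"
proof -
  have "P s" if "t \<le> s + real n * d" for n s
    using that
  proof (induction n arbitrary: s)
    case (Suc n)
    then have "P (s + d)" by (intro Suc.IH) (simp add: algebra_simps)
    then show ?case by (rule step)
  qed (use base in simp)
  moreover obtain n :: nat where "(t - s) / d < real n" using reals_Archimedean2 by blast
  ultimately show ?thesis using d by (auto simp: field_simps intro: less_imp_le)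
qed

lemma pbox_trivial:
  assumes "\<forall>w \<in> U. t \<le> w \<longrightarrow> J w = {\<one>}" "set L \<subseteq> letters t" "x \<in> pbox G L c r"
  shows "x = \<one>"
  using assms(2,3)
proof (induction L arbitrary: x)
  case (Cons l L)
  obtain g a where l: "l = (g, a)" by force
  have g: "g = \<one>" using Cons.prems(1) assms(1) l by (auto simp: letters_def)
  obtain n z where "x = g [^] (n::int) \<otimes> z" "z \<in> pbox G L c r" using Cons.prems l by auto
  moreover from this have "z = \<one>" using Cons by auto
  ultimately show ?case by (simp add: g)
qed simp

text \<open>Both bounds hold for large weights, where all elements are trivial, and are carried
  downwards together: long products at weight \<open>w\<close> need commutators at weight \<open>2 w\<close>, and commutators
  of weight \<open>s\<close> need long products at weight \<open>s\<close> and commutators of larger weight.\<close>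

proposition comm_bound_prod_bound:
  "(weight_gap \<le> a \<longrightarrow> weight_gap \<le> b \<longrightarrow> comm_bound a b) \<and> (weight_gap \<le> w \<longrightarrow> prod_bound w)"
proof -
  obtain t where t: "\<forall>w \<in> U. t \<le> w \<longrightarrow> J w = {\<one>}" using term_trivial by blast
  define Q where "Q s \<longleftrightarrow>
    (\<forall>a b. weight_gap \<le> a \<longrightarrow> weight_gap \<le> b \<longrightarrow> s \<le> a + b \<longrightarrow> comm_bound a b) \<and>
    (\<forall>w. weight_gap \<le> w \<longrightarrow> s \<le> w \<longrightarrow> prod_bound w)" for s
  have lw: "0 < weight_gap" by (rule weight_gap)
  have "Q s" for s
  proof (rule downward_induct[where d = weight_gap and t = "2 * \<bar>t\<bar>"])
    fix s assume s: "2 * \<bar>t\<bar> \<le> s"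
    have "comm_bound a b" if ab: "s \<le> a + b" for a b
    proof -
      have "t \<le> a \<or> t \<le> b" using ab s by linarith
      then have triv: "gcomm G x y = \<one>"
        if "set L1 \<subseteq> letters a" "set L2 \<subseteq> letters b" "x \<in> pbox G L1 \<rho> r" "y \<in> pbox G L2 \<sigma> r"
        for x y L1 L2 \<rho> \<sigma> r
      proof -
        have c: "x \<in> carrier G" "y \<in> carrier G"
          using pbox_closed[OF that(3) letters_carrier[OF that(1)]]
            pbox_closed[OF that(4) letters_carrier[OF that(2)]] by auto
        have "x = \<one> \<or> y = \<one>"
          using \<open>t \<le> a \<or> t \<le> b\<close> that pbox_trivial[OF t _ that(3)] pbox_trivial[OF t _ that(4)]
            letters_antimono by blast
        then show ?thesis using c by auto
      qed
      then show ?thesis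
        by (auto simp: comm_bound_def comm_ctrl_def comm_estimate_def intro!: exI[of _ "[]"] exI[of _ "0::real"])
    qed
    moreover have "prod_bound w" if w: "s \<le> w" for w
    proof -
      have tw: "t \<le> w" using s w by linarith
      have "pprod G h N = \<one>" if "set L \<subseteq> letters w" "\<forall>i<N. h i \<in> pbox G L \<rho> r" for h N L \<rho> r
      proof -
        have "h i = \<one>" if "i < N" for i
          using that pbox_trivial[OF t, of L "h i"] \<open>set L \<subseteq> letters w\<close>
            letters_antimono[OF tw] \<open>\<forall>i<N. h i \<in> pbox G L \<rho> r\<close> by blast
        then show ?thesis by (induction N) auto
      qed
      then show ?thesis
        unfolding prod_bound_def prod_estimate_def
        by (auto intro!: exI[of _ "[]"] exI[of _ "0::real"])
    qed
    ultimately show "Q s" by (auto simp: Q_def)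
  next
    fix s assume "Q (s + weight_gap)"
    then have C: "\<And>a b. weight_gap \<le> a \<Longrightarrow> weight_gap \<le> b \<Longrightarrow> s + weight_gap \<le> a + b \<Longrightarrow> comm_bound a b"
      and P: "\<And>w. weight_gap \<le> w \<Longrightarrow> s + weight_gap \<le> w \<Longrightarrow> prod_bound w"
      by (auto simp: Q_def)
    have P': "prod_bound w" if "weight_gap \<le> w" "s \<le> w" for w
      by (rule prod_bound_step) (use that lw in \<open>auto intro: C P\<close>)
    have "comm_bound a b" if "weight_gap \<le> a" "weight_gap \<le> b" "s \<le> a + b" for a b
    proof (rule comm_bound_step)
      show "comm_bound c d" if "weight_gap \<le> c" "weight_gap \<le> d" "a + b + weight_gap \<le> c + d" for c d
        using that \<open>s \<le> a + b\<close> by (intro C) auto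
      show "prod_bound w" if "a + b \<le> w" for w
        using that \<open>s \<le> a + b\<close> \<open>weight_gap \<le> a\<close> \<open>weight_gap \<le> b\<close> lw by (intro P') auto
    qed fact+
    then show "Q s" using P' by (auto simp: Q_def)
  qed (rule lw)
  then show ?thesis by (auto simp: Q_def)
qed

lemmas comm_bound = comm_bound_prod_bound[THEN conjunct1, rule_format]
lemmas prod_bound = comm_bound_prod_bound[THEN conjunct2, rule_format]

text \<open>If the factors of a long product differ from a fixed element \<open>p\<close> by small elements, then the
  product differs from \<open>p\<^sup>N\<close> by an element whose size is of order \<open>N\<close> times theirs. This keeps track of leading terms,
  which the size bounds alone forget.\<close>

definition collect_estimate ::
  "real \<Rightarrow> real \<Rightarrow> ('a \<times> real) list \<Rightarrow> ('a \<times> real) list \<Rightarrow> ('a \<times> real) list \<Rightarrow> bool" where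
  "collect_estimate \<kappa> K L M L' \<longleftrightarrow> (\<forall>r \<sigma> \<tau> N c p. 1 \<le> r \<longrightarrow> 0 \<le> \<sigma> \<longrightarrow> \<sigma> \<le> \<kappa> \<longrightarrow> 0 \<le> \<tau> \<longrightarrow> \<tau> \<le> \<kappa> \<longrightarrow>
     real N * \<tau> \<le> \<kappa> \<longrightarrow> p \<in> carrier G \<longrightarrow> (\<forall>i<N. p [^] i \<in> pbox G M \<sigma> r) \<longrightarrow> (\<forall>i<N. c i \<in> pbox G L \<tau> r) \<longrightarrow>
     (\<exists>z \<in> pbox G L' (K * (real N * \<tau>)) r. pprod G (\<lambda>i. c i \<otimes> p) N = z \<otimes> p [^] N))"

lemma collect_estimateD:
  "collect_estimate \<kappa> K L M L' \<Longrightarrow> 1 \<le> r \<Longrightarrow> 0 \<le> \<sigma> \<Longrightarrow> \<sigma> \<le> \<kappa> \<Longrightarrow> 0 \<le> \<tau> \<Longrightarrow> \<tau> \<le> \<kappa> \<Longrightarrow>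
    real N * \<tau> \<le> \<kappa> \<Longrightarrow> p \<in> carrier G \<Longrightarrow> (\<And>i. i < N \<Longrightarrow> p [^] (i::nat) \<in> pbox G M \<sigma> r) \<Longrightarrow>
    (\<And>i. i < N \<Longrightarrow> c i \<in> pbox G L \<tau> r) \<Longrightarrow>
    \<exists>z \<in> pbox G L' (K * (real N * \<tau>)) r. pprod G (\<lambda>i. c i \<otimes> p) N = z \<otimes> p [^] N"
  by (simp add: collect_estimate_def)

lemma collect_constant:
  assumes w: "weight_gap \<le> w" and v: "weight_gap \<le> v" and L: "set L \<subseteq> letters w"
    and M: "set M \<subseteq> letters v" and \<kappa>: "0 \<le> \<kappa>"
  obtains L' K where "set L' \<subseteq> letters w" "0 \<le> K" "collect_estimate \<kappa> K L M L'"
proof -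
  have lw: "0 < weight_gap" by (rule weight_gap)
  obtain L2 K2 where L2: "set L2 \<subseteq> letters (v + w)" and K2: "0 \<le> K2"
    and 2: "comm_estimate \<kappa> K2 M L L2"
    by (rule comm_boundE[OF comm_bound[OF v w] \<kappa> M L]) (rule that)
  note 2 = comm_estimateD[OF 2]
  have L2L: "set (L2 @ L) \<subseteq> letters w" using v lw by (intro letters_append[OF L2 L]) auto
  define k where "k = K2 * \<kappa> + 1"
  have k: "0 \<le> k" using K2 \<kappa> by (simp add: k_def)
  have k\<kappa>: "0 \<le> k * \<kappa>" using k \<kappa> by simp
  obtain L' K' where L': "set L' \<subseteq> letters w" and K': "0 \<le> K'"
    and 3: "prod_estimate (k * \<kappa>) K' (L2 @ L) L'"
    using prod_boundE[OF prod_bound[OF w] k\<kappa> L2L] by blast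
  note 3 = prod_estimateD[OF 3]
  show ?thesis
  proof (rule that[OF L'])
    show "0 \<le> K' * k" using K' k by simp
    have "\<exists>z \<in> pbox G L' (K' * k * (real N * \<tau>)) r. pprod G (\<lambda>i. c i \<otimes> p) N = z \<otimes> p [^] N"
      if r: "1 \<le> r" and \<sigma>: "0 \<le> \<sigma>" "\<sigma> \<le> \<kappa>" and \<tau>: "0 \<le> \<tau>" "\<tau> \<le> \<kappa>" and N: "real N * \<tau> \<le> \<kappa>"
      and p: "p \<in> carrier G" and pb: "\<And>i. i < N \<Longrightarrow> p [^] i \<in> pbox G M \<sigma> r"
      and cb: "\<And>i. i < N \<Longrightarrow> c i \<in> pbox G L \<tau> r" for r \<sigma> \<tau> N c p
    proof -
      define z where "z = pprod G (\<lambda>i. p [^] i \<otimes> c i \<otimes> inv (p [^] i)) N"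
      have "p [^] i \<otimes> c i \<otimes> inv (p [^] i) \<in> pbox G (L2 @ L) (k * \<tau>) r" if i: "i < N" for i
      proof -
        have "gcomm G (p [^] i) (c i) \<in> pbox G L2 (K2 * (\<sigma> * \<tau>)) r"
          by (rule 2[OF r \<sigma> \<tau> pb[OF i] cb[OF i]])
        then have "p [^] i \<otimes> c i \<otimes> inv (p [^] i) \<in> pbox G (L2 @ L) (K2 * (\<sigma> * \<tau>) + \<tau>) r"
          using K2 \<sigma> \<tau> p by (intro conj_in_pbox[OF L2 L] cb[OF i]) auto
        moreover have "K2 * (\<sigma> * \<tau>) + \<tau> \<le> k * \<tau>"
          using mult_left_mono[OF mult_right_mono[OF \<sigma>(2) \<tau>(1)] K2] by (simp add: k_def algebra_simps)
        ultimately show ?thesis by (rule pbox_up)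
      qed
      moreover have "real N * (k * \<tau>) \<le> k * \<kappa>"
        using mult_left_mono[OF N k] by (simp add: mult.left_commute)
      ultimately have "z \<in> pbox G L' (K' * (real N * (k * \<tau>))) r"
        unfolding z_def using k \<tau> by (intro 3 r) auto
      then have zb: "z \<in> pbox G L' (K' * k * (real N * \<tau>)) r" by (simp add: mult.left_commute mult.assoc)
      have cc: "c i \<in> carrier G" if "i < N" for i using pbox_closed[OF cb[OF that] letters_carrier[OF L]] .
      have "pprod G (\<lambda>i. c i \<otimes> p) N = z \<otimes> p [^] N"
        unfolding z_def using pprod_collect[of N c "\<lambda>_. p"] cc p by (simp add: pprod_const)
      with zb show ?thesis by blast
    qed
    then show "collect_estimate \<kappa> (K' * k) L M L'" unfolding collect_estimate_def by blast
  qed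
qed

lemma pow_in_pbox:
  "g \<in> carrier G \<Longrightarrow> real n \<le> c * r powr a \<Longrightarrow> g [^] (n::nat) \<in> pbox G [(g, a)] c r"
  by (auto simp: pbox_single simp flip: int_pow_int intro!: exI[of _ "int n"])

lemma letter_in_pbox:
  "g \<in> carrier G \<Longrightarrow> 1 \<le> r \<Longrightarrow> g \<in> pbox G [(g, a)] (r powr - a) r"
  by (auto simp: pbox_single simp flip: powr_add intro!: exI[of _ 1])

text \<open>Taking powers is multiplicative modulo higher weights. Since \<open>r\<close> and \<open>n\<close> range over all
  values with \<open>n \<le> \<kappa> r\<^sup>w\<close>, the error is an admissible product with a bounded number of factors, not
  merely an element of a smaller subgroup.\<close>

proposition pow_mult_collect:
  assumes w: "w \<in> U" and g: "g \<in> J w" and h: "h \<in> J w" and \<kappa>: "0 \<le> \<kappa>"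
  obtains L K where "set L \<subseteq> letters (w + w)" "0 \<le> K"
    "\<And>r n. 1 \<le> r \<Longrightarrow> real n \<le> \<kappa> * r powr w \<Longrightarrow>
       \<exists>z \<in> pbox G L K r. (g \<otimes> h) [^] (n::nat) = z \<otimes> h [^] n \<otimes> g [^] n"
proof -
  have lw: "0 < weight_gap" "weight_gap \<le> w" "weight_gap \<le> w + w"
    using weight_gap(1) weight_gap(2)[OF w] by auto
  have w0: "0 < w" using lw by simp
  have gl: "set [(g, w)] \<subseteq> letters w" and hl: "set [(h, w)] \<subseteq> letters w"
    using g h w by (auto simp: letters_def)
  have gc: "g \<in> carrier G" and hc: "h \<in> carrier G" using g h w term_closed by auto
  have k1: "0 \<le> \<kappa> + 1" using \<kappa> by simp
  obtain L2 K2 where L2: "set L2 \<subseteq> letters (w + w)" and K2: "0 \<le> K2"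
    and 2: "comm_estimate (\<kappa> + 1) K2 [(g, w)] [(h, w)] L2"
    by (rule comm_boundE[OF comm_bound[OF lw(2,2)] k1 gl hl]) (rule that)
  note 2 = comm_estimateD[OF 2]
  define \<kappa>' where "\<kappa>' = K2 * (\<kappa> + 1) * (\<kappa> + 1) + (\<kappa> + 1)"
  have \<kappa>': "0 \<le> \<kappa>'" "\<kappa> \<le> \<kappa>'" "K2 * (\<kappa> + 1) * (\<kappa> + 1) \<le> \<kappa>'" "K2 * (\<kappa> + 1) * \<kappa> \<le> \<kappa>'"
      "K2 * (\<kappa> + 1) \<le> \<kappa>'"
    using K2 \<kappa> by (simp_all add: \<kappa>'_def algebra_simps add_increasing add_increasing2)
  obtain L3 K3 where L3: "set L3 \<subseteq> letters (w + w)" and K3: "0 \<le> K3"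
    and 3: "collect_estimate \<kappa>' K3 L2 [(h, w)] L3"
    using collect_constant[OF lw(3,2) L2 hl \<kappa>'(1)] by blast
  note 3 = collect_estimateD[OF 3]
  show ?thesis
  proof (rule that[OF L3])
    show "0 \<le> K3 * \<kappa>'" using K3 \<kappa>' by simp
    fix r n assume r: "1 \<le> r" and n: "real n \<le> \<kappa> * r powr w"
    define \<tau> where "\<tau> = K2 * ((\<kappa> + 1) * r powr - w)"
    have rw: "r powr - w \<le> 1" "r powr w * r powr - w = 1" "1 \<le> r powr w"
      using r w0 by (auto simp: powr_minus ge_one_powr_ge_zero inverse_le_1_iff simp flip: powr_add)
    have \<tau>: "0 \<le> \<tau>" "\<tau> \<le> \<kappa>'"
      using K2 \<kappa> rw mult_left_mono[OF mult_left_mono[OF rw(1) k1] K2] \<kappa>'(5) by (auto simp: \<tau>_def)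
    have n\<tau>: "real n * \<tau> \<le> \<kappa>'"
    proof -
      have "real n * \<tau> \<le> (\<kappa> * r powr w) * \<tau>" using n \<tau> by (intro mult_right_mono)
      also have "\<dots> = K2 * (\<kappa> + 1) * \<kappa> * (r powr w * r powr - w)" by (simp add: \<tau>_def)
      also have "\<dots> \<le> \<kappa>'" unfolding rw using \<kappa>' by simp
      finally show ?thesis .
    qed
    define c where "c i = gcomm G (g [^] Suc i) h" for i
    have cb: "c i \<in> pbox G L2 \<tau> r" if "i < n" for i
    proof -
      have "real (Suc i) \<le> (\<kappa> + 1) * r powr w" using that n rw by (simp add: algebra_simps)
      then show ?thesis
        unfolding c_def \<tau>_def using \<kappa> rw
        by (intro 2 r pow_in_pbox gc letter_in_pbox hc) auto
    qed
    have hb: "h [^] i \<in> pbox G [(h, w)] \<kappa> r" if "i < n" for i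
      using that n by (intro pow_in_pbox hc) auto
    obtain z where z: "z \<in> pbox G L3 (K3 * (real n * \<tau>)) r"
      "pprod G (\<lambda>i. c i \<otimes> h) n = z \<otimes> h [^] n"
      using that 3[of r \<kappa> \<tau> n h c, OF r \<kappa> \<kappa>'(2) \<tau> n\<tau> hc hb cb] by blast
    have "pprod G (\<lambda>i. g [^] Suc i \<otimes> h \<otimes> inv (g [^] Suc i)) n = pprod G (\<lambda>i. c i \<otimes> h) n"
      unfolding c_def by (intro pprod_cong conj_eq_gcomm nat_pow_closed gc hc)
    then have "(g \<otimes> h) [^] n = z \<otimes> h [^] n \<otimes> g [^] n"
      using mult_pow_eq_pprod[OF gc hc, of n] z(2) by simp
    moreover have "z \<in> pbox G L3 (K3 * \<kappa>') r"
      using z(1) mult_left_mono[OF n\<tau> K3] by (rule pbox_up)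
    ultimately show "\<exists>z \<in> pbox G L3 (K3 * \<kappa>') r. (g \<otimes> h) [^] n = z \<otimes> h [^] n \<otimes> g [^] n"
      by blast
  qed
qed

lemma letters_term: "a \<in> U \<Longrightarrow> g \<in> J a \<Longrightarrow> set [(g, a)] \<subseteq> letters a"
  by (auto simp: letters_def)

text \<open>The commutator is bimultiplicative modulo higher weights, with the same control of the
  error. Read from right to left, it writes the power \<open>[x, y]\<^sup>n\<^sup>k\<close>, whose exponent may be as large as
  \<open>r\<^sup>a\<^sup>+\<^sup>b\<close>, as a commutator of the powers \<open>x\<^sup>n\<close> and \<open>y\<^sup>k\<close> with exponents of order \<open>r\<^sup>a\<close> and \<open>r\<^sup>b\<close>.\<close>

proposition gcomm_pow_collect:
  assumes a: "a \<in> U" and b: "b \<in> U" and x: "x \<in> J a" and y: "y \<in> J b" and \<kappa>: "0 \<le> \<kappa>"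
  obtains L K where "set L \<subseteq> letters (a + b + weight_gap)" "0 \<le> K"
    "\<And>r n k. 1 \<le> r \<Longrightarrow> real n \<le> \<kappa> * r powr a \<Longrightarrow> real k \<le> \<kappa> * r powr b \<Longrightarrow>
       \<exists>z \<in> pbox G L K r. gcomm G (x [^] (n::nat)) (y [^] (k::nat)) = z \<otimes> gcomm G x y [^] (n * k)"
proof -
  define s where "s = a + b + weight_gap"
  have lw: "0 < weight_gap" "weight_gap \<le> a" "weight_gap \<le> b"
    using weight_gap(1) weight_gap(2)[OF a] weight_gap(2)[OF b] by auto
  have pos: "0 < a" "0 < b" using lw by auto
  have w: "weight_gap \<le> a + b" "weight_gap \<le> s" "a + b \<le> s" using lw by (auto simp: s_def)
  have ab: "a + b \<in> U" using a b by (rule weight_add)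
  define z where "z = gcomm G x y"
  define z' where "z' = gcomm G y x"
  have xc: "x \<in> carrier G" and yc: "y \<in> carrier G" using term_closed a b x y by auto
  have zJ: "z \<in> J (a + b)" "z' \<in> J (a + b)"
    using term_gcomm[OF a b x y] term_gcomm[OF b a y x] by (auto simp: z_def z'_def add.commute)
  have zc: "z \<in> carrier G" "z' \<in> carrier G" using zJ term_closed ab by auto
  have zz: "inv z' = z" using xc yc by (simp add: z_def z'_def inv_gcomm)
  have xl: "set [(x, a)] \<subseteq> letters a" and yl: "set [(y, b)] \<subseteq> letters b"
    and zl: "set [(z, a + b)] \<subseteq> letters (a + b)" and z'l: "set [(z', a + b)] \<subseteq> letters (a + b)"
    using letters_term[OF a x] letters_term[OF b y] letters_term[OF ab zJ(1)] letters_term[OF ab zJ(2)]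
    by auto
  have up: "set L \<subseteq> letters s" if "set L \<subseteq> letters t" "s \<le> t" for L t
    using that letters_antimono by blast
  \<comment> \<open>The lists and constants are fixed first, since they must not depend on \<open>r\<close>, \<open>n\<close> and \<open>k\<close>. In
    the notation below \<open>[y, x\<^sup>n] = e z'\<^sup>n\<close>, \<open>[x\<^sup>n, y] = e' z\<^sup>n\<close>, \<open>[x\<^sup>n, y\<^sup>k] = f [x\<^sup>n, y]\<^sup>k\<close> and
    \<open>[x\<^sup>n, y]\<^sup>k = g z\<^sup>n\<^sup>k\<close>, where \<open>e\<close>, \<open>e'\<close>, \<open>f\<close>, \<open>g\<close> have higher weight.\<close>
  obtain L1 K1 where L1: "set L1 \<subseteq> letters (a + (a + b))" and K1: "0 \<le> K1"
    and 1: "comm_estimate (\<kappa> + 1) K1 [(x, a)] [(z', a + b)] L1"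
    using comm_boundE[OF comm_bound[OF lw(2) w(1)] _ xl z'l, of "\<kappa> + 1"] \<kappa> by auto
  note 1 = comm_estimateD[OF 1]
  have L1s: "set L1 \<subseteq> letters s" using lw by (intro up[OF L1]) (auto simp: s_def)
  define \<kappa>2 where "\<kappa>2 = \<kappa> + K1 * \<kappa> + K1 * \<kappa> * \<kappa>"
  have \<kappa>2: "0 \<le> \<kappa>2" "\<kappa> \<le> \<kappa>2" "K1 * \<kappa> \<le> \<kappa>2" "K1 * \<kappa> * \<kappa> \<le> \<kappa>2"
    using K1 \<kappa> by (simp_all add: \<kappa>2_def)
  obtain L2 K2 where L2: "set L2 \<subseteq> letters s" and K2: "0 \<le> K2"
    and 2: "collect_estimate \<kappa>2 K2 L1 [(z', a + b)] L2"
    using collect_constant[OF w(2,1) L1s z'l \<kappa>2(1)] by blast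
  note 2 = collect_estimateD[OF 2]
  define C2 where "C2 = K2 * (K1 * \<kappa> * \<kappa>)"
  have C2: "0 \<le> C2" using K1 K2 \<kappa> by (simp add: C2_def)
  have rL2: "set (rev L2) \<subseteq> letters s" using L2 by simp
  have kC2: "0 \<le> \<kappa> + C2" using \<kappa> C2 by simp
  obtain L3 K3 where L3: "set L3 \<subseteq> letters (a + b + s)" and K3: "0 \<le> K3"
    and 3: "comm_estimate (\<kappa> + C2) K3 [(z, a + b)] (rev L2) L3"
    by (rule comm_boundE[OF comm_bound[OF w(1,2)] kC2 zl rL2]) (rule that)
  note 3 = comm_estimateD[OF 3]
  have L3s: "set L3 \<subseteq> letters s" using lw by (intro up[OF L3]) auto
  define Le where "Le = L3 @ rev L2"
  have Le: "set Le \<subseteq> letters s" using L3s rL2 by (simp add: Le_def)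
  define C3 where "C3 = K3 * (\<kappa> * C2) + C2"
  have C3: "0 \<le> C3" using K3 \<kappa> C2 by (simp add: C3_def)
  define Ly where "Ly = Le @ [(z, a + b)]"
  have Ly: "set Ly \<subseteq> letters (a + b)" using Le zl letters_antimono[OF w(3)] by (auto simp: Ly_def)
  define C4 where "C4 = C3 + \<kappa>"
  have C4: "0 \<le> C4" using C3 \<kappa> by (simp add: C4_def)
  have kC4: "0 \<le> C4 * \<kappa>" using C4 \<kappa> by simp
  obtain L5 K5 where L5: "set L5 \<subseteq> letters (a + b)" and K5: "0 \<le> K5"
    and 5: "prod_estimate (C4 * \<kappa>) K5 Ly L5"
    using prod_boundE[OF prod_bound[OF w(1)] kC4 Ly] by blast
  note 5 = prod_estimateD[OF 5]
  have kC4': "0 \<le> \<kappa> + C4" using C4 \<kappa> by simp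
  obtain L6 K6 where L6: "set L6 \<subseteq> letters (b + (a + b))" and K6: "0 \<le> K6"
    and 6: "comm_estimate (\<kappa> + C4) K6 [(y, b)] Ly L6"
    by (rule comm_boundE[OF comm_bound[OF lw(3) w(1)] kC4' yl Ly]) (rule that)
  note 6 = comm_estimateD[OF 6]
  have L6s: "set L6 \<subseteq> letters s" using lw by (intro up[OF L6]) (auto simp: s_def)
  define D where "D = K6 * (\<kappa> * C4)"
  have D: "0 \<le> D" using K6 \<kappa> C4 by (simp add: D_def)
  define \<kappa>7 where "\<kappa>7 = K5 * (C4 * \<kappa>) + D + \<kappa> * D"
  have \<kappa>7: "0 \<le> \<kappa>7" "K5 * (C4 * \<kappa>) \<le> \<kappa>7" "D \<le> \<kappa>7" "\<kappa> * D \<le> \<kappa>7"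
    using K5 kC4 D \<kappa> by (simp_all add: \<kappa>7_def)
  obtain L7 K7 where L7: "set L7 \<subseteq> letters s" and K7: "0 \<le> K7"
    and 7: "collect_estimate \<kappa>7 K7 L6 L5 L7"
    using collect_constant[OF w(2,1) L6s L5 \<kappa>7(1)] by blast
  note 7 = collect_estimateD[OF 7]
  define \<kappa>8 where "\<kappa>8 = \<kappa> * \<kappa> + C3 + \<kappa> * C3"
  have \<kappa>8: "0 \<le> \<kappa>8" "\<kappa> * \<kappa> \<le> \<kappa>8" "C3 \<le> \<kappa>8" "\<kappa> * C3 \<le> \<kappa>8"
    using \<kappa> C3 by (simp_all add: \<kappa>8_def)
  obtain L8 K8 where L8: "set L8 \<subseteq> letters s" and K8: "0 \<le> K8"
    and 8: "collect_estimate \<kappa>8 K8 Le [(z, a + b)] L8"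
    using collect_constant[OF w(2,1) Le zl \<kappa>8(1)] by blast
  note 8 = collect_estimateD[OF 8]
  define K where "K = K7 * (\<kappa> * D) + K8 * (\<kappa> * C3)"
  have K: "0 \<le> K" "K7 * (\<kappa> * D) \<le> K" "K8 * (\<kappa> * C3) \<le> K"
    using K7 K8 \<kappa> D C3 by (simp_all add: K_def)
  have main: "\<exists>f \<in> pbox G (L7 @ L8) K r. gcomm G (x [^] n) (y [^] k) = f \<otimes> z [^] (n * k)"
    if r: "1 \<le> r" and n: "real n \<le> \<kappa> * r powr a" and k: "real k \<le> \<kappa> * r powr b" for r and n k :: nat
  proof -
    define q where "q = r powr - b"
    define q' where "q' = r powr - (a + b)"
    have le1: "r powr - c \<le> 1" if "0 < c" for c
      using r that by (simp add: powr_minus ge_one_powr_ge_zero inverse_le_1_iff)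
    have q: "0 \<le> q" "q \<le> 1" "0 \<le> q'" "q' \<le> 1" "r powr b * q = 1" "r powr a * q' = q"
        "q * r powr (a + b) = r powr a"
      using r pos le1[of b] le1[of "a + b"] by (simp_all add: q_def q'_def flip: powr_add)
    have kq: "real k * q \<le> \<kappa>" using mult_right_mono[OF k q(1)] q(5) by (simp add: mult.assoc)
    have nq: "real n * q' \<le> \<kappa> * q" using mult_right_mono[OF n q(3)] q(6) by (simp add: mult.assoc)
    have n': "real n \<le> \<kappa> * q * r powr (a + b)" using n q(7) by (simp add: mult.assoc)
    have \<kappa>q: "0 \<le> \<kappa> * q" "\<kappa> * q \<le> \<kappa>" using \<kappa> q by (auto simp: mult_left_le)
    have mono1: "C * q \<le> C" "0 \<le> C * q" if "0 \<le> C" for C using that q by (auto simp: mult_left_le)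
    define c where "c i = gcomm G (x [^] i) z'" for i :: nat
    have cb: "c i \<in> pbox G L1 (K1 * \<kappa> * q') r" if "i < n" for i
    proof -
      have z'1: "z' \<in> pbox G [(z', a + b)] q' r"
        unfolding q'_def by (rule letter_in_pbox[OF zc(2) r])
      have "c i \<in> pbox G L1 (K1 * (\<kappa> * q')) r"
        unfolding c_def using that n \<kappa> q by (intro 1 r pow_in_pbox xc z'1) auto
      then show ?thesis by (simp add: mult.assoc)
    qed
    have z'b: "z' [^] i \<in> pbox G [(z', a + b)] (\<kappa> * q) r" if "i < n" for i
      using that n' by (intro pow_in_pbox zc) auto
    have nt: "real n * (K1 * \<kappa> * q') \<le> K1 * \<kappa> * \<kappa> * q"
      using mult_left_mono[OF nq, of "K1 * \<kappa>"] K1 \<kappa> by (simp add: algebra_simps)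
    have nt': "real n * (K1 * \<kappa> * q') \<le> \<kappa>2"
      using nt mono1(1)[of "K1 * \<kappa> * \<kappa>"] K1 \<kappa> \<kappa>2(4) by simp
    have t0: "0 \<le> K1 * \<kappa> * q'" "K1 * \<kappa> * q' \<le> \<kappa>2"
      using K1 \<kappa> q \<kappa>2(3) mult_left_le[of q' "K1 * \<kappa>"] by auto
    obtain e where e: "e \<in> pbox G L2 (K2 * (real n * (K1 * \<kappa> * q'))) r"
      and e_eq: "pprod G (\<lambda>i. c i \<otimes> z') n = e \<otimes> z' [^] n"
      using that 2[of r "\<kappa> * q" "K1 * \<kappa> * q'" n z' c, OF r \<kappa>q(1) order_trans[OF \<kappa>q(2) \<kappa>2(2)] t0 nt' zc(2) z'b cb]
      by blast
    have "K2 * (real n * (K1 * \<kappa> * q')) \<le> C2 * q"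
      using mult_left_mono[OF nt K2] by (simp add: C2_def mult.assoc)
    then have e2: "e \<in> pbox G L2 (C2 * q) r" by (rule pbox_up[OF e])
    have ec: "e \<in> carrier G" by (rule pbox_closed[OF e2 letters_carrier[OF L2]])
    have yx: "gcomm G y (x [^] n) = e \<otimes> z' [^] n"
      unfolding gcomm_pow_eq_pprod[OF xc yc] e_eq[symmetric] c_def
      using conj_eq_gcomm xc zc by (intro pprod_cong) (simp add: z'_def)
    define Y where "Y = gcomm G (x [^] n) y"
    define e' where "e' = z [^] n \<otimes> inv e \<otimes> inv (z [^] n)"
    have zn: "inv (z' [^] n) = z [^] n" using zc zz by (simp flip: nat_pow_inv)
    have Y: "Y = e' \<otimes> z [^] n"
    proof -
      have "Y = inv (e \<otimes> z' [^] n)" unfolding Y_def yx[symmetric] using xc yc by (simp add: inv_gcomm)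
      also have "\<dots> = z [^] n \<otimes> inv e" using zn ec zc by (simp add: inv_mult_group)
      also have "\<dots> = e' \<otimes> z [^] n" using ec zc by (simp add: e'_def m_assoc)
      finally show ?thesis .
    qed
    have zb: "z [^] n \<in> pbox G [(z, a + b)] (\<kappa> * q) r" using n' by (intro pow_in_pbox zc)
    have ie: "inv e \<in> pbox G (rev L2) (C2 * q) r" by (rule pbox_inv[OF letters_carrier[OF L2] e2])
    have "gcomm G (z [^] n) (inv e) \<in> pbox G L3 (K3 * ((\<kappa> * q) * (C2 * q))) r"
      using \<kappa>q mono1[OF C2] \<kappa> C2 by (intro 3 r zb ie) auto
    then have "e' \<in> pbox G (L3 @ rev L2) (K3 * ((\<kappa> * q) * (C2 * q)) + C2 * q) r"
      unfolding e'_def using K3 \<kappa>q mono1[OF C2] zc by (intro conj_in_pbox[OF L3 rL2] ie) auto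
    moreover have "K3 * ((\<kappa> * q) * (C2 * q)) + C2 * q \<le> C3 * q"
      using mult_left_mono[OF mult_right_mono[OF \<kappa>q(2) mono1(2)[OF C2]] K3] by (simp add: C3_def algebra_simps)
    ultimately have e'b: "e' \<in> pbox G Le (C3 * q) r" unfolding Le_def by (rule pbox_up)
    have e'c: "e' \<in> carrier G" by (rule pbox_closed[OF e'b letters_carrier[OF Le]])
    have Yb: "Y \<in> pbox G Ly (C4 * q) r"
      unfolding Y Ly_def using mono1(2)[OF C3] \<kappa>q
      by (intro pbox_append letters_carrier[OF Le] letters_carrier[OF zl] pbox_up[OF e'b] pbox_up[OF zb])
        (auto simp: C4_def distrib_right)
    have Yc: "Y \<in> carrier G" using xc yc by (simp add: Y_def)
    have sub: "real i * (C4 * q) \<le> C4 * \<kappa>" if "i \<le> k" for i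
    proof -
      have "real i * (C4 * q) = C4 * (real i * q)" by simp
      also have "\<dots> \<le> C4 * \<kappa>"
        using that kq mult_right_mono[of "real i" "real k" q] q C4 by (intro mult_left_mono) auto
      finally show ?thesis .
    qed
    have Ypow: "Y [^] i \<in> pbox G L5 (K5 * (C4 * \<kappa>)) r" if "i < k" for i
    proof -
      have "pprod G (\<lambda>_. Y) i \<in> pbox G L5 (K5 * (real i * (C4 * q))) r"
        using that mono1(2)[OF C4] by (intro 5 r sub Yb) auto
      then show ?thesis
        using that mult_left_mono[OF sub K5, of i] by (simp add: pprod_const[OF Yc] pbox_up)
    qed
    define d where "d i = gcomm G (y [^] i) Y" for i :: nat
    have db: "d i \<in> pbox G L6 (D * q) r" if "i < k" for i
    proof -
      have "d i \<in> pbox G L6 (K6 * (\<kappa> * (C4 * q))) r"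
        unfolding d_def using that k \<kappa> C4 mono1[OF C4]
        by (intro 6 r pow_in_pbox yc Yb) auto
      then show ?thesis by (simp add: D_def mult.assoc)
    qed
    have kD: "real k * (D * q) \<le> \<kappa> * D" using mult_left_mono[OF kq D] by (simp add: algebra_simps)
    have u7: "0 \<le> K5 * (C4 * \<kappa>)" "D * q \<le> \<kappa>7" using K5 kC4 mono1[OF D] \<kappa>7(3) by auto
    obtain f where f: "f \<in> pbox G L7 (K7 * (real k * (D * q))) r"
      and f_eq: "pprod G (\<lambda>i. d i \<otimes> Y) k = f \<otimes> Y [^] k"
      using that 7[of r "K5 * (C4 * \<kappa>)" "D * q" k Y d, OF r u7(1) \<kappa>7(2) mono1(2)[OF D] u7(2) order_trans[OF kD \<kappa>7(4)] Yc Ypow db]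
      by blast
    have fK: "f \<in> pbox G L7 K r"
      using mult_left_mono[OF kD K7] K(2) by (intro pbox_up[OF f]) auto
    have fc: "f \<in> carrier G" by (rule pbox_closed[OF fK letters_carrier[OF L7]])
    have "gcomm G (x [^] n) (y [^] k) = pprod G (\<lambda>i. d i \<otimes> Y) k"
      unfolding gcomm_pow_eq_pprod[OF yc nat_pow_closed[OF xc]] d_def Y_def[symmetric]
      using yc Yc by (intro pprod_cong conj_eq_gcomm) auto
    then have xy: "gcomm G (x [^] n) (y [^] k) = f \<otimes> Y [^] k" using f_eq by simp
    have zni: "(z [^] n) [^] i \<in> pbox G [(z, a + b)] (\<kappa> * \<kappa>) r" if "i < k" for i
    proof -
      have "real (n * i) \<le> (\<kappa> * r powr a) * (\<kappa> * r powr b)"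
        unfolding of_nat_mult using that n k \<kappa> by (intro mult_mono) auto
      also have "\<dots> = \<kappa> * \<kappa> * r powr (a + b)" by (simp add: powr_add)
      finally show ?thesis unfolding nat_pow_pow[OF zc(1)] by (intro pow_in_pbox zc)
    qed
    have kC3: "real k * (C3 * q) \<le> \<kappa> * C3" using mult_left_mono[OF kq C3] by (simp add: algebra_simps)
    have u8: "0 \<le> \<kappa> * \<kappa>" "C3 * q \<le> \<kappa>8" using \<kappa> mono1[OF C3] \<kappa>8(3) by auto
    obtain g where g: "g \<in> pbox G L8 (K8 * (real k * (C3 * q))) r"
      and g_eq: "pprod G (\<lambda>i. e' \<otimes> z [^] n) k = g \<otimes> (z [^] n) [^] k"
      using that 8[of r "\<kappa> * \<kappa>" "C3 * q" k "z [^] n" "\<lambda>_. e'", OF r u8(1) \<kappa>8(2) mono1(2)[OF C3] u8(2) order_trans[OF kC3 \<kappa>8(4)] nat_pow_closed[OF zc(1)] zni e'b]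
      by blast
    have gK: "g \<in> pbox G L8 K r"
      using mult_left_mono[OF kC3 K8] K(3) by (intro pbox_up[OF g]) auto
    have gc: "g \<in> carrier G" by (rule pbox_closed[OF gK letters_carrier[OF L8]])
    have "Y [^] k = g \<otimes> z [^] (n * k)"
      using g_eq pprod_const[of "e' \<otimes> z [^] n" k] e'c zc by (simp add: Y nat_pow_pow)
    then have "gcomm G (x [^] n) (y [^] k) = (f \<otimes> g) \<otimes> z [^] (n * k)"
      using xy fc gc zc by (simp add: m_assoc)
    moreover have "f \<otimes> g \<in> pbox G (L7 @ L8) K r"
      by (intro pbox_append letters_carrier[OF L7] letters_carrier[OF L8] fK gK)
    ultimately show ?thesis by blast
  qed
  show ?thesis
    by (rule that[of "L7 @ L8" K]) (use L7 L8 K(1) main in \<open>auto simp: s_def z_def\<close>)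
qed

end

section \<open>Families of group elements of controlled size\<close>

text \<open>The group of all functions from an index set into a group. Uniform statements about all
  scales become statements about single elements and subgroups of this group, which allows
  generation arguments without naming constants.\<close>

definition fam :: "('a, 'b) monoid_scheme \<Rightarrow> ('i \<Rightarrow> 'a) monoid" where
  "fam G = \<lparr>carrier = {f. \<forall>i. f i \<in> carrier G}, monoid.mult = (\<lambda>f g i. f i \<otimes>\<^bsub>G\<^esub> g i), one = (\<lambda>i. \<one>\<^bsub>G\<^esub>)\<rparr>"

lemma fam_simps [simp]:
  "f \<in> carrier (fam G) \<longleftrightarrow> (\<forall>i. f i \<in> carrier G)"
  "f \<otimes>\<^bsub>fam G\<^esub> g = (\<lambda>i. f i \<otimes>\<^bsub>G\<^esub> g i)"
  "\<one>\<^bsub>fam G\<^esub> = (\<lambda>i. \<one>\<^bsub>G\<^esub>)"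
  by (simp_all add: fam_def)

definition bounded_exponents :: "('i \<Rightarrow> real) \<Rightarrow> real \<Rightarrow> ('i \<Rightarrow> int) set" where
  "bounded_exponents sc a = {n. \<exists>K. \<forall>i. \<bar>real_of_int (n i)\<bar> \<le> K * sc i powr a}"

text \<open>The families that are products of a bounded number of powers of letters from \<open>A\<close>, with
  exponents of order \<open>sc\<^sup>a\<close> for a letter of weight \<open>a\<close>; both the number of factors and the implied
  constants are independent of the index.\<close>

definition bounded_families ::
  "('a, 'b) monoid_scheme \<Rightarrow> ('i \<Rightarrow> real) \<Rightarrow> ('a \<times> real) set \<Rightarrow> ('i \<Rightarrow> 'a) set" where
  "bounded_families G sc A =
     generate (fam G) {\<lambda>i. g [^]\<^bsub>G\<^esub> n i | g a n. (g, a) \<in> A \<and> n \<in> bounded_exponents sc a}"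

lemma bounded_exponentsI: "(\<And>i. \<bar>real_of_int (n i)\<bar> \<le> K * sc i powr a) \<Longrightarrow> n \<in> bounded_exponents sc a"
  by (auto simp: bounded_exponents_def)

lemma bounded_exponentsE:
  assumes "n \<in> bounded_exponents sc a"
  obtains K where "0 \<le> K" "\<And>i. \<bar>real_of_int (n i)\<bar> \<le> K * sc i powr a"
proof -
  obtain K where K: "\<And>i. \<bar>real_of_int (n i)\<bar> \<le> K * sc i powr a"
    using assms by (auto simp: bounded_exponents_def)
  have "\<bar>real_of_int (n i)\<bar> \<le> \<bar>K\<bar> * sc i powr a" for i
    by (rule order_trans[OF K]) (simp add: mult_right_mono)
  then show ?thesis by (intro that[of "\<bar>K\<bar>"]) auto
qed

lemma bounded_exponents_mono:
  assumes "n \<in> bounded_exponents sc a" "a \<le> b" "\<And>i. 1 \<le> sc i"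
  shows "n \<in> bounded_exponents sc b"
proof -
  obtain K where K: "0 \<le> K" "\<And>i. \<bar>real_of_int (n i)\<bar> \<le> K * sc i powr a"
    using bounded_exponentsE[OF assms(1)] by blast
  show ?thesis
    by (rule bounded_exponentsI[of _ K], rule order_trans[OF K(2)])
      (use K(1) assms in \<open>auto intro!: mult_left_mono powr_mono\<close>)
qed

lemma bounded_exponents_uminus:
  "n \<in> bounded_exponents sc a \<Longrightarrow> (\<lambda>i. - n i) \<in> bounded_exponents sc a"
  by (auto simp: bounded_exponents_def)

context group begin

lemma group_fam: "group (fam G)"
proof (rule groupI)
  fix f assume f: "f \<in> carrier (fam G)"
  show "\<exists>g \<in> carrier (fam G). g \<otimes>\<^bsub>fam G\<^esub> f = \<one>\<^bsub>fam G\<^esub>"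
    by (rule bexI[of _ "\<lambda>i. inv f i"]) (use f in auto)
qed (auto simp: m_assoc)

lemma inv_fam: "(\<And>i. f i \<in> carrier G) \<Longrightarrow> inv\<^bsub>fam G\<^esub> f = (\<lambda>i. inv (f i))"
  using group_fam by (intro group.inv_equality) auto

lemma gcomm_fam:
  "(\<And>i. f i \<in> carrier G) \<Longrightarrow> (\<And>i. g i \<in> carrier G) \<Longrightarrow> gcomm (fam G) f g = (\<lambda>i. gcomm G (f i) (g i))"
  by (simp add: gcomm_def inv_fam)

lemma bounded_generators_closed:
  assumes "fst ` A \<subseteq> carrier G"
  shows "{\<lambda>i. g [^] n i | g a n. (g, a) \<in> A \<and> n \<in> bounded_exponents sc a} \<subseteq> carrier (fam G)"
  using assms by (fastforce intro: int_pow_closed)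

lemma subgroup_bounded_families:
  "fst ` A \<subseteq> carrier G \<Longrightarrow> subgroup (bounded_families G sc A) (fam G)"
  unfolding bounded_families_def
  by (rule group.generate_is_subgroup[OF group_fam bounded_generators_closed])

lemma bounded_familiesI:
  "(g, a) \<in> A \<Longrightarrow> n \<in> bounded_exponents sc a \<Longrightarrow> (\<lambda>i. g [^] n i) \<in> bounded_families G sc A"
  unfolding bounded_families_def by (rule generate.incl) blast

lemma bounded_families_mono: "A \<subseteq> B \<Longrightarrow> bounded_families G sc A \<subseteq> bounded_families G sc B"
  unfolding bounded_families_def by (rule group.mono_generate[OF group_fam]) blast

lemma bounded_families_minimal:
  assumes "subgroup H (fam G)"
    and "\<And>g a n. (g, a) \<in> A \<Longrightarrow> n \<in> bounded_exponents sc a \<Longrightarrow> (\<lambda>i. g [^] n i) \<in> H"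
  shows "bounded_families G sc A \<subseteq> H"
  unfolding bounded_families_def
  by (rule group.generate_subgroup_incl[OF group_fam _ assms(1)]) (use assms(2) in blast)

lemma bounded_families_mult:
  assumes "fst ` A \<subseteq> carrier G" "f \<in> bounded_families G sc A" "g \<in> bounded_families G sc A"
  shows "(\<lambda>i. f i \<otimes> g i) \<in> bounded_families G sc A"
  using subgroup.m_closed[OF subgroup_bounded_families[OF assms(1)] assms(2,3)] by simp

lemma family_in_boxes:
  assumes A: "fst ` A \<subseteq> carrier G" and "set L \<subseteq> A" and "\<And>i. h i \<in> pbox G L K (sc i)"
  shows "h \<in> bounded_families G sc A"
  using assms(2,3)
proof (induction L arbitrary: h)
  case Nil
  then have "h = \<one>\<^bsub>fam G\<^esub>" by auto
  then show ?case using subgroup.one_closed[OF subgroup_bounded_families[OF A]] by simp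
next
  case (Cons l L)
  obtain g a where l: "l = (g, a)" by force
  have "\<forall>i. \<exists>n z. h i = g [^] (n::int) \<otimes> z \<and> \<bar>real_of_int n\<bar> \<le> K * sc i powr a \<and> z \<in> pbox G L K (sc i)"
    using Cons.prems(2) l by auto
  then obtain n z where nz: "\<And>i. h i = g [^] (n i::int) \<otimes> z i"
    "\<And>i. \<bar>real_of_int (n i)\<bar> \<le> K * sc i powr a" "\<And>i. z i \<in> pbox G L K (sc i)"
    by metis
  have "(\<lambda>i. g [^] n i) \<in> bounded_families G sc A"
    using Cons.prems(1) l nz(2) by (intro bounded_familiesI bounded_exponentsI) auto
  moreover have "z \<in> bounded_families G sc A" using Cons.prems nz(3) by (intro Cons.IH) auto
  ultimately have "(\<lambda>i. g [^] n i \<otimes> z i) \<in> bounded_families G sc A" by (rule bounded_families_mult[OF A])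
  moreover have "h = (\<lambda>i. g [^] n i \<otimes> z i)" using nz(1) by auto
  ultimately show ?case by simp
qed

end

text \<open>The subgroups \<open>\<Gamma> w\<close> of families built from terms of weight at least \<open>w\<close> form a filtration of the
  group of families, with the same behaviour under commutators.\<close>

locale scaled_filtration = weight_filtration +
  fixes sc :: "'i \<Rightarrow> real"
  assumes scale_ge_1: "1 \<le> sc i"
begin

abbreviation \<Gamma> :: "real \<Rightarrow> ('i \<Rightarrow> 'a) set" where
  "\<Gamma> w \<equiv> bounded_families G sc (letters w)"

lemma letters_closed: "fst ` letters w \<subseteq> carrier G"
  using term_closed by (auto simp: letters_def)

sublocale F: group "fam G :: ('i \<Rightarrow> 'a) monoid"
  by (rule group_fam)

lemma \<Gamma>_subgroup: "subgroup (\<Gamma> w) (fam G)"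
  by (rule subgroup_bounded_families[OF letters_closed])

lemma \<Gamma>_antimono: "v \<le> w \<Longrightarrow> \<Gamma> w \<subseteq> \<Gamma> v"
  by (intro bounded_families_mono letters_antimono)

lemma \<Gamma>_closed: "p \<in> \<Gamma> w \<Longrightarrow> p \<in> carrier (fam G)"
  by (rule subgroup.mem_carrier[OF \<Gamma>_subgroup])

lemma \<Gamma>I: "a \<in> U \<Longrightarrow> w \<le> a \<Longrightarrow> g \<in> J a \<Longrightarrow> n \<in> bounded_exponents sc a \<Longrightarrow> (\<lambda>i. g [^] n i) \<in> \<Gamma> w"
  by (rule bounded_familiesI) (auto simp: letters_def)

text \<open>This is where the size bounds for commutators enter. Normality and centrality modulo higher weights follow from it formally.\<close>

lemma gcomm_generators:
  assumes a: "a \<in> U" and b: "b \<in> U" and x: "x \<in> J a" and y: "y \<in> J b"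
    and n: "n \<in> bounded_exponents sc a" and k: "k \<in> bounded_exponents sc b"
  shows "gcomm (fam G) (\<lambda>i. x [^] n i) (\<lambda>i. y [^] k i) \<in> \<Gamma> (a + b)"
proof -
  have xc: "x \<in> carrier G" and yc: "y \<in> carrier G" using term_closed a b x y by auto
  obtain K where K: "0 \<le> K" "\<And>i. \<bar>real_of_int (n i)\<bar> \<le> K * sc i powr a"
    using bounded_exponentsE[OF n] by blast
  obtain K' where K': "0 \<le> K'" "\<And>i. \<bar>real_of_int (k i)\<bar> \<le> K' * sc i powr b"
    using bounded_exponentsE[OF k] by blast
  have KK: "0 \<le> K + K'" using K K' by simp
  obtain L C where L: "set L \<subseteq> letters (a + b)" and C: "0 \<le> C"
    and *: "comm_estimate (K + K') C [(x, a)] [(y, b)] L"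
    by (rule comm_boundE[OF comm_bound[OF weight_gap(2)[OF a] weight_gap(2)[OF b]] KK
        letters_term[OF a x] letters_term[OF b y]]) (rule that)
  note * = comm_estimateD[OF *]
  have "gcomm G (x [^] n i) (y [^] k i) \<in> pbox G L (C * (K * K')) (sc i)" for i
    using K K' scale_ge_1 by (intro *) (auto simp: pbox_single xc yc simp del: pbox.simps)
  then show ?thesis
    using xc yc family_in_boxes[OF letters_closed L, of _ "C * (K * K')" sc] by (simp add: gcomm_fam)
qed

lemma \<Gamma>_normal:
  assumes p: "p \<in> \<Gamma> 0" and h: "h \<in> \<Gamma> w"
  shows "p \<otimes>\<^bsub>fam G\<^esub> h \<otimes>\<^bsub>fam G\<^esub> inv\<^bsub>fam G\<^esub> p \<in> \<Gamma> w"
proof -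
  let ?X = "\<lambda>w. {\<lambda>i. g [^] n i | g a n. (g, a) \<in> letters w \<and> n \<in> bounded_exponents sc a}"
  have conj: "x \<otimes>\<^bsub>fam G\<^esub> z \<otimes>\<^bsub>fam G\<^esub> inv\<^bsub>fam G\<^esub> x \<in> \<Gamma> w" if x: "x \<in> ?X 0" and z: "z \<in> ?X w" for x z
  proof -
    obtain g a n where g: "x = (\<lambda>i. g [^] n i)" "a \<in> U" "g \<in> J a" "n \<in> bounded_exponents sc a"
      using x by (auto simp: letters_def)
    obtain h b k where h: "z = (\<lambda>i. h [^] k i)" "b \<in> U" "w \<le> b" "h \<in> J b" "k \<in> bounded_exponents sc b"
      using z by (auto simp: letters_def)
    have c: "x \<in> carrier (fam G)" "z \<in> carrier (fam G)"
      unfolding fam_simps g(1) h(1) using term_closed[OF g(2,3)] term_closed[OF h(2,4)] by auto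
    have "gcomm (fam G) x z \<in> \<Gamma> (a + b)"
      unfolding g(1) h(1) by (rule gcomm_generators) (use g h in auto)
    then have 1: "gcomm (fam G) x z \<in> \<Gamma> w"
      using \<Gamma>_antimono[of w "a + b"] h(3) weight_pos[OF g(2)] by auto
    have 2: "z \<in> \<Gamma> w" unfolding h(1) using h by (intro \<Gamma>I) auto
    show ?thesis
      unfolding F.conj_eq_gcomm[OF c] by (rule subgroup.m_closed[OF \<Gamma>_subgroup 1 2])
  qed
  have conj_inv: "inv\<^bsub>fam G\<^esub> x \<otimes>\<^bsub>fam G\<^esub> z \<otimes>\<^bsub>fam G\<^esub> x \<in> \<Gamma> w" if x: "x \<in> ?X 0" and z: "z \<in> ?X w" for x z
  proof -
    obtain g a n where g: "x = (\<lambda>i. g [^] n i)" "(g, a) \<in> letters 0" "n \<in> bounded_exponents sc a"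
      using x by auto
    have gc: "g \<in> carrier G" using g(2) letters_closed by force
    have "inv\<^bsub>fam G\<^esub> x = (\<lambda>i. g [^] (- n i))" using gc by (simp add: g(1) inv_fam int_pow_neg)
    then have "inv\<^bsub>fam G\<^esub> x \<in> ?X 0" using g(2) bounded_exponents_uminus[OF g(3)] by force
    from conj[OF this z] show ?thesis
      using gc g(1) F.inv_inv[of x] by simp
  qed
  show ?thesis
    using F.generate_normalizes[OF bounded_generators_closed[OF letters_closed]
        bounded_generators_closed[OF letters_closed]
        conj[unfolded bounded_families_def] conj_inv[unfolded bounded_families_def]
        p[unfolded bounded_families_def] h[unfolded bounded_families_def]]
    unfolding bounded_families_def .
qed

lemma \<Gamma>_gcomm:
  assumes p: "p \<in> \<Gamma> 0" and h: "h \<in> \<Gamma> w"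
  shows "gcomm (fam G) p h \<in> \<Gamma> (w + weight_gap)"
proof -
  let ?X = "\<lambda>w. {\<lambda>i. g [^] n i | g a n. (g, a) \<in> letters w \<and> n \<in> bounded_exponents sc a}"
  have base: "gcomm (fam G) x z \<in> \<Gamma> (w + weight_gap)" if x: "x \<in> ?X 0" and z: "z \<in> ?X w" for x z
  proof -
    obtain g a n where g: "x = (\<lambda>i. g [^] n i)" "a \<in> U" "g \<in> J a" "n \<in> bounded_exponents sc a"
      using x by (auto simp: letters_def)
    obtain h b k where h: "z = (\<lambda>i. h [^] k i)" "b \<in> U" "w \<le> b" "h \<in> J b" "k \<in> bounded_exponents sc b"
      using z by (auto simp: letters_def)
    have "gcomm (fam G) x z \<in> \<Gamma> (a + b)"
      unfolding g(1) h(1) by (rule gcomm_generators) (use g h in auto)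
    then show ?thesis
      using \<Gamma>_antimono[of "w + weight_gap" "a + b"] h(3) weight_gap(2)[OF g(2)] by auto
  qed
  have sub: "\<Gamma> w \<subseteq> \<Gamma> 0"
    by (intro bounded_families_mono) (use weight_pos in \<open>auto simp: letters_def less_imp_le\<close>)
  have norm: "q \<otimes>\<^bsub>fam G\<^esub> k \<otimes>\<^bsub>fam G\<^esub> inv\<^bsub>fam G\<^esub> q \<in> \<Gamma> (w + weight_gap)"
    if "q \<in> generate (fam G) (?X 0) \<union> generate (fam G) (?X w)" "k \<in> \<Gamma> (w + weight_gap)" for q k
    using that sub by (intro \<Gamma>_normal) (auto simp: bounded_families_def)
  show ?thesis
    by (rule F.gcomm_generate[OF bounded_generators_closed[OF letters_closed]
        bounded_generators_closed[OF letters_closed] \<Gamma>_subgroup norm base])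
      (use p h in \<open>simp_all add: bounded_families_def\<close>)
qed

lemma \<Gamma>_le_0: "\<Gamma> w \<subseteq> \<Gamma> 0"
  by (intro bounded_families_mono) (use weight_pos in \<open>auto simp: letters_def less_imp_le\<close>)

lemma \<Gamma>_trivial:
  assumes "\<forall>w \<in> U. t \<le> w \<longrightarrow> J w = {\<one>}" "p \<in> \<Gamma> t"
  shows "p = \<one>\<^bsub>fam G\<^esub>"
proof -
  have "\<Gamma> t \<subseteq> {\<one>\<^bsub>fam G\<^esub>}"
    using assms(1) by (intro bounded_families_minimal F.triv_subgroup) (auto simp: letters_def)
  then show ?thesis using assms(2) by blast
qed

text \<open>The product \<open>\<Gamma>\<^sub>s B\<close>, with \<open>B\<close> cut down to \<open>\<Gamma>\<^sub>0\<close>, which normalizes \<open>\<Gamma>\<^sub>s\<close>; families in \<open>B\<close> may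
  take values outside the filtered group.\<close>

definition cosets_over :: "('i \<Rightarrow> 'a) set \<Rightarrow> real \<Rightarrow> ('i \<Rightarrow> 'a) set" where
  "cosets_over B s = {p. \<exists>\<gamma> \<in> \<Gamma> s. \<exists>b \<in> B \<inter> \<Gamma> 0. p = \<gamma> \<otimes>\<^bsub>fam G\<^esub> b}"

lemma subgroup_cosets_over:
  assumes B: "subgroup B (fam G)"
  shows "subgroup (cosets_over B s) (fam G)"
proof -
  interpret B: subgroup "B \<inter> \<Gamma> 0" "fam G"
    by (rule F.subgroups_Inter_pair[OF B \<Gamma>_subgroup])
  interpret S: subgroup "\<Gamma> s" "fam G" by (rule \<Gamma>_subgroup)
  note fam_simps [simp del]
  have conj: "b \<otimes>\<^bsub>fam G\<^esub> \<gamma> \<otimes>\<^bsub>fam G\<^esub> inv\<^bsub>fam G\<^esub> b \<in> \<Gamma> s" if "b \<in> B \<inter> \<Gamma> 0" "\<gamma> \<in> \<Gamma> s" for b \<gamma>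
    using that by (intro \<Gamma>_normal) auto
  show ?thesis
  proof (rule F.subgroupI)
    show "cosets_over B s \<subseteq> carrier (fam G)" by (auto simp: cosets_over_def)
    show "cosets_over B s \<noteq> {}" using B.one_closed S.one_closed unfolding cosets_over_def by blast
  next
    fix p assume "p \<in> cosets_over B s"
    then obtain \<gamma> b where *: "\<gamma> \<in> \<Gamma> s" "b \<in> B \<inter> \<Gamma> 0" "p = \<gamma> \<otimes>\<^bsub>fam G\<^esub> b" by (auto simp: cosets_over_def)
    have ib: "inv\<^bsub>fam G\<^esub> b \<in> B \<inter> \<Gamma> 0" using *(2) by (rule B.m_inv_closed)
    have "inv\<^bsub>fam G\<^esub> p = (inv\<^bsub>fam G\<^esub> b \<otimes>\<^bsub>fam G\<^esub> inv\<^bsub>fam G\<^esub> \<gamma> \<otimes>\<^bsub>fam G\<^esub> inv\<^bsub>fam G\<^esub> (inv\<^bsub>fam G\<^esub> b)) \<otimes>\<^bsub>fam G\<^esub> inv\<^bsub>fam G\<^esub> b"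
      using * S.mem_carrier B.mem_carrier by (simp add: F.inv_mult_group F.m_assoc)
    then show "inv\<^bsub>fam G\<^esub> p \<in> cosets_over B s"
      unfolding cosets_over_def using conj[OF ib S.m_inv_closed[OF *(1)]] ib by blast
  next
    fix p q assume "p \<in> cosets_over B s" "q \<in> cosets_over B s"
    then obtain \<gamma> b \<gamma>' b' where *: "\<gamma> \<in> \<Gamma> s" "b \<in> B \<inter> \<Gamma> 0" "p = \<gamma> \<otimes>\<^bsub>fam G\<^esub> b"
      "\<gamma>' \<in> \<Gamma> s" "b' \<in> B \<inter> \<Gamma> 0" "q = \<gamma>' \<otimes>\<^bsub>fam G\<^esub> b'" unfolding cosets_over_def by blast
    have "p \<otimes>\<^bsub>fam G\<^esub> q = (\<gamma> \<otimes>\<^bsub>fam G\<^esub> (b \<otimes>\<^bsub>fam G\<^esub> \<gamma>' \<otimes>\<^bsub>fam G\<^esub> inv\<^bsub>fam G\<^esub> b)) \<otimes>\<^bsub>fam G\<^esub> (b \<otimes>\<^bsub>fam G\<^esub> b')"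
      using * S.mem_carrier B.mem_carrier by (simp add: F.m_assoc)
    then show "p \<otimes>\<^bsub>fam G\<^esub> q \<in> cosets_over B s"
      unfolding cosets_over_def
      using S.m_closed[OF *(1) conj[OF *(2,4)]] B.m_closed[OF *(2,5)] by blast
  qed
qed

lemma \<Gamma>_le_cosets_over:
  assumes B: "subgroup B (fam G)"
  shows "\<Gamma> s \<subseteq> cosets_over B s"
proof
  fix p assume p: "p \<in> \<Gamma> s"
  have "p = p \<otimes>\<^bsub>fam G\<^esub> \<one>\<^bsub>fam G\<^esub>" using \<Gamma>_closed[OF p] by (simp only: F.r_one)
  then show "p \<in> cosets_over B s"
    unfolding cosets_over_def
    using p subgroup.one_closed[OF B] subgroup.one_closed[OF \<Gamma>_subgroup] by blast
qed

lemma le_cosets_over: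
  assumes B: "subgroup B (fam G)"
  shows "B \<inter> \<Gamma> 0 \<subseteq> cosets_over B s"
proof
  fix p assume p: "p \<in> B \<inter> \<Gamma> 0"
  then have "p \<in> carrier (fam G)" using \<Gamma>_closed by blast
  then have "p = \<one>\<^bsub>fam G\<^esub> \<otimes>\<^bsub>fam G\<^esub> p" by (simp only: F.l_one)
  then show "p \<in> cosets_over B s"
    unfolding cosets_over_def using p subgroup.one_closed[OF \<Gamma>_subgroup] by blast
qed

text \<open>Factors from \<open>\<Gamma>\<^sub>w\<close> are central modulo \<open>\<Gamma>\<^sub>s\<close>. Hence elements known modulo \<open>\<Gamma>\<^sub>w\<close> have commutators
  known modulo the smaller group \<open>\<Gamma>\<^sub>s\<close>.\<close>

lemma gcomm_cosets_over:
  assumes B: "subgroup B (fam G)" and s: "\<Gamma> (w + weight_gap) \<subseteq> \<Gamma> s"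
    and p: "p \<in> cosets_over B w" and q: "q \<in> cosets_over B w"
  shows "gcomm (fam G) p q \<in> cosets_over B s"
proof -
  interpret H: subgroup "cosets_over B s" "fam G" by (rule subgroup_cosets_over[OF B])
  interpret B: subgroup "B \<inter> \<Gamma> 0" "fam G"
    by (rule F.subgroups_Inter_pair[OF B \<Gamma>_subgroup])
  interpret S: subgroup "\<Gamma> 0" "fam G" by (rule \<Gamma>_subgroup)
  note fam_simps [simp del]
  obtain \<gamma> b where p': "\<gamma> \<in> \<Gamma> w" "b \<in> B \<inter> \<Gamma> 0" "p = \<gamma> \<otimes>\<^bsub>fam G\<^esub> b"
    using p by (auto simp: cosets_over_def)
  obtain \<gamma>' b' where q': "\<gamma>' \<in> \<Gamma> w" "b' \<in> B \<inter> \<Gamma> 0" "q = \<gamma>' \<otimes>\<^bsub>fam G\<^esub> b'"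
    using q by (auto simp: cosets_over_def)
  have c: "\<gamma> \<in> carrier (fam G)" "b \<in> carrier (fam G)" "\<gamma>' \<in> carrier (fam G)" "b' \<in> carrier (fam G)"
      "q \<in> carrier (fam G)" "p \<in> carrier (fam G)"
    using p' q' \<Gamma>_closed B.mem_carrier by auto
  have q0: "q \<in> \<Gamma> 0" and b0: "b \<in> \<Gamma> 0" and b0': "b' \<in> \<Gamma> 0" and g0: "\<gamma>' \<in> \<Gamma> 0"
    using p' q' \<Gamma>_le_0 S.m_closed by blast+
  have central: "gcomm (fam G) u v \<in> cosets_over B s" if "u \<in> \<Gamma> 0" "v \<in> \<Gamma> w" for u v
    using \<Gamma>_gcomm[OF that] s \<Gamma>_le_cosets_over[OF B] by blast
  have central': "gcomm (fam G) v u \<in> cosets_over B s" if "u \<in> \<Gamma> 0" "v \<in> \<Gamma> w" for u v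
    using H.m_inv_closed[OF central[OF that]] \<Gamma>_closed that by (simp add: F.inv_gcomm)
  have comm0: "gcomm (fam G) u v \<in> \<Gamma> 0" if "u \<in> \<Gamma> 0" "v \<in> \<Gamma> 0" for u v
    using \<Gamma>_gcomm[OF that] \<Gamma>_le_0 by blast
  have "gcomm (fam G) b b' \<in> B \<inter> \<Gamma> 0"
    unfolding gcomm_def using p'(2) q'(2) by (intro B.m_closed B.m_inv_closed)
  then have bb: "gcomm (fam G) b b' \<in> cosets_over B s" using le_cosets_over[OF B] by blast
  have "gcomm (fam G) b q = gcomm (fam G) b \<gamma>' \<otimes>\<^bsub>fam G\<^esub> gcomm (fam G) \<gamma>' (gcomm (fam G) b b') \<otimes>\<^bsub>fam G\<^esub> gcomm (fam G) b b'"
    unfolding q'(3) using c by (intro F.gcomm_mult_right)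
  also have "\<dots> \<in> cosets_over B s"
    using b0 q'(1) b0' by (intro H.m_closed central central' bb comm0)
  finally have bq: "gcomm (fam G) b q \<in> cosets_over B s" .
  have "gcomm (fam G) p q = gcomm (fam G) \<gamma> (gcomm (fam G) b q) \<otimes>\<^bsub>fam G\<^esub> gcomm (fam G) b q \<otimes>\<^bsub>fam G\<^esub> gcomm (fam G) \<gamma> q"
    unfolding p'(3) using c by (intro F.gcomm_mult_left)
  also have "\<dots> \<in> cosets_over B s"
    using p'(1) q0 b0 by (intro H.m_closed central' bq comm0)
  finally show ?thesis .
qed

text \<open>The sign of the exponent may vary with the index, so the positive and negative parts are
  treated as separate families.\<close>

lemma power_family_nat_int:
  assumes H: "subgroup H (fam G)" and g: "g \<in> carrier G" and n: "n \<in> bounded_exponents sc a"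
    and nat: "\<And>m K. 0 \<le> K \<Longrightarrow> (\<And>i. real (m i) \<le> K * sc i powr a) \<Longrightarrow> (\<lambda>i. g [^] (m i :: nat)) \<in> H"
  shows "(\<lambda>i. g [^] (n i :: int)) \<in> H"
proof -
  obtain K where K: "0 \<le> K" "\<And>i. \<bar>real_of_int (n i)\<bar> \<le> K * sc i powr a"
    using bounded_exponentsE[OF n] by blast
  have K': "real_of_int (n i) \<le> K * sc i powr a" "- real_of_int (n i) \<le> K * sc i powr a" for i
    using K(2)[of i] by linarith+
  have K0: "0 \<le> K * sc i powr a" for i using K(1) by simp
  have b: "real (nat (n i)) \<le> K * sc i powr a" "real (nat (- n i)) \<le> K * sc i powr a" for i
    using K'[of i] K0[of i] by (cases "0 \<le> n i"; simp)+
  have 1: "(\<lambda>i. g [^] nat (n i)) \<in> H" and 2: "(\<lambda>i. g [^] nat (- n i)) \<in> H"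
    by (rule nat[OF K(1)], rule b)+
  have "g [^] n i = g [^] nat (n i) \<otimes> inv (g [^] nat (- n i))" for i
    using g by (simp add: int_pow_def2 del: pow_nat)
  then have "(\<lambda>i. g [^] (n i :: int)) = (\<lambda>i. g [^] nat (n i)) \<otimes>\<^bsub>fam G\<^esub> inv\<^bsub>fam G\<^esub> (\<lambda>i. g [^] nat (- n i))"
    using g by (simp add: inv_fam)
  also have "\<dots> \<in> H" by (intro subgroup.m_closed[OF H] subgroup.m_inv_closed[OF H] 1 2)
  finally show ?thesis .
qed

lemma gcomm_power_family:
  assumes B: "subgroup B (fam G)" and s: "\<Gamma> (a + b + weight_gap) \<subseteq> \<Gamma> s"
    and IH: "\<Gamma> 0 \<subseteq> cosets_over B (a + b)"
    and a: "a \<in> U" and b: "b \<in> U" and x: "x \<in> J a" and y: "y \<in> J b" and K: "0 \<le> K"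
    and n: "\<And>i. real (n i) \<le> K * sc i powr a" and k: "\<And>i. real (k i) \<le> K * sc i powr b"
  shows "(\<lambda>i. gcomm G x y [^] (n i * k i :: nat)) \<in> cosets_over B s"
proof -
  interpret H: subgroup "cosets_over B s" "fam G" by (rule subgroup_cosets_over[OF B])
  have xc: "x \<in> carrier G" and yc: "y \<in> carrier G" using a b x y term_closed by auto
  obtain L C where L: "set L \<subseteq> letters (a + b + weight_gap)" and C: "0 \<le> C"
    and *: "\<And>r n k. 1 \<le> r \<Longrightarrow> real n \<le> K * r powr a \<Longrightarrow> real k \<le> K * r powr b \<Longrightarrow>
       \<exists>z \<in> pbox G L C r. gcomm G (x [^] (n::nat)) (y [^] (k::nat)) = z \<otimes> gcomm G x y [^] (n * k)"
    by (rule gcomm_pow_collect[OF a b x y K]) (rule that)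
  obtain z where z: "\<And>i. z i \<in> pbox G L C (sc i)"
    "\<And>i. gcomm G (x [^] n i) (y [^] k i) = z i \<otimes> gcomm G x y [^] (n i * k i)"
    using *[OF scale_ge_1 n k] by metis
  have zH: "z \<in> cosets_over B s"
    using family_in_boxes[OF letters_closed L, of z C sc] z(1) s \<Gamma>_le_cosets_over[OF B] by blast
  have zc: "z i \<in> carrier G" for i by (rule pbox_closed[OF z(1) letters_carrier[OF L]])
  have "(\<lambda>i. x [^] int (n i)) \<in> \<Gamma> 0"
    using n weight_pos[OF a] by (intro \<Gamma>I[OF a _ x] bounded_exponentsI[of _ K]) auto
  moreover have "(\<lambda>i. y [^] int (k i)) \<in> \<Gamma> 0"
    using k weight_pos[OF b] by (intro \<Gamma>I[OF b _ y] bounded_exponentsI[of _ K]) auto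
  ultimately have "gcomm (fam G) (\<lambda>i. x [^] n i) (\<lambda>i. y [^] k i) \<in> cosets_over B s"
    using IH by (intro gcomm_cosets_over[OF B s]) (auto simp: int_pow_int)
  then have "inv\<^bsub>fam G\<^esub> z \<otimes>\<^bsub>fam G\<^esub> gcomm (fam G) (\<lambda>i. x [^] n i) (\<lambda>i. y [^] k i) \<in> cosets_over B s"
    by (intro H.m_closed H.m_inv_closed zH)
  then show ?thesis using xc yc zc by (simp add: inv_fam gcomm_fam z(2))
qed

text \<open>If every term \<open>J w\<close> is generated modulo larger weights by a set \<open>Y w\<close> and by commutators of
  terms of smaller weight, then admissible powers of all elements are admissible products of powers
  of elements of the sets \<open>Y w\<close>. It is shown that \<open>\<Gamma>\<^sub>0 = \<Gamma>\<^sub>s (B \<inter> \<Gamma>\<^sub>0)\<close> for increasing \<open>s\<close>, until \<open>\<Gamma>\<^sub>s\<close> is trivial.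
  In passing over the weight \<open>w\<close>, commutators \<open>[x, y]\<close> are the critical generators: their powers are
  commutators of powers of \<open>x\<close> and \<open>y\<close>, and these are known modulo \<open>\<Gamma>\<^sub>w\<close>.\<close>

proposition power_families_generated:
  assumes B: "subgroup B (fam G)"
    and Y: "\<And>w y. w \<in> U \<Longrightarrow> y \<in> Y w \<Longrightarrow> y \<in> J w"
    and YB: "\<And>w y n. w \<in> U \<Longrightarrow> y \<in> Y w \<Longrightarrow> n \<in> bounded_exponents sc w \<Longrightarrow> (\<lambda>i. y [^] n i) \<in> B"
    and gen: "\<And>w. w \<in> U \<Longrightarrow> J w \<subseteq> generate G (Y w \<union> \<Union> {J v | v. v \<in> U \<and> w < v} \<union>
      {gcomm G x y | x y. \<exists>a \<in> U. \<exists>b \<in> U. a + b = w \<and> x \<in> J a \<and> y \<in> J b})"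
    and g: "w \<in> U" "g \<in> J w" "n \<in> bounded_exponents sc w"
  shows "(\<lambda>i. g [^] n i) \<in> B"
proof -
  have "\<Gamma> 0 \<subseteq> cosets_over B s" for s
  proof (induction "card {a \<in> U. a < s}" arbitrary: s rule: less_induct)
    case less
    have fin: "finite {a \<in> U. a < s}" by (rule finite_subset[OF _ weights_finite[of s]]) auto
    show ?case
    proof (cases "{a \<in> U. a < s} = {}")
      case True
      then have "letters 0 \<subseteq> letters s" by (auto simp: letters_def not_less[symmetric])
      then show ?thesis using \<Gamma>_le_cosets_over[OF B, of s] bounded_families_mono by blast
    next
      case False
      \<comment> \<open>The last weight before \<open>s\<close>, the only one that separates \<open>\<Gamma>\<^sub>w\<close> from \<open>\<Gamma>\<^sub>s\<close>.\<close>
      define w where "w = Max {a \<in> U. a < s}"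
      have w: "w \<in> U" "w < s" using Max_in[OF fin False] by (auto simp: w_def)
      have ge_s: "s \<le> a" if "a \<in> U" "w < a" for a
        using that Max_ge[OF fin, of a] by (cases "a < s") (auto simp: w_def)
      have step: "\<Gamma> v \<subseteq> \<Gamma> s" if "w < v" for v
        using that ge_s by (intro bounded_families_mono) (auto simp: letters_def)
      have "{a \<in> U. a < w} \<subset> {a \<in> U. a < s}" using w by auto
      then have IH: "\<Gamma> 0 \<subseteq> cosets_over B w" using fin by (intro less psubset_card_mono)
      interpret H: subgroup "cosets_over B s" "fam G" by (rule subgroup_cosets_over[OF B])
      have \<Gamma>s: "\<Gamma> s \<subseteq> cosets_over B s" by (rule \<Gamma>_le_cosets_over[OF B])
      have wlw: "\<Gamma> (w + weight_gap) \<subseteq> \<Gamma> s" using weight_gap(1) by (intro step) auto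
      let ?good = "\<lambda>g. g \<in> J w \<and> (\<forall>n \<in> bounded_exponents sc w. (\<lambda>i. g [^] n i) \<in> cosets_over B s)"
      have gens: "?good g" if "g \<in> Y w \<union> \<Union> {J v | v. v \<in> U \<and> w < v} \<union>
        {gcomm G x y | x y. \<exists>a \<in> U. \<exists>b \<in> U. a + b = w \<and> x \<in> J a \<and> y \<in> J b}" for g
      proof -
        from that consider "g \<in> Y w" | v where "v \<in> U" "w < v" "g \<in> J v"
        | x y a b where "a \<in> U" "b \<in> U" "a + b = w" "x \<in> J a" "y \<in> J b" "g = gcomm G x y"
        by blast
      then show ?thesis
      proof cases
        case 1
        have "(\<lambda>i. g [^] n i) \<in> cosets_over B s" if "n \<in> bounded_exponents sc w" for n
          using YB[OF w(1) 1 that] \<Gamma>I[OF w(1) _ Y[OF w(1) 1] that, of 0] weight_pos[OF w(1)]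
            le_cosets_over[OF B] by auto
        then show ?thesis using Y[OF w(1) 1] by blast
      next
        case 2
        have "(\<lambda>i. g [^] n i) \<in> cosets_over B s" if "n \<in> bounded_exponents sc w" for n
          using 2 \<Gamma>s ge_s bounded_exponents_mono[OF that _ scale_ge_1, of v]
          by (auto intro!: subsetD[OF \<Gamma>s] \<Gamma>I[of v])
        then show ?thesis using term_antimono[OF w(1) 2(1)] 2 by auto
      next
        case 3
        have gJ: "g \<in> J w" using term_gcomm[OF 3(1,2,4,5)] 3 by simp
        have gc: "g \<in> carrier G" using gJ term_closed w by blast
        have s': "\<Gamma> (a + b + weight_gap) \<subseteq> \<Gamma> s" using wlw 3(3) by simp
        have IH': "\<Gamma> 0 \<subseteq> cosets_over B (a + b)" using IH 3(3) by simp
        have "(\<lambda>i. g [^] n i) \<in> cosets_over B s" if n: "n \<in> bounded_exponents sc w" for n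
        proof (rule power_family_nat_int[OF H.subgroup_axioms gc n])
          fix m :: "'i \<Rightarrow> nat" and K :: real
          assume K: "0 \<le> K" and m: "\<And>i. real (m i) \<le> K * sc i powr w"
          \<comment> \<open>The exponent is split as \<open>m = n1 q + (m mod n1)\<close> with \<open>n1\<close> of order \<open>sc\<^sup>a\<close> and \<open>q\<close> of order
            \<open>sc\<^sup>b\<close>; the remainder is smaller than \<open>n1\<close> and is treated with the second exponent \<open>1\<close>.\<close>
          define n1 where "n1 i = nat \<lceil>sc i powr a\<rceil>" for i
          have s1: "1 \<le> sc i powr a" for i
            using scale_ge_1 weight_pos[OF 3(1)] by (intro ge_one_powr_ge_zero) auto
          have n1: "sc i powr a \<le> real (n1 i)" "real (n1 i) \<le> 2 * sc i powr a" "0 < n1 i" for i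
            using s1[of i] unfolding n1_def by linarith+
          have q: "real (m i div n1 i) \<le> K * sc i powr b" for i
          proof -
            have "real (m i div n1 i) * sc i powr a \<le> real (m i div n1 i) * real (n1 i)"
              using n1(1) by (intro mult_left_mono) auto
            also have "\<dots> \<le> real (m i)" by (metis div_times_less_eq_dividend of_nat_le_iff of_nat_mult)
            also have "\<dots> \<le> K * sc i powr w" by (rule m)
            also have "\<dots> = K * sc i powr b * sc i powr a" by (simp add: powr_add flip: 3(3))
            finally show ?thesis
                  by (rule mult_right_le_imp_le) (use s1[of i] in linarith)
          qed
          have mono: "C * sc i powr c \<le> (K + 2) * sc i powr c" if "C \<le> K + 2" for i c C
            using that by (intro mult_right_mono) auto
          have one: "real 1 \<le> (K + 2) * sc i powr b" for i
            using mult_mono[of 1 "K + 2" 1 "sc i powr b"] K scale_ge_1[of i] weight_pos[OF 3(2)]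
            by (auto simp: ge_one_powr_ge_zero)
          have "(\<lambda>i. gcomm G x y [^] (n1 i * (m i div n1 i))) \<in> cosets_over B s"
            using K order_trans[OF n1(2) mono] order_trans[OF q mono]
            by (intro gcomm_power_family[OF B s' IH' 3(1,2,4,5), of "K + 2"]) auto
          moreover have "(\<lambda>i. gcomm G x y [^] (m i mod n1 i * 1)) \<in> cosets_over B s"
          proof (rule gcomm_power_family[OF B s' IH' 3(1,2,4,5), of "K + 2"])
            have "real (m i mod n1 i) \<le> real (n1 i)" for i using n1(3)[of i] by simp
            then show "real (m i mod n1 i) \<le> (K + 2) * sc i powr a" for i
              using order_trans[OF order_trans[OF _ n1(2)] mono] K by simp
          qed (use K one in auto)
          ultimately have "(\<lambda>i. g [^] (n1 i * (m i div n1 i))) \<otimes>\<^bsub>fam G\<^esub> (\<lambda>i. g [^] (m i mod n1 i)) \<in> cosets_over B s"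
            using 3(6) by (intro H.m_closed) auto
          then show "(\<lambda>i. g [^] m i) \<in> cosets_over B s"
            using gc by (simp add: nat_pow_mult)
        qed
        then show ?thesis using gJ by blast
      qed
      qed
      have Jw: "?good g" if "g \<in> J w" for g
        using subsetD[OF gen[OF w(1)] that]
      proof induction
        case one
        then show ?case using subgroup.one_closed[OF term_subgroup[OF w(1)]] H.one_closed by simp
      next
        case (incl g)
        then show ?case by (rule gens)
      next
        case (inv h)
        have h: "h \<in> J w" "\<And>n. n \<in> bounded_exponents sc w \<Longrightarrow> (\<lambda>i. h [^] n i) \<in> cosets_over B s"
          using gens[OF inv] by auto
        have hc: "h \<in> carrier G" using h(1) term_closed w by blast
        have "(\<lambda>i. inv h [^] n i) \<in> cosets_over B s" if "n \<in> bounded_exponents sc w" for n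
          using h(2)[OF bounded_exponents_uminus[OF that]] hc by (simp add: int_pow_neg int_pow_inv)
        then show ?case using subgroup.m_inv_closed[OF term_subgroup[OF w(1)] h(1)] by blast
      next
        case (eng g h)
        have gc: "g \<in> carrier G" and hc: "h \<in> carrier G" using eng term_closed w by auto
        have gh: "g \<otimes> h \<in> J w" using eng subgroup.m_closed[OF term_subgroup[OF w(1)]] by blast
        have "(\<lambda>i. (g \<otimes> h) [^] n i) \<in> cosets_over B s" if n: "n \<in> bounded_exponents sc w" for n
        proof (rule power_family_nat_int[OF H.subgroup_axioms m_closed[OF gc hc] n])
          fix m :: "'i \<Rightarrow> nat" and K :: real
          assume K: "0 \<le> K" and m: "\<And>i. real (m i) \<le> K * sc i powr w"
          obtain L C where L: "set L \<subseteq> letters (w + w)" and C: "0 \<le> C"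
            and *: "\<And>r n. 1 \<le> r \<Longrightarrow> real n \<le> K * r powr w \<Longrightarrow>
               \<exists>z \<in> pbox G L C r. (g \<otimes> h) [^] (n::nat) = z \<otimes> h [^] n \<otimes> g [^] n"
            by (rule pow_mult_collect[OF w(1) conjunct1[OF eng.IH(1)] conjunct1[OF eng.IH(2)] K]) (rule that)
          obtain z where z: "\<And>i. z i \<in> pbox G L C (sc i)"
            "\<And>i. (g \<otimes> h) [^] m i = z i \<otimes> h [^] m i \<otimes> g [^] m i"
            using *[OF scale_ge_1 m] by metis
          have "z \<in> cosets_over B s"
            using family_in_boxes[OF letters_closed L, of z C sc] z(1) step[of "w + w"] weight_pos[OF w(1)] \<Gamma>s by auto
          moreover have mb: "(\<lambda>i. int (m i)) \<in> bounded_exponents sc w"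
            using m by (intro bounded_exponentsI) auto
          note bspec[OF conjunct2[OF eng.IH(1)] mb] bspec[OF conjunct2[OF eng.IH(2)] mb]
          ultimately have "z \<otimes>\<^bsub>fam G\<^esub> (\<lambda>i. h [^] m i) \<otimes>\<^bsub>fam G\<^esub> (\<lambda>i. g [^] m i) \<in> cosets_over B s"
            by (intro H.m_closed) (auto simp: int_pow_int)
          then show "(\<lambda>i. (g \<otimes> h) [^] m i) \<in> cosets_over B s" by (simp add: z(2))
        qed
        then show ?case using gh by blast
      qed
      have "\<Gamma> w \<subseteq> cosets_over B s"
      proof (rule bounded_families_minimal[OF H.subgroup_axioms])
        fix g a n assume ga: "(g, a) \<in> letters w" and n: "n \<in> bounded_exponents sc a"
        show "(\<lambda>i. g [^] n i) \<in> cosets_over B s"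
        proof (cases "a = w")
          case True
          then show ?thesis using Jw ga n by (auto simp: letters_def)
        next
          case False
          then have "(\<lambda>i. g [^] n i) \<in> \<Gamma> s" using ga n ge_s by (intro \<Gamma>I[of a]) (auto simp: letters_def)
          then show ?thesis using \<Gamma>s by blast
        qed
      qed
      then have "cosets_over B w \<subseteq> cosets_over B s"
        using le_cosets_over[OF B, of s] H.m_closed unfolding cosets_over_def[of B w] by blast
      then show ?thesis using IH by blast
    qed
  qed
  obtain t where t: "\<forall>w \<in> U. t \<le> w \<longrightarrow> J w = {\<one>}" using term_trivial by blast
  have "(\<lambda>i. g [^] n i) \<in> \<Gamma> 0" using g weight_pos[OF g(1)] by (intro \<Gamma>I[of w]) auto
  then obtain \<gamma> b where b: "\<gamma> \<in> \<Gamma> t" "b \<in> B" "(\<lambda>i. g [^] n i) = \<gamma> \<otimes>\<^bsub>fam G\<^esub> b"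
    using \<open>\<Gamma> 0 \<subseteq> cosets_over B t\<close> unfolding cosets_over_def by blast
  have "b \<in> carrier (fam G)" by (rule subgroup.mem_carrier[OF B b(2)])
  then have "\<gamma> \<otimes>\<^bsub>fam G\<^esub> b = b" unfolding \<Gamma>_trivial[OF t b(1)] by (rule F.l_one)
  then show ?thesis using b by simp
qed

end

section \<open>The filtration of a weighted tuple\<close>

text \<open>A formal commutator of the same weight that evaluates to the inverse.\<close>

primrec fc_inverse :: "'i fcomm \<Rightarrow> 'i fcomm" where
  "fc_inverse (Letter i b) = Letter i (\<not> b)"
| "fc_inverse (Br c d) = Br d c"

primrec fc_length :: "'i fcomm \<Rightarrow> nat" where
  "fc_length (Letter i b) = 1"
| "fc_length (Br c d) = fc_length c + fc_length d"

text \<open>Deep commutators vanish in a nilpotent group. Depth is used in place of length because a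
  commutator of depth \<open>n\<close> lies in the \<open>n\<close>-th lower central term directly by the definition of these
  terms.\<close>

primrec fc_depth :: "'i fcomm \<Rightarrow> nat" where
  "fc_depth (Letter i b) = 0"
| "fc_depth (Br c d) = Suc (max (fc_depth c) (fc_depth d))"

lemma fcomms_simps [simp]:
  "Letter i b \<in> fcomms T \<longleftrightarrow> i < length T"
  "Br c d \<in> fcomms T \<longleftrightarrow> c \<in> fcomms T \<and> d \<in> fcomms T"
  by (auto simp: fcomms_def)

lemma fcomms_inverse: "c \<in> fcomms T \<Longrightarrow> fc_inverse c \<in> fcomms T"
  by (induction c) auto

lemma fc_weight_inverse: "fc_weight T (fc_inverse c) = fc_weight T c"
  by (induction c) auto

lemma fc_length_pos: "1 \<le> fc_length c"
  by (induction c) auto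

lemma fc_length_le: "fc_length c \<le> 2 ^ fc_depth c"
proof (induction c)
  case (Br c d)
  have "(2::nat) ^ fc_depth c \<le> 2 ^ max (fc_depth c) (fc_depth d)"
    "(2::nat) ^ fc_depth d \<le> 2 ^ max (fc_depth c) (fc_depth d)"
    by (intro power_increasing; simp)+
  with Br have "fc_length c + fc_length d \<le> 2 ^ max (fc_depth c) (fc_depth d) + 2 ^ max (fc_depth c) (fc_depth d)"
    by (intro add_mono order_trans[OF Br.IH(1)] order_trans[OF Br.IH(2)])
  then show ?case by simp
qed simp

definition formal_weights :: "'a wtuple \<Rightarrow> real set" where
  "formal_weights T = fc_weight T ` fcomms T"

lemma formal_weights_add:
  "a \<in> formal_weights T \<Longrightarrow> b \<in> formal_weights T \<Longrightarrow> a + b \<in> formal_weights T"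
  unfolding formal_weights_def
proof (elim imageE)
  fix c d assume "a = fc_weight T c" "c \<in> fcomms T" "b = fc_weight T d" "d \<in> fcomms T"
  then show "a + b \<in> fc_weight T ` fcomms T" by (intro image_eqI[of _ _ "Br c d"]) auto
qed

lemma fc_weight_lower:
  assumes "\<And>w. w \<in> snd ` set T \<Longrightarrow> d \<le> w" "c \<in> fcomms T"
  shows "real (fc_length c) * d \<le> fc_weight T c"
  using assms(2) by (induction c) (auto simp: assms(1) distrib_right intro!: add_mono)

lemma fc_weight_upper:
  assumes "\<And>w. w \<in> snd ` set T \<Longrightarrow> w \<le> D" "c \<in> fcomms T"
  shows "fc_weight T c \<le> real (fc_length c) * D"
  using assms(2) by (induction c) (auto simp: assms(1) distrib_right intro!: add_mono)

lemma ex_least_letter: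
  assumes "\<And>w. w \<in> snd ` set T \<Longrightarrow> (0::real) < w"
  obtains d where "0 < d" "\<And>w. w \<in> snd ` set T \<Longrightarrow> d \<le> w"
proof (cases "T = []")
  case True
  then show ?thesis using that[of 1] by simp
next
  case False
  then have "Min (snd ` set T) \<in> snd ` set T" by (intro Min_in) auto
  then show ?thesis using assms by (intro that[of "Min (snd ` set T)"]) auto
qed

lemma formal_weights_pos:
  assumes "\<And>w. w \<in> snd ` set T \<Longrightarrow> 0 < w" "w \<in> formal_weights T"
  shows "0 < w"
proof -
  obtain d where d: "0 < d" "\<And>w. w \<in> snd ` set T \<Longrightarrow> d \<le> w" using ex_least_letter assms(1) by blast
  obtain c where c: "c \<in> fcomms T" "w = fc_weight T c" using assms(2) by (auto simp: formal_weights_def)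
  have "0 < real (fc_length c) * d" using d(1) fc_length_pos[of c] by simp
  then show ?thesis using fc_weight_lower[OF d(2) c(1)] c(2) by simp
qed

text \<open>Weights are at least a positive multiple of the length, and commutators of bounded length have
  finitely many weights.\<close>

lemma formal_weights_finite:
  assumes pos: "\<And>w. w \<in> snd ` set T \<Longrightarrow> 0 < w"
  shows "finite {w \<in> formal_weights T. w \<le> x}"
proof -
  obtain d where d: "0 < d" "\<And>w. w \<in> snd ` set T \<Longrightarrow> d \<le> w" using ex_least_letter pos by blast
  have fin: "finite (fc_weight T ` {c \<in> fcomms T. fc_length c \<le> n})" for n
  proof (induction n)
    case 0
    have "{c \<in> fcomms T. fc_length c \<le> 0} = {}" using fc_length_pos by (metis (lifting) Collect_empty_eq le_trans not_one_le_zero)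
    then show ?case by (simp only: image_empty finite.emptyI)
  next
    case (Suc n)
    let ?W = "fc_weight T ` {c \<in> fcomms T. fc_length c \<le> n}"
    have "fc_weight T ` {c \<in> fcomms T. fc_length c \<le> Suc n} \<subseteq> snd ` set T \<union> (\<lambda>(a, b). a + b) ` (?W \<times> ?W)"
    proof
      fix w assume "w \<in> fc_weight T ` {c \<in> fcomms T. fc_length c \<le> Suc n}"
      then obtain c where c: "c \<in> fcomms T" "fc_length c \<le> Suc n" "w = fc_weight T c" by blast
      show "w \<in> snd ` set T \<union> (\<lambda>(a, b). a + b) ` (?W \<times> ?W)"
      proof (cases c)
        case (Letter i b)
        then show ?thesis using c by auto
      next
        case (Br c1 c2)
        have "fc_length c1 \<le> n" "fc_length c2 \<le> n"
          using c(2) Br fc_length_pos[of c1] fc_length_pos[of c2] by auto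
        then have "fc_weight T c1 \<in> ?W" "fc_weight T c2 \<in> ?W" using c Br by auto
        then show ?thesis unfolding c(3) Br by force
      qed
    qed
    moreover have "finite (snd ` set T \<union> (\<lambda>(a, b). a + b) ` (?W \<times> ?W))" using Suc by simp
    ultimately show ?case by (rule finite_subset)
  qed
  have "{w \<in> formal_weights T. w \<le> x} \<subseteq> fc_weight T ` {c \<in> fcomms T. fc_length c \<le> nat \<lceil>x / d\<rceil>}"
  proof
    fix w assume "w \<in> {w \<in> formal_weights T. w \<le> x}"
    then obtain c where c: "c \<in> fcomms T" "w = fc_weight T c" "w \<le> x" by (auto simp: formal_weights_def)
    have "real (fc_length c) * d \<le> x" using fc_weight_lower[OF d(2) c(1)] c by simp
    then have "real (fc_length c) \<le> x / d" using d(1) by (simp add: pos_le_divide_eq)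
    then have "fc_length c \<le> nat \<lceil>x / d\<rceil>" by linarith
    then show "w \<in> fc_weight T ` {c \<in> fcomms T. fc_length c \<le> nat \<lceil>x / d\<rceil>}" using c by auto
  qed
  then show ?thesis using fin finite_subset by blast
qed

context group begin

lemma fc_eval_closed:
  assumes "subgroup H G" "fst ` set T \<subseteq> H" "c \<in> fcomms T"
  shows "fc_eval G T c \<in> H"
  using assms(3)
proof (induction c)
  case (Letter i b)
  then have "fst (T ! i) \<in> H" using assms(2) by (auto intro: nth_mem)
  then show ?case using subgroup.m_inv_closed[OF assms(1)] by simp
next
  case (Br c d)
  then show ?case
    by (simp add: gcomm_def subgroup.m_closed[OF assms(1)] subgroup.m_inv_closed[OF assms(1)])
qed

lemma fc_eval_carrier: "fst ` set T \<subseteq> carrier G \<Longrightarrow> c \<in> fcomms T \<Longrightarrow> fc_eval G T c \<in> carrier G"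
  by (rule fc_eval_closed[OF subgroup_self])

lemma fc_eval_inverse:
  assumes "fst ` set T \<subseteq> carrier G" "c \<in> fcomms T"
  shows "fc_eval G T (fc_inverse c) = inv (fc_eval G T c)"
  using assms(2)
proof (induction c)
  case (Letter i b)
  then have "fst (T ! i) \<in> carrier G" using assms(1) by (auto intro: nth_mem)
  then show ?case by simp
next
  case (Br c d)
  then show ?case using fc_eval_carrier[OF assms(1)] by (simp add: inv_gcomm)
qed

lemma fc_eval_lower_central:
  assumes N: "subgroup N G" and T: "fst ` set T \<subseteq> N" and c: "c \<in> fcomms T"
  shows "fc_eval G T c \<in> lower_central (G\<lparr>carrier := N\<rparr>) (fc_depth c)"
  using c
proof (induction c)
  case (Letter i b)
  then show ?case using fc_eval_closed[OF N T Letter] by simp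
next
  case (Br c d)
  interpret N: group "G\<lparr>carrier := N\<rparr>" by (rule subgroup.subgroup_is_group[OF N is_group])
  have inv: "inv\<^bsub>G\<lparr>carrier := N\<rparr>\<^esub> x = inv x" if "x \<in> N" for x
    using m_inv_consistent[OF N that] .
  have eq: "gcomm (G\<lparr>carrier := N\<rparr>) x y = gcomm G x y" if "x \<in> N" "y \<in> N" for x y
    using that by (simp add: gcomm_def inv)
  let ?c = "fc_eval G T c" and ?d = "fc_eval G T d"
  have cd: "?c \<in> N" "?d \<in> N" using Br.prems fc_eval_closed[OF N T] by auto
  have cG: "?c \<in> carrier G" "?d \<in> carrier G" using cd subgroup.mem_carrier[OF N] by auto
  have gN: "gcomm G x y \<in> N" if "x \<in> N" "y \<in> N" for x y
    using that by (simp add: gcomm_def subgroup.m_closed[OF N] subgroup.m_inv_closed[OF N])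
  have 1: "gcomm G x y \<in> lower_central (G\<lparr>carrier := N\<rparr>) (Suc k)"
    if "x \<in> lower_central (G\<lparr>carrier := N\<rparr>) k" "x \<in> N" "y \<in> N" for x y k
    unfolding eq[OF that(2,3), symmetric] lower_central.simps comm_subgroup_def
    using that by (intro generate.incl) auto
  have 2: "gcomm G y x \<in> lower_central (G\<lparr>carrier := N\<rparr>) (Suc k)"
    if "x \<in> lower_central (G\<lparr>carrier := N\<rparr>) k" "x \<in> N" "y \<in> N" for x y k
  proof -
    have "inv\<^bsub>G\<lparr>carrier := N\<rparr>\<^esub> (gcomm (G\<lparr>carrier := N\<rparr>) x y) \<in> lower_central (G\<lparr>carrier := N\<rparr>) (Suc k)"
      unfolding lower_central.simps comm_subgroup_def using that by (intro generate.inv) auto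
    then show ?thesis
      using that eq inv[OF gN] subgroup.mem_carrier[OF N] by (simp add: inv_gcomm)
  qed
  show ?case
  proof (cases "fc_depth d \<le> fc_depth c")
    case True
    then show ?thesis using 1[of ?c "fc_depth c" ?d] Br cd by (simp add: max_def del: lower_central.simps)
  next
    case False
    then show ?thesis using 2[of ?d "fc_depth d" ?c] Br cd by (simp add: max_def del: lower_central.simps)
  qed
qed

lemma lower_central_trivial_above:
  assumes "lower_central G n = {\<one>}" "n \<le> m"
  shows "lower_central G m = {\<one>}"
  using assms(2)
proof (induction m rule: dec_induct)
  case (step m)
  have "{gcomm G h k | h k. h \<in> {\<one>} \<and> k \<in> carrier G} = {\<one>}" by (auto intro!: exI[of _ \<one>])
  then show ?case using step by (simp add: comm_subgroup_def generate_one)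
qed (fact assms(1))

text \<open>A formal commutator of large weight is long, hence deep, hence trivial. The other properties
  hold because a bracket of formal commutators is again one and its weight is the sum.\<close>

proposition weight_filtration_formal:
  assumes N: "subgroup N G" and nil: "nilpotent_group (G\<lparr>carrier := N\<rparr>)"
    and T: "fst ` set T \<subseteq> N" and pos: "\<And>w. w \<in> snd ` set T \<Longrightarrow> 0 < w"
  shows "weight_filtration G (formal_weights T) (weight_subgroup G T)"
proof (intro weight_filtration.intro weight_filtration_axioms.intro)
  show "group G" by (rule is_group)
  have TG: "fst ` set T \<subseteq> carrier G" using T subgroup.subset[OF N] by blast
  let ?X = "\<lambda>w. fc_eval G T ` {c \<in> fcomms T. w \<le> fc_weight T c}"
  have X: "?X w \<subseteq> carrier G" for w using fc_eval_carrier[OF TG] by auto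
  have cpos: "0 < fc_weight T c" if "c \<in> fcomms T" for c
    using formal_weights_pos[OF pos, of T] that by (auto simp: formal_weights_def)
  show "0 < w" if "w \<in> formal_weights T" for w by (rule formal_weights_pos[OF pos that])
  show "finite {w \<in> formal_weights T. w \<le> t}" for t by (rule formal_weights_finite[OF pos])
  show "a + b \<in> formal_weights T" if "a \<in> formal_weights T" "b \<in> formal_weights T" for a b
    by (rule formal_weights_add[OF that])
  show "subgroup (weight_subgroup G T w) G" for w
    unfolding weight_subgroup_def by (rule generate_is_subgroup[OF X])
  show "weight_subgroup G T b \<subseteq> weight_subgroup G T a" if "a \<le> b" for a b
    unfolding weight_subgroup_def using that by (intro mono_generate) auto
  have norm: "p \<otimes> h \<otimes> inv p \<in> generate G (?X v)"
    if p: "p \<in> generate G (?X w)" and h: "h \<in> generate G (?X v)" for p h v w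
  proof (rule generate_normalizes[OF X X _ _ p h])
    have *: "x \<otimes> z \<otimes> inv x \<in> generate G (?X v)" if xz: "x \<in> ?X w" "z \<in> ?X v" for x z
    proof -
      obtain c d where c: "c \<in> fcomms T" "x = fc_eval G T c" and d: "d \<in> fcomms T" "v \<le> fc_weight T d" "z = fc_eval G T d"
        using xz by auto
      have "fc_eval G T (Br c d) \<in> ?X v" using c d cpos[OF c(1)] by (intro imageI) auto
      moreover have "x \<in> carrier G" "z \<in> carrier G" using xz X by blast+
      ultimately show ?thesis
        using xz(2) c(2) d(3) by (simp add: conj_eq_gcomm generate.incl generate.eng)
    qed
    then show "x \<otimes> z \<otimes> inv x \<in> generate G (?X v)" if "x \<in> ?X w" "z \<in> ?X v" for x z using that .
    show "inv x \<otimes> z \<otimes> x \<in> generate G (?X v)" if xz: "x \<in> ?X w" "z \<in> ?X v" for x z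
    proof -
      obtain c where c: "c \<in> fcomms T" "w \<le> fc_weight T c" "x = fc_eval G T c" using xz by auto
      have "inv x \<in> ?X w"
        using c fc_eval_inverse[OF TG c(1)] fcomms_inverse[OF c(1)] fc_weight_inverse[of T c]
        by (intro image_eqI[of _ _ "fc_inverse c"]) auto
      moreover have "x \<in> carrier G" using xz X by blast
      ultimately show ?thesis using *[of "inv x" z] xz(2) by simp
    qed
  qed
  show "gcomm G x y \<in> weight_subgroup G T (a + b)"
    if "x \<in> weight_subgroup G T a" "y \<in> weight_subgroup G T b" for a b x y
    unfolding weight_subgroup_def
  proof (rule gcomm_generate[OF X X generate_is_subgroup[OF X]])
    show "p \<otimes> h \<otimes> inv p \<in> generate G (?X (a + b))"
      if "p \<in> generate G (?X a) \<union> generate G (?X b)" "h \<in> generate G (?X (a + b))" for p h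
      using that norm by blast
    show "gcomm G x y \<in> generate G (?X (a + b))" if xz: "x \<in> ?X a" "y \<in> ?X b" for x y
    proof -
      obtain c d where cd: "c \<in> fcomms T" "a \<le> fc_weight T c" "x = fc_eval G T c"
        "d \<in> fcomms T" "b \<le> fc_weight T d" "y = fc_eval G T d"
        using xz by auto
      then have "fc_eval G T (Br c d) \<in> ?X (a + b)" by (intro imageI) auto
      then show ?thesis using cd by (simp add: generate.incl)
    qed
  qed (use that in \<open>simp_all add: weight_subgroup_def\<close>)
  show "\<exists>t. \<forall>w\<in>formal_weights T. t \<le> w \<longrightarrow> weight_subgroup G T w = {\<one>}"
  proof -
    interpret N: group "G\<lparr>carrier := N\<rparr>" by (rule subgroup.subgroup_is_group[OF N is_group])
    obtain n where n: "lower_central (G\<lparr>carrier := N\<rparr>) n = {\<one>}"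
      using nil by (auto simp: nilpotent_group_def)
    define D where "D = Max (insert 0 (snd ` set T))"
    have D: "0 \<le> D" "\<And>w. w \<in> snd ` set T \<Longrightarrow> w \<le> D" by (auto simp: D_def)
    have "weight_subgroup G T w = {\<one>}" if w: "2 ^ n * D + 1 \<le> w" for w
    proof -
      have "fc_eval G T c = \<one>" if c: "c \<in> fcomms T" "w \<le> fc_weight T c" for c
      proof -
        have "n \<le> fc_depth c"
        proof (rule ccontr)
          assume "\<not> n \<le> fc_depth c"
          then have "(2::nat) ^ fc_depth c \<le> 2 ^ n" by (intro power_increasing) auto
          then have "real (fc_length c) \<le> 2 ^ n"
            using fc_length_le[of c] by (metis of_nat_le_iff of_nat_numeral of_nat_power order_trans)
          then have "real (fc_length c) * D \<le> 2 ^ n * D" using D(1) by (rule mult_right_mono)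
          then show False using fc_weight_upper[OF D(2) c(1)] c(2) w by linarith
        qed
        then show ?thesis
          using fc_eval_lower_central[OF N T c(1)] N.lower_central_trivial_above[of n "fc_depth c"] n by simp
      qed
      then have "?X w \<subseteq> {\<one>}" by auto
      then show ?thesis
        unfolding weight_subgroup_def
        using generate_subgroup_incl[OF _ triv_subgroup, of "?X w"] generate.one[of G "?X w"] by blast
    qed
    then show ?thesis by blast
  qed
qed

end

section \<open>The reduced series\<close>

lemma Least_locally_finite:
  fixes P :: "real \<Rightarrow> bool"
  assumes fin: "\<And>x. finite {w. P w \<and> w \<le> x}" and ex: "P v"
  shows "P (LEAST w. P w)" "(LEAST w. P w) \<le> v"
proof -
  let ?S = "{w. P w \<and> w \<le> v}"
  have S: "finite ?S" "?S \<noteq> {}" using fin ex by auto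
  have least: "(LEAST w. P w) = Min ?S"
  proof (rule Least_equality)
    show "P (Min ?S)" using Min_in[OF S] by simp
    show "Min ?S \<le> w" if "P w" for w
      using that S Min_le[OF S(1), of w] Min_in[OF S] by (cases "w \<le> v") auto
  qed
  show "P (LEAST w. P w)" unfolding least using Min_in[OF S] by simp
  show "(LEAST w. P w) \<le> v" unfolding least using S ex by (intro Min_le) auto
qed

lemma fcomms_Nil: "fcomms [] = {}"
proof -
  have "c \<notin> fcomms []" for c by (induction c) auto
  then show ?thesis by blast
qed

context
  fixes T :: "'a wtuple"
  assumes nonempty: "T \<noteq> []" and pos: "\<And>w. w \<in> snd ` set T \<Longrightarrow> 0 < w"
begin

lemma formal_weight_above:
  obtains w where "w \<in> formal_weights T" "x < w"
proof -
  let ?w = "fc_weight T (Letter 0 True)"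
  have w: "?w \<in> formal_weights T" unfolding formal_weights_def using nonempty by (intro imageI) simp
  have w0: "0 < ?w" by (rule formal_weights_pos[OF pos w])
  have mult: "real (Suc n) * ?w \<in> formal_weights T" for n
  proof (induction n)
    case (Suc n)
    then show ?case using formal_weights_add[OF Suc w] by (simp add: algebra_simps)
  qed (use w in simp)
  obtain n where "x / ?w < real n" using reals_Archimedean2 by blast
  then have "x < real (Suc n) * ?w" using w0 by (simp add: field_simps)
  then show ?thesis using mult that by blast
qed

lemma weight_value_in: "weight_value T j \<in> formal_weights T"
  and weight_value_Suc: "weight_value T j < weight_value T (Suc j)"
  and weight_value_Suc_le: "w \<in> formal_weights T \<Longrightarrow> weight_value T j < w \<Longrightarrow> weight_value T (Suc j) \<le> w"
  and weight_value_0_le: "w \<in> formal_weights T \<Longrightarrow> weight_value T 0 \<le> w"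
proof -
  have fin: "finite {w. w \<in> fc_weight T ` fcomms T \<and> w \<le> x}" for x
    using formal_weights_finite[OF pos, of T x] by (simp add: formal_weights_def)
  have fin': "finite {w. (w \<in> fc_weight T ` fcomms T \<and> y < w) \<and> w \<le> x}" for x y
    by (rule finite_subset[OF _ fin[of x]]) auto
  have Suc: "weight_value T (Suc j) \<in> formal_weights T \<and> weight_value T j < weight_value T (Suc j)" for j
  proof -
    obtain v where "v \<in> formal_weights T" "weight_value T j < v" by (rule formal_weight_above)
    then show ?thesis
      using Least_locally_finite(1)[OF fin', where v = v] by (simp add: formal_weights_def)
  qed
  obtain v where "v \<in> formal_weights T" by (rule formal_weight_above)
  then have 0: "weight_value T 0 \<in> formal_weights T"
    using Least_locally_finite(1)[OF fin, where v = v] by (simp add: formal_weights_def)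
  show "weight_value T j \<in> formal_weights T" using 0 Suc by (cases j) auto
  show "weight_value T j < weight_value T (Suc j)" using Suc by simp
  show "weight_value T (Suc j) \<le> w" if "w \<in> formal_weights T" "weight_value T j < w"
    using that Least_locally_finite(2)[OF fin', where v = w] by (simp add: formal_weights_def)
  show "weight_value T 0 \<le> w" if "w \<in> formal_weights T"
    using that Least_locally_finite(2)[OF fin, where v = w] by (simp add: formal_weights_def)
qed

lemma weight_value_mono: "i \<le> j \<Longrightarrow> weight_value T i \<le> weight_value T j"
  by (rule lift_Suc_mono_le) (simp_all add: weight_value_Suc less_imp_le del: weight_value.simps)

text \<open>The recursive enumeration of the weights by least elements misses none of them, since only
  finitely many lie below a given weight.\<close>

lemma weight_value_onto:
  assumes w: "w \<in> formal_weights T"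
  obtains j where "weight_value T j = w"
proof -
  have inj: "inj (weight_value T)"
    by (intro strict_mono_imp_inj_on strict_mono_Suc_iff[THEN iffD2] allI weight_value_Suc)
  have "weight_value T ` {j. weight_value T j \<le> w} \<subseteq> {v \<in> formal_weights T. v \<le> w}"
    using weight_value_in by blast
  then have "finite (weight_value T ` {j. weight_value T j \<le> w})"
    using formal_weights_finite[OF pos, of T w] finite_subset by blast
  then have fin: "finite {j. weight_value T j \<le> w}"
    by (rule finite_imageD) (rule inj_on_subset[OF inj], simp)
  define j where "j = Max {j. weight_value T j \<le> w}"
  have ne: "{j. weight_value T j \<le> w} \<noteq> {}" using weight_value_0_le[OF w] by blast
  have "j \<in> {j. weight_value T j \<le> w}" unfolding j_def by (rule Max_in[OF fin ne])
  then have j: "weight_value T j \<le> w" by simp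
  have "\<not> weight_value T (Suc j) \<le> w"
  proof
    assume "weight_value T (Suc j) \<le> w"
    then have "Suc j \<le> j" unfolding j_def by (intro Max_ge fin) simp
    then show False by simp
  qed
  then have "weight_value T j = w" using weight_value_Suc_le[OF w, of j] j by linarith
  then show ?thesis by (rule that)
qed

end

context group begin

context
  fixes N :: "'a set" and T :: "'a wtuple"
  assumes N: "subgroup N G" and nil: "nilpotent_group (G\<lparr>carrier := N\<rparr>)"
    and T: "fst ` set T \<subseteq> N" and pos: "\<And>w. w \<in> snd ` set T \<Longrightarrow> 0 < w"
begin

interpretation weight_filtration G "formal_weights T" "weight_subgroup G T"
  by (rule weight_filtration_formal[OF N nil T pos])

lemma weight_subgroup_length:
  assumes "T \<noteq> []"
  shows "weight_subgroup G T (weight_value T (weight_length G T)) = {\<one>}"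
proof -
  obtain t where t: "\<forall>w \<in> formal_weights T. t \<le> w \<longrightarrow> weight_subgroup G T w = {\<one>}"
    using term_trivial by blast
  obtain w where w: "w \<in> formal_weights T" "t < w" by (rule formal_weight_above[OF assms pos])
  obtain j where "weight_value T j = w" by (rule weight_value_onto[OF assms pos w(1)])
  then have "weight_subgroup G T (weight_value T j) = {\<one>}" using t w by simp
  then show ?thesis unfolding weight_length_def by (rule LeastI)
qed

lemma reduced_series_member:
  assumes "(w, K) \<in> set (reduced_series G T)"
  shows "w \<in> formal_weights T" "K = isolator G (wgroup G T) (weight_subgroup G T w)"
proof -
  obtain l where l: "l < weight_length G T" "w = weight_value T l" "K = isolated_term G T l"
    using assms unfolding reduced_series_def by auto
  have "T \<noteq> []"
  proof
    assume "T = []"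
    then have "weight_subgroup G T w = {\<one>}" for w
      by (simp add: weight_subgroup_def fcomms_Nil generate_empty)
    then have "weight_length G T = 0" unfolding weight_length_def by (intro Least_eq_0)
    then show False using l(1) by simp
  qed
  then show "w \<in> formal_weights T" using weight_value_in[OF _ pos] l by simp
  show "K = isolator G (wgroup G T) (weight_subgroup G T w)" using l by (simp add: isolated_term_def)
qed

text \<open>Passing to the last occurrence of a repeated term only increases the recorded weight, so an
  element of weight \<open>w\<close> lies in a retained term of weight at least \<open>w\<close>, or in the torsion subgroup,
  which closes the chain.\<close>

lemma in_reduced_series_term:
  assumes "T \<noteq> []" and w: "w \<in> formal_weights T" and t: "t \<in> wgroup G T" "t \<in> weight_subgroup G T w"
  shows "t \<in> torsion_part G (wgroup G T) \<or> (\<exists>(w', K) \<in> set (reduced_series G T). w \<le> w' \<and> t \<in> K)"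
proof -
  let ?n = "weight_length G T"
  have tc: "t \<in> carrier G" by (rule term_closed[OF w t(2)])
  obtain l where l: "weight_value T l = w" by (rule weight_value_onto[OF assms(1) pos w])
  have iso: "t \<in> isolated_term G T l"
    unfolding isolated_term_def isolator_def l using t tc by (auto intro!: exI[of _ "1::nat"])
  have last: "isolated_term G T ?n = torsion_part G (wgroup G T)"
    unfolding isolated_term_def weight_subgroup_length[OF assms(1)] ..
  show ?thesis
  proof (cases "?n \<le> l")
    case True
    have "weight_subgroup G T w \<subseteq> weight_subgroup G T (weight_value T ?n)"
      using l w weight_value_in[OF assms(1) pos] weight_value_mono[OF assms(1) pos True]
      by (intro term_antimono) auto
    then have "t = \<one>" using t weight_subgroup_length[OF assms(1)] by auto
    then show ?thesis using t by (auto simp: isolator_def intro!: exI[of _ "1::nat"])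
  next
    case False
    define S where "S = {k. l \<le> k \<and> k \<le> ?n \<and> isolated_term G T k = isolated_term G T l}"
    have S: "finite S" "l \<in> S" using False by (auto simp: S_def)
    define k where "k = Max S"
    have "k \<in> S" unfolding k_def using S by (intro Max_in) auto
    then have k: "l \<le> k" "k \<le> ?n" "isolated_term G T k = isolated_term G T l" by (auto simp: S_def)
    have later: "isolated_term G T k' \<noteq> isolated_term G T k" if "k < k'" "k' \<le> ?n" for k'
    proof
      assume "isolated_term G T k' = isolated_term G T k"
      then have "k' \<in> S" using that k by (simp add: S_def)
      then have "k' \<le> k" unfolding k_def by (intro Max_ge S)
      then show False using that by simp
    qed
    show ?thesis
    proof (cases "k = ?n")
      case True
      then show ?thesis using iso k last by simp
    next
      case False
      then have "(weight_value T k, isolated_term G T k) \<in> set (reduced_series G T)"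
        unfolding reduced_series_def using k later by auto
      moreover have "w \<le> weight_value T k" using weight_value_mono[OF assms(1) pos k(1)] l by simp
      ultimately show ?thesis using iso k by auto
    qed
  qed
qed

end

end

section \<open>Generation of the graded pieces\<close>

text \<open>The iterated quotient is reached by a homomorphism from \<open>I (u i)\<close>. Since images of generated
  subgroups are generated by images, its fibres give the required decomposition \<open>x = j c y\<close>.\<close>

lemma (in group) generates_graded_pieceD:
  fixes u :: "nat \<Rightarrow> real" and I :: "real \<Rightarrow> 'a set" and i :: nat
  defines "A \<equiv> I (u i)" and "J \<equiv> I (u (Suc i))" and "C \<equiv> series_comm G u I i"
  assumes A: "subgroup A G" and J: "subgroup J G" "J \<subseteq> A" and C: "subgroup C G" "C \<subseteq> A"
    and comm: "\<And>x y. x \<in> A \<Longrightarrow> y \<in> A \<Longrightarrow> gcomm G x y \<in> J"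
    and Y: "Y \<subseteq> A" and gen: "generates_graded_piece G u I i Y"
  shows "A \<subseteq> generate G (Y \<union> C \<union> J)"
proof -
  define GA where "GA = G\<lparr>carrier := A\<rparr>"
  have GA[simp]: "carrier GA = A" "monoid.mult GA = monoid.mult G" "monoid.one GA = \<one>"
    by (simp_all add: GA_def)
  interpret GA: group GA unfolding GA_def by (rule subgroup_imp_group[OF A])
  have AG: "A \<subseteq> carrier G" by (rule subgroup.subset[OF A])
  have invA: "inv\<^bsub>GA\<^esub> x = inv x" if "x \<in> A" for x unfolding GA_def using m_inv_consistent[OF A that] .
  have rcos: "J #>\<^bsub>GA\<^esub> x = J #> x" for x by (simp add: r_coset_def)
  interpret J: normal J GA
  proof -
    have "subgroup J GA" unfolding GA_def by (rule subgroup_incl[OF J(1) A J(2)])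
    moreover have "x \<otimes>\<^bsub>GA\<^esub> h \<otimes>\<^bsub>GA\<^esub> inv\<^bsub>GA\<^esub> x \<in> J" if "x \<in> carrier GA" "h \<in> J" for x h
    proof -
      have c: "x \<in> A" "h \<in> A" "x \<in> carrier G" "h \<in> carrier G" using that J(2) AG by auto
      have "x \<otimes> h \<otimes> inv x = gcomm G x h \<otimes> h" by (rule conj_eq_gcomm[OF c(3,4)])
      then show ?thesis
        using subgroup.m_closed[OF J(1) comm[OF c(1,2)] that(2)] by (simp add: invA[OF c(1)])
    qed
    ultimately show "J \<lhd> GA" by (simp add: GA.normal_inv_iff)
  qed
  define Q where "Q = GA Mod J"
  interpret Q: group Q unfolding Q_def by (rule J.factorgroup_is_group)
  define \<pi> where "\<pi> x = J #>\<^bsub>GA\<^esub> x" for x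
  have \<pi>_hom: "\<pi> \<in> hom GA Q" unfolding Q_def \<pi>_def by (rule J.r_coset_hom_Mod)
  interpret \<pi>: group_hom GA Q \<pi> by unfold_locales (rule \<pi>_hom)
  have Qcar: "carrier Q = \<pi> ` A" by (simp add: Q_def carrier_FactGroup \<pi>_def)
  have \<pi>_eqD: "\<exists>j \<in> J. x = j \<otimes> y" if "x \<in> A" "\<pi> x = \<pi> y" for x y
  proof -
    have "x \<in> \<pi> x" unfolding \<pi>_def by (rule GA.rcos_self[OF _ J.subgroup_axioms]) (simp add: that)
    then have "x \<in> \<pi> y" using that(2) by (simp only:)
    then show ?thesis unfolding \<pi>_def by (auto simp: r_coset_def)
  qed
  have \<pi>_J: "\<pi> j = \<one>\<^bsub>Q\<^esub>" if "j \<in> J" for j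
    using GA.coset_join2[OF _ J.subgroup_axioms that] that J(2) by (auto simp: \<pi>_def Q_def)
  have "comm_group Q"
  proof (rule Q.group_comm_groupI)
    fix p q assume "p \<in> carrier Q" "q \<in> carrier Q"
    then obtain x y where xy: "x \<in> A" "y \<in> A" "p = \<pi> x" "q = \<pi> y" unfolding Qcar by blast
    have c: "x \<in> carrier G" "y \<in> carrier G" using xy AG by auto
    have J': "gcomm G x y \<in> J" by (rule comm[OF xy(1,2)])
    have yx: "y \<otimes> x \<in> A" by (rule subgroup.m_closed[OF A xy(2,1)])
    have "p \<otimes>\<^bsub>Q\<^esub> q = \<pi> (gcomm G x y \<otimes> (y \<otimes> x))"
      using c xy \<pi>.hom_mult[of x y] by (simp add: gcomm_def m_assoc)
    also have "\<dots> = \<pi> (gcomm G x y) \<otimes>\<^bsub>Q\<^esub> \<pi> (y \<otimes> x)"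
      using \<pi>.hom_mult[of "gcomm G x y" "y \<otimes> x"] J' J(2) yx by auto
    also have "\<dots> = \<pi> y \<otimes>\<^bsub>Q\<^esub> \<pi> x"
      using \<pi>_J[OF J'] \<pi>.hom_closed[of "y \<otimes> x"] \<pi>.hom_mult[of y x] yx xy by simp
    finally show "p \<otimes>\<^bsub>Q\<^esub> q = q \<otimes>\<^bsub>Q\<^esub> p" using xy by simp
  qed
  then interpret Q: comm_group Q .
  define H where "H = carrier (G\<lparr>carrier := C <#> J\<rparr> Mod J)"
  have CA: "subgroup C GA" unfolding GA_def by (rule subgroup_incl[OF C(1) A C(2)])
  have "H = \<pi> ` (C <#> J)" by (simp add: H_def carrier_FactGroup \<pi>_def r_coset_def)
  also have "\<dots> = \<pi> ` C"
  proof -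
    have cj: "\<pi> (c \<otimes> j) = \<pi> c" if "c \<in> C" "j \<in> J" for c j
      using that C(2) J(2) \<pi>.hom_mult[of c j] \<pi>_J[of j] \<pi>.hom_closed[of c] by (auto simp: subset_iff)
    have "c = c \<otimes> \<one>" if "c \<in> C" for c using that C(2) AG by auto
    then show ?thesis
      using cj subgroup.one_closed[OF J(1)] unfolding set_mult_def by (auto simp: image_iff)
  qed
  finally have H: "H = \<pi> ` C" .
  have "subgroup H Q" unfolding H by (rule \<pi>.subgroup_img_is_subgroup[OF CA])
  then interpret H: normal H Q by (rule Q.subgroup_imp_normal)
  interpret QH: group "Q Mod H" by (rule H.factorgroup_is_group)
  define \<psi> where "\<psi> x = H #>\<^bsub>Q\<^esub> \<pi> x" for x
  have "(\<lambda>q. H #>\<^bsub>Q\<^esub> q) \<circ> \<pi> \<in> hom GA (Q Mod H)"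
    by (rule Group.hom_compose[OF \<pi>_hom H.r_coset_hom_Mod])
  moreover have "(\<lambda>q. H #>\<^bsub>Q\<^esub> q) \<circ> \<pi> = \<psi>" by (rule ext) (simp add: \<psi>_def)
  ultimately have "\<psi> \<in> hom GA (Q Mod H)" by simp
  then interpret \<psi>: group_hom GA "Q Mod H" \<psi> by unfold_locales
  have "generate (Q Mod H) (\<psi> ` Y) = carrier (Q Mod H)"
  proof -
    have "\<psi> ` Y = (\<lambda>y. H #>\<^bsub>Q\<^esub> (J #>\<^bsub>G\<^esub> y)) ` Y" by (simp add: \<psi>_def \<pi>_def rcos)
    then show ?thesis
      using gen unfolding generates_graded_piece_def Let_def A_def[symmetric] J_def[symmetric]
        C_def[symmetric] GA_def[symmetric] Q_def[symmetric] H_def[symmetric] by simp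
  qed
  then have img: "carrier (Q Mod H) = \<psi> ` generate GA Y" using Y \<psi>.generate_img[of Y] by simp
  show ?thesis
  proof
    fix x assume x: "x \<in> A"
    have "\<psi> x \<in> \<psi> ` generate GA Y" using \<psi>.hom_closed[of x] x img by simp
    then obtain y where y: "y \<in> generate GA Y" "\<psi> x = \<psi> y" by blast
    have yG: "y \<in> generate G Y" using y(1) generate_consistent[OF Y A] by (simp add: GA_def)
    have yA: "y \<in> A" using GA.generate_in_carrier[of Y y] Y y(1) by simp
    have "\<pi> x \<in> H #>\<^bsub>Q\<^esub> \<pi> y"
      using Q.rcos_self[OF _ H.subgroup_axioms, of "\<pi> x"] y(2) x by (simp add: \<psi>_def \<pi>.hom_closed)
    then obtain c where c: "c \<in> C" "\<pi> x = \<pi> c \<otimes>\<^bsub>Q\<^esub> \<pi> y" unfolding H by (auto simp: r_coset_def)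
    have "\<pi> x = \<pi> (c \<otimes> y)" using c yA C(2) \<pi>.hom_mult[of c y] by auto
    then obtain j where j: "j \<in> J" "x = j \<otimes> (c \<otimes> y)" using \<pi>_eqD[OF x] by blast
    have "generate G Y \<subseteq> generate G (Y \<union> C \<union> J)" by (intro mono_generate) auto
    then show "x \<in> generate G (Y \<union> C \<union> J)"
      using yG c(1) j by (auto intro!: generate.eng generate.incl[of j] generate.incl[of c])
  qed
qed

section \<open>Energies of powers\<close>

definition power_weight :: "real \<Rightarrow> int \<Rightarrow> real" where
  "power_weight w a = (1 + real_of_int \<bar>a\<bar>) powr (- 1 - 1 / w)"

text \<open>The exponents admitted at the scale \<open>r = 2\<^sup>k\<close> for a letter of weight \<open>w\<close>.\<close>

definition window :: "real \<Rightarrow> nat \<Rightarrow> int set" where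
  "window w k = {b. real_of_int \<bar>b\<bar> \<le> 2 powr (real k * w)}"

definition peak :: "real \<Rightarrow> (int \<Rightarrow> real) \<Rightarrow> nat \<Rightarrow> real" where
  "peak w \<phi> k = Max (\<phi> ` window w k)"

lemma finite_window: "finite (window w k)"
proof -
  have "window w k \<subseteq> {- \<lceil>2 powr (real k * w)\<rceil> .. \<lceil>2 powr (real k * w)\<rceil>}"
    unfolding window_def by (auto simp: abs_le_iff) linarith+
  then show ?thesis by (rule finite_subset) simp
qed

lemma zero_in_window: "0 \<in> window w k" by (simp add: window_def)

lemma peak_ge: "b \<in> window w k \<Longrightarrow> \<phi> b \<le> peak w \<phi> k"
  unfolding peak_def using finite_window by (intro Max_ge) auto

lemma peak_attained:
  obtains b where "b \<in> window w k" "peak w \<phi> k = \<phi> b"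
proof -
  have "Max (\<phi> ` window w k) \<in> \<phi> ` window w k"
    using finite_window zero_in_window[of w k] by (intro Max_in) auto
  then show ?thesis using that unfolding peak_def by blast
qed

lemma card_window_le:
  assumes "0 \<le> w"
  shows "real (card (window w k)) \<le> 3 * 2 powr (real k * w)"
proof -
  let ?x = "2 powr (real k * w)"
  have x: "1 \<le> ?x" using assms by (intro ge_one_powr_ge_zero) auto
  have "window w k \<subseteq> {- \<lfloor>?x\<rfloor> .. \<lfloor>?x\<rfloor>}" unfolding window_def by (auto simp: abs_le_iff le_floor_iff) linarith
  then have "card (window w k) \<le> card {- \<lfloor>?x\<rfloor> .. \<lfloor>?x\<rfloor>}" by (intro card_mono) auto
  also have "\<dots> = nat (2 * \<lfloor>?x\<rfloor> + 1)" by simp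
  finally have "real (card (window w k)) \<le> 2 * ?x + 1" using x by linarith
  then show ?thesis using x by linarith
qed

lemma card_window_ge: "2 powr (real k * w) \<le> real (card (window w k))"
proof -
  let ?x = "2 powr (real k * w)"
  have x: "0 \<le> ?x" by simp
  have "{0 .. \<lfloor>?x\<rfloor>} \<subseteq> window w k" unfolding window_def by (auto simp: le_floor_iff)
  then have "card {0 .. \<lfloor>?x\<rfloor>} \<le> card (window w k)" by (intro card_mono finite_window)
  then show ?thesis using x by simp linarith
qed

lemma power_weight_le_window:
  assumes w: "0 < w"
  obtains k where "a \<in> window w k" "power_weight w a \<le> 2 powr (1 + w) * 2 powr (- (real k * (1 + w)))"
proof -
  define x where "x = 1 + real_of_int \<bar>a\<bar>"
  have x: "1 \<le> x" by (simp add: x_def)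
  define k where "k = nat \<lceil>log 2 x / w\<rceil>"
  have l: "0 \<le> log 2 x / w" using x w by simp
  have k: "log 2 x / w \<le> real k" "real k \<le> log 2 x / w + 1" using l unfolding k_def by linarith+
  have "log 2 x \<le> real k * w" using k(1) w by (simp add: pos_divide_le_eq)
  then have "x \<le> 2 powr (real k * w)" using x by (simp add: log_le_iff)
  then have 1: "a \<in> window w k" by (simp add: window_def x_def)
  have "power_weight w a = x powr (- 1 - 1 / w)" by (simp only: power_weight_def x_def)
  also have "\<dots> = 2 powr (log 2 x * (- 1 - 1 / w))"
    using x by (simp flip: powr_powr)
  also have "log 2 x * (- 1 - 1 / w) = - (log 2 x / w) * (1 + w)" using w by (simp add: field_simps)
  also have "2 powr (- (log 2 x / w) * (1 + w)) \<le> 2 powr ((1 - real k) * (1 + w))"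
    using k(2) w by (intro powr_mono mult_right_mono) auto
  also have "\<dots> = 2 powr (1 + w) * 2 powr (- (real k * (1 + w)))"
    by (simp add: algebra_simps flip: powr_add)
  finally show ?thesis using that[OF 1] by simp
qed

lemma sum_half_power_le: "finite S \<Longrightarrow> (\<Sum>k\<in>S. (1 / 2 :: real) ^ k) \<le> 2"
  using sum_le_suminf[of "\<lambda>k. (1 / 2 :: real) ^ k" S] suminf_geometric[of "1 / 2 :: real"]
  by (simp add: summable_geometric)

text \<open>Every exponent \<open>a\<close> is assigned to a window of size of order \<open>1 + |a|\<close>. The window with index \<open>k\<close>
  receives at most of order \<open>2\<^sup>k\<^sup>w\<close> exponents, each with weight of order \<open>2\<^sup>-\<^sup>k\<^sup>(\<^sup>1\<^sup>+\<^sup>w\<^sup>)\<close>, which leaves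
  the factor \<open>2\<^sup>-\<^sup>k\<close>.\<close>

lemma energy_le_peaks:
  assumes w: "0 < w" and \<phi>: "\<And>a. 0 \<le> \<phi> a" and B: "\<And>a. \<phi> a \<le> B"
  shows "(\<lambda>a. \<phi> a * power_weight w a) summable_on UNIV"
    and "summable (\<lambda>k. (1 / 2) ^ k * peak w \<phi> k)"
    and "(\<Sum>\<^sub>\<infinity>a. \<phi> a * power_weight w a) \<le> 3 * 2 powr (1 + w) * (\<Sum>k. (1 / 2) ^ k * peak w \<phi> k)"
proof -
  have peak0: "0 \<le> peak w \<phi> k" for k using peak_ge[OF zero_in_window] \<phi>[of 0] by (rule order_trans[rotated])
  have peakB: "peak w \<phi> k \<le> B" for k by (rule peak_attained[of w k \<phi>]) (simp add: B)
  show sum: "summable (\<lambda>k. (1 / 2) ^ k * peak w \<phi> k)"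
  proof (rule summable_comparison_test')
    show "summable (\<lambda>k. (1 / 2) ^ k * B)" by (intro summable_mult2 summable_geometric) simp
    show "norm ((1 / 2) ^ k * peak w \<phi> k) \<le> (1 / 2) ^ k * B" if "0 \<le> k" for k
      using peak0[of k] peakB[of k] by (simp add: mult_left_mono)
  qed
  have "\<exists>k. a \<in> window w k \<and> power_weight w a \<le> 2 powr (1 + w) * 2 powr (- (real k * (1 + w)))" for a
    by (rule power_weight_le_window[OF w, of a]) blast
  then obtain \<kappa> where \<kappa>: "\<And>a. a \<in> window w (\<kappa> a)"
      "\<And>a. power_weight w a \<le> 2 powr (1 + w) * 2 powr (- (real (\<kappa> a) * (1 + w)))"
    by metis
  have fin: "(\<Sum>a\<in>F. \<phi> a * power_weight w a) \<le> 3 * 2 powr (1 + w) * (\<Sum>k. (1 / 2) ^ k * peak w \<phi> k)"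
    if F: "finite F" for F
  proof -
    have "(\<Sum>a\<in>F. \<phi> a * power_weight w a)
        \<le> (\<Sum>a\<in>F. 2 powr (1 + w) * (2 powr (- (real (\<kappa> a) * (1 + w))) * peak w \<phi> (\<kappa> a)))"
    proof (rule sum_mono)
      fix a
      have "\<phi> a * power_weight w a \<le> peak w \<phi> (\<kappa> a) * (2 powr (1 + w) * 2 powr (- (real (\<kappa> a) * (1 + w))))"
        using \<kappa> \<phi> peak0 by (intro mult_mono peak_ge) (auto simp: power_weight_def)
      then show "\<phi> a * power_weight w a \<le> 2 powr (1 + w) * (2 powr (- (real (\<kappa> a) * (1 + w))) * peak w \<phi> (\<kappa> a))"
        by (simp add: mult_ac)
    qed
    also have "\<dots> = 2 powr (1 + w) * (\<Sum>k\<in>\<kappa> ` F. \<Sum>a\<in>{a\<in>F. \<kappa> a = k}. 2 powr (- (real (\<kappa> a) * (1 + w))) * peak w \<phi> (\<kappa> a))"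
      unfolding sum_distrib_left[symmetric] by (subst sum.image_gen[OF F, of _ \<kappa>]) simp
    also have "\<dots> = 2 powr (1 + w) * (\<Sum>k\<in>\<kappa> ` F. real (card {a\<in>F. \<kappa> a = k}) * (2 powr (- (real k * (1 + w))) * peak w \<phi> k))"
      by (intro arg_cong2[where f = "(*)"] refl sum.cong) simp
    also have "\<dots> \<le> 2 powr (1 + w) * (\<Sum>k\<in>\<kappa> ` F. 3 * ((1 / 2) ^ k * peak w \<phi> k))"
    proof (intro mult_left_mono sum_mono)
      fix k
      have "{a\<in>F. \<kappa> a = k} \<subseteq> window w k" using \<kappa>(1) by blast
      then have "card {a\<in>F. \<kappa> a = k} \<le> card (window w k)" by (intro card_mono finite_window)
      then have "real (card {a\<in>F. \<kappa> a = k}) \<le> 3 * 2 powr (real k * w)"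
        using card_window_le[of w k] w by simp
      then have "real (card {a\<in>F. \<kappa> a = k}) * (2 powr (- (real k * (1 + w))) * peak w \<phi> k)
          \<le> 3 * 2 powr (real k * w) * (2 powr (- (real k * (1 + w))) * peak w \<phi> k)"
        using peak0[of k] by (intro mult_right_mono) auto
      also have "\<dots> = 3 * ((2 powr (real k * w) * 2 powr (- (real k * (1 + w)))) * peak w \<phi> k)" by simp
      also have "2 powr (real k * w) * 2 powr (- (real k * (1 + w))) = (1 / 2 :: real) ^ k"
        by (simp add: algebra_simps powr_minus powr_realpow power_one_over inverse_eq_divide flip: powr_add)
      finally show "real (card {a\<in>F. \<kappa> a = k}) * (2 powr (- (real k * (1 + w))) * peak w \<phi> k)
          \<le> 3 * ((1 / 2) ^ k * peak w \<phi> k)" .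
    qed simp
    also have "\<dots> \<le> 2 powr (1 + w) * (3 * (\<Sum>k. (1 / 2) ^ k * peak w \<phi> k))"
      unfolding sum_distrib_left[symmetric] using F peak0
      by (intro mult_left_mono sum_le_suminf sum) auto
    finally show ?thesis by simp
  qed
  show summable: "(\<lambda>a. \<phi> a * power_weight w a) summable_on UNIV"
    using fin \<phi> by (intro nonneg_bdd_above_summable_on bdd_aboveI2) (auto simp: power_weight_def)
  show "(\<Sum>\<^sub>\<infinity>a. \<phi> a * power_weight w a) \<le> 3 * 2 powr (1 + w) * (\<Sum>k. (1 / 2) ^ k * peak w \<phi> k)"
    using fin by (intro infsum_le_finite_sums summable) auto
qed

text \<open>The doubled windows containing \<open>a\<close> have weights that decrease geometrically, so the first one
  dominates, and it has size at least of order \<open>1 + |a|\<close>.\<close>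

lemma window_sum_le_power_weight:
  assumes w: "0 < w"
  shows "(\<Sum>k \<in> {k. k < n \<and> real_of_int \<bar>a\<bar> \<le> 2 * 2 powr (real k * w)}. 2 powr (- (real k * (1 + w))))
    \<le> 2 * 3 powr (1 + 1 / w) * power_weight w a"
proof (cases "{k. k < n \<and> real_of_int \<bar>a\<bar> \<le> 2 * 2 powr (real k * w)} = {}")
  case True
  then show ?thesis unfolding True by (simp add: power_weight_def)
next
  case False
  let ?S = "{k. k < n \<and> real_of_int \<bar>a\<bar> \<le> 2 * 2 powr (real k * w)}"
  define m where "m = Min ?S"
  have S: "finite ?S" by simp
  have m: "m \<in> ?S" unfolding m_def by (rule Min_in[OF S False])
  have le: "m \<le> k" if "k \<in> ?S" for k unfolding m_def by (rule Min_le[OF S that])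
  have "(\<Sum>k\<in>?S. 2 powr (- (real k * (1 + w)))) \<le> (\<Sum>k\<in>?S. 2 powr (- (real m * (1 + w))) * (1 / 2) ^ (k - m))"
  proof (rule sum_mono)
    fix k assume "k \<in> ?S"
    then have km: "m \<le> k" by (rule le)
    have "real (k - m) * 1 \<le> real (k - m) * (1 + w)" using w by (intro mult_left_mono) auto
    then have "- (real k * (1 + w)) \<le> - (real m * (1 + w)) + - real (k - m)"
      using km by (simp add: of_nat_diff algebra_simps)
    then have "2 powr (- (real k * (1 + w))) \<le> 2 powr (- (real m * (1 + w)) + - real (k - m))"
      by (intro powr_mono) auto
    also have "\<dots> = 2 powr (- (real m * (1 + w))) * (1 / 2) ^ (k - m)"
      unfolding powr_add by (simp add: powr_minus powr_realpow power_one_over inverse_eq_divide)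
    finally show "2 powr (- (real k * (1 + w))) \<le> 2 powr (- (real m * (1 + w))) * (1 / 2) ^ (k - m)" .
  qed
  also have "\<dots> = 2 powr (- (real m * (1 + w))) * (\<Sum>k\<in>(\<lambda>k. k - m) ` ?S. (1 / 2) ^ k)"
    unfolding sum_distrib_left
    by (subst sum.reindex) (use le in \<open>auto intro!: inj_onI dest: le simp: eq_diff_iff\<close>)
  also have "\<dots> \<le> 2 powr (- (real m * (1 + w))) * 2"
    using S by (intro mult_left_mono sum_half_power_le) auto
  also have "2 powr (- (real m * (1 + w))) \<le> 3 powr (1 + 1 / w) * power_weight w a"
  proof -
    have inverse_w: "0 \<le> 1 / w" using w by simp
    have "1 + real_of_int \<bar>a\<bar> \<le> 3 * 2 powr (real m * w)"
      using m ge_one_powr_ge_zero[of 2 "real m * w"] w by auto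
    then have "(3 * 2 powr (real m * w)) powr (- 1 - 1 / w) \<le> power_weight w a"
      unfolding power_weight_def using inverse_w by (intro powr_mono2') linarith+
    then have "3 powr (1 + 1 / w) * (3 * 2 powr (real m * w)) powr (- 1 - 1 / w)
        \<le> 3 powr (1 + 1 / w) * power_weight w a"
      by (intro mult_left_mono) auto
    moreover have "3 powr (1 + 1 / w) * (3 * 2 powr (real m * w)) powr (- 1 - 1 / w)
        = (3 powr (1 + 1 / w) * 3 powr (- 1 - 1 / w)) * 2 powr (real m * w * (- 1 - 1 / w))"
      by (simp add: powr_mult powr_powr)
    moreover have "3 powr (1 + 1 / w) * 3 powr (- 1 - 1 / w) = (1::real)" by (simp flip: powr_add)
    moreover have "real m * w * (- 1 - 1 / w) = - (real m * (1 + w))" using w by (simp add: field_simps)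
    ultimately show ?thesis by simp
  qed
  finally show ?thesis by simp
qed

text \<open>The reverse bound is where quasi-subadditivity is used: \<open>\<phi>(b) \<le> 2 \<phi>(b + c) + 2 \<phi>(c)\<close>, averaged
  over \<open>c\<close> in the window, bounds the maximum over a window by the mean over the doubled window. A
  bound of the maximum by the energy, scale by scale, would lose a logarithm in the sum.\<close>

lemma peaks_le_energy:
  assumes w: "0 < w" and \<phi>: "\<And>a. 0 \<le> \<phi> a" and B: "\<And>a. \<phi> a \<le> B"
    and add: "\<And>a b. \<phi> (a + b) \<le> 2 * \<phi> a + 2 * \<phi> b" and neg: "\<And>a. \<phi> (- a) = \<phi> a"
  shows "(\<Sum>k. (1 / 2) ^ k * peak w \<phi> k) \<le> 8 * 3 powr (1 + 1 / w) * (\<Sum>\<^sub>\<infinity>a. \<phi> a * power_weight w a)"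
proof (rule suminf_le_const)
  show "summable (\<lambda>k. (1 / 2) ^ k * peak w \<phi> k)" by (rule energy_le_peaks(2)[OF w \<phi> B])
  define V where "V k = {c. real_of_int \<bar>c\<bar> \<le> 2 * 2 powr (real k * w)}" for k :: nat
  have V: "finite (V k)" for k
  proof -
    have "V k \<subseteq> {- \<lceil>2 * 2 powr (real k * w)\<rceil> .. \<lceil>2 * 2 powr (real k * w)\<rceil>}"
      unfolding V_def by (auto simp: abs_le_iff) linarith+
    then show ?thesis by (rule finite_subset) simp
  qed
  have avg: "peak w \<phi> k \<le> 4 * 2 powr (- (real k * w)) * (\<Sum>c\<in>V k. \<phi> c)" for k
  proof -
    let ?W = "window w k"
    obtain b where b: "b \<in> ?W" "peak w \<phi> k = \<phi> b" by (rule peak_attained)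
    have W: "?W \<subseteq> V k" "(\<lambda>c. b + c) ` ?W \<subseteq> V k"
      using b(1) unfolding window_def V_def by (auto intro: order_trans[OF abs_triangle_ineq])
    have "real (card ?W) * \<phi> b = (\<Sum>c\<in>?W. \<phi> b)" by simp
    also have "\<dots> \<le> (\<Sum>c\<in>?W. 2 * \<phi> (b + c) + 2 * \<phi> c)"
    proof (rule sum_mono)
      fix c show "\<phi> b \<le> 2 * \<phi> (b + c) + 2 * \<phi> c" using add[of "b + c" "- c"] neg[of c] by simp
    qed
    also have "\<dots> = 2 * (\<Sum>c\<in>(\<lambda>c. b + c) ` ?W. \<phi> c) + 2 * (\<Sum>c\<in>?W. \<phi> c)"
      by (simp add: sum.distrib sum_distrib_left sum.reindex)
    also have "\<dots> \<le> 2 * (\<Sum>c\<in>V k. \<phi> c) + 2 * (\<Sum>c\<in>V k. \<phi> c)"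
      using W \<phi> by (intro add_mono mult_left_mono sum_mono2 V) auto
    finally have "real (card ?W) * \<phi> b \<le> 4 * (\<Sum>c\<in>V k. \<phi> c)" by simp
    moreover have "2 powr (real k * w) * \<phi> b \<le> real (card ?W) * \<phi> b"
      by (rule mult_right_mono[OF card_window_ge \<phi>])
    ultimately have "2 powr (real k * w) * \<phi> b \<le> 4 * (\<Sum>c\<in>V k. \<phi> c)" by linarith
    then have "2 powr (- (real k * w)) * (2 powr (real k * w) * \<phi> b) \<le> 2 powr (- (real k * w)) * (4 * (\<Sum>c\<in>V k. \<phi> c))"
      by (intro mult_left_mono) auto
    moreover have "2 powr (- (real k * w)) * (2 powr (real k * w) * \<phi> b) = \<phi> b"
      unfolding mult.assoc[symmetric] by (simp flip: powr_add)
    ultimately have "\<phi> b \<le> 2 powr (- (real k * w)) * (4 * (\<Sum>c\<in>V k. \<phi> c))" by linarith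
    also have "\<dots> = 4 * 2 powr (- (real k * w)) * (\<Sum>c\<in>V k. \<phi> c)" by simp
    finally show ?thesis unfolding b(2) .
  qed
  fix n
  have Vsub: "V k \<subseteq> V n" if "k < n" for k
  proof -
    have "2 * 2 powr (real k * w) \<le> 2 * 2 powr (real n * w)"
      using that w by (intro mult_left_mono powr_mono mult_right_mono) auto
    then show ?thesis unfolding V_def by (intro Collect_mono impI) linarith
  qed
  have "(\<Sum>k<n. (1 / 2) ^ k * peak w \<phi> k) \<le> (\<Sum>k<n. 4 * (\<Sum>c\<in>V k. 2 powr (- (real k * (1 + w))) * \<phi> c))"
  proof (rule sum_mono)
    fix k
    have "(1 / 2) ^ k * peak w \<phi> k \<le> (1 / 2) ^ k * (4 * 2 powr (- (real k * w)) * (\<Sum>c\<in>V k. \<phi> c))"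
      by (intro mult_left_mono avg) simp
    also have "\<dots> = 4 * (((1 / 2) ^ k * 2 powr (- (real k * w))) * (\<Sum>c\<in>V k. \<phi> c))" by simp
    also have "(1 / 2) ^ k * 2 powr (- (real k * w)) = 2 powr (- (real k * (1 + w)))"
      by (simp add: distrib_left powr_diff powr_minus powr_realpow power_one_over inverse_eq_divide powr_add)
    finally show "(1 / 2) ^ k * peak w \<phi> k \<le> 4 * (\<Sum>c\<in>V k. 2 powr (- (real k * (1 + w))) * \<phi> c)"
      by (simp add: sum_distrib_left)
  qed
  also have "\<dots> = 4 * (\<Sum>k<n. \<Sum>c\<in>V k. 2 powr (- (real k * (1 + w))) * \<phi> c)"
    by (simp add: sum_distrib_left)
  also have "(\<Sum>k<n. \<Sum>c\<in>V k. 2 powr (- (real k * (1 + w))) * \<phi> c)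
      = (\<Sum>k<n. \<Sum>c | c \<in> V n \<and> c \<in> V k. 2 powr (- (real k * (1 + w))) * \<phi> c)"
    using Vsub by (intro sum.cong refl) auto
  also have "\<dots> = (\<Sum>c\<in>V n. \<Sum>k | k \<in> {..<n} \<and> c \<in> V k. 2 powr (- (real k * (1 + w))) * \<phi> c)"
    by (rule sum.swap_restrict) (use V in auto)
  also have "\<dots> = (\<Sum>c\<in>V n. \<phi> c * (\<Sum>k | k < n \<and> real_of_int \<bar>c\<bar> \<le> 2 * 2 powr (real k * w). 2 powr (- (real k * (1 + w)))))"
    unfolding V_def sum_distrib_left by (intro sum.cong refl) (auto simp: mult.commute)
  also have "\<dots> \<le> (\<Sum>c\<in>V n. \<phi> c * (2 * 3 powr (1 + 1 / w) * power_weight w c))"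
    by (intro sum_mono mult_left_mono window_sum_le_power_weight w \<phi>)
  also have "\<dots> = 2 * 3 powr (1 + 1 / w) * (\<Sum>c\<in>V n. \<phi> c * power_weight w c)"
    by (simp add: sum_distrib_left mult_ac)
  also have "(\<Sum>c\<in>V n. \<phi> c * power_weight w c) \<le> (\<Sum>\<^sub>\<infinity>c. \<phi> c * power_weight w c)"
    using \<phi> by (intro finite_sum_le_infsum energy_le_peaks(1)[OF w \<phi> B] V) (auto simp: power_weight_def)
  finally show "(\<Sum>k<n. (1 / 2) ^ k * peak w \<phi> k) \<le> 8 * 3 powr (1 + 1 / w) * (\<Sum>\<^sub>\<infinity>a. \<phi> a * power_weight w a)"
    by simp
qed

section \<open>Dirichlet forms and displacements\<close>

text \<open>The square of the distance in \<open>\<ell>\<^sup>2\<close> between \<open>f\<close> and its right translate by \<open>h\<close>.\<close>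

definition displacement :: "('a, 'b) monoid_scheme \<Rightarrow> ('a \<Rightarrow> real) \<Rightarrow> 'a \<Rightarrow> real" where
  "displacement G f h = (\<Sum>\<^sub>\<infinity>g\<in>carrier G. (f (g \<otimes>\<^bsub>G\<^esub> h) - f g)\<^sup>2)"

context group begin

context
  fixes f :: "'a \<Rightarrow> real"
  assumes fin: "finite {g \<in> carrier G. f g \<noteq> 0}"
begin

lemma bij_right_mult: "h \<in> carrier G \<Longrightarrow> bij_betw (\<lambda>g. g \<otimes> h) (carrier G) (carrier G)"
  by (rule bij_betw_byWitness[where f' = "\<lambda>g. g \<otimes> inv h"]) (auto simp: m_assoc)

lemma finite_support_translate:
  assumes "h \<in> carrier G"
  shows "finite {g \<in> carrier G. f (g \<otimes> h) \<noteq> 0}"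
proof -
  have "{g \<in> carrier G. f (g \<otimes> h) \<noteq> 0} \<subseteq> (\<lambda>g. g \<otimes> inv h) ` {g \<in> carrier G. f g \<noteq> 0}"
  proof
    fix g assume "g \<in> {g \<in> carrier G. f (g \<otimes> h) \<noteq> 0}"
    then show "g \<in> (\<lambda>g. g \<otimes> inv h) ` {g \<in> carrier G. f g \<noteq> 0}"
      using assms by (intro image_eqI[of _ _ "g \<otimes> h"]) (auto simp: m_assoc)
  qed
  then show ?thesis using fin finite_subset by blast
qed

lemma displacement_summable:
  assumes "h \<in> carrier G"
  shows "(\<lambda>g. (f (g \<otimes> h) - f g)\<^sup>2) summable_on carrier G"
  by (rule finite_nonzero_values_imp_summable_on,
      rule finite_subset[OF _ finite_UnI[OF fin finite_support_translate[OF assms]]]) auto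

lemma displacement_nonneg: "0 \<le> displacement G f h"
  unfolding displacement_def by (intro infsum_nonneg) simp

lemma displacement_mult:
  assumes g: "g \<in> carrier G" and h: "h \<in> carrier G"
  shows "displacement G f (g \<otimes> h) \<le> 2 * displacement G f g + 2 * displacement G f h"
proof -
  have s1: "(\<lambda>x. (f (x \<otimes> g \<otimes> h) - f (x \<otimes> g))\<^sup>2) summable_on carrier G"
    using summable_on_reindex_bij_betw[OF bij_right_mult[OF g], of "\<lambda>y. (f (y \<otimes> h) - f y)\<^sup>2"]
      displacement_summable[OF h] by simp
  have e1: "(\<Sum>\<^sub>\<infinity>x\<in>carrier G. (f (x \<otimes> g \<otimes> h) - f (x \<otimes> g))\<^sup>2) = displacement G f h"
    unfolding displacement_def
    using infsum_reindex_bij_betw[OF bij_right_mult[OF g], of "\<lambda>y. (f (y \<otimes> h) - f y)\<^sup>2"] by simp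
  have "displacement G f (g \<otimes> h) \<le> (\<Sum>\<^sub>\<infinity>x\<in>carrier G. 2 * (f (x \<otimes> g) - f x)\<^sup>2 + 2 * (f (x \<otimes> g \<otimes> h) - f (x \<otimes> g))\<^sup>2)"
    unfolding displacement_def
  proof (rule infsum_mono)
    show "(\<lambda>x. (f (x \<otimes> (g \<otimes> h)) - f x)\<^sup>2) summable_on carrier G" using g h by (intro displacement_summable) simp
    show "(\<lambda>x. 2 * (f (x \<otimes> g) - f x)\<^sup>2 + 2 * (f (x \<otimes> g \<otimes> h) - f (x \<otimes> g))\<^sup>2) summable_on carrier G"
      by (intro summable_on_add summable_on_cmult_right displacement_summable g s1)
    fix x assume x: "x \<in> carrier G"
    have *: "(p + q)\<^sup>2 \<le> 2 * p\<^sup>2 + 2 * q\<^sup>2" for p q :: real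
      using zero_le_power2[of "p - q"] by (simp add: power2_eq_square algebra_simps)
    show "(f (x \<otimes> (g \<otimes> h)) - f x)\<^sup>2 \<le> 2 * (f (x \<otimes> g) - f x)\<^sup>2 + 2 * (f (x \<otimes> g \<otimes> h) - f (x \<otimes> g))\<^sup>2"
      using *[of "f (x \<otimes> g) - f x" "f (x \<otimes> g \<otimes> h) - f (x \<otimes> g)"] x g h by (simp add: m_assoc)
  qed
  also have "\<dots> = 2 * displacement G f g + 2 * (\<Sum>\<^sub>\<infinity>x\<in>carrier G. (f (x \<otimes> g \<otimes> h) - f (x \<otimes> g))\<^sup>2)"
    unfolding displacement_def
    by (simp add: infsum_add summable_on_cmult_right displacement_summable g s1 infsum_cmult_right')
  finally show ?thesis by (simp add: e1)
qed

lemma displacement_inv: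
  assumes h: "h \<in> carrier G"
  shows "displacement G f (inv h) = displacement G f h"
proof -
  have "displacement G f (inv h) = (\<Sum>\<^sub>\<infinity>x\<in>carrier G. (f (x \<otimes> h \<otimes> inv h) - f (x \<otimes> h))\<^sup>2)"
    unfolding displacement_def
    using infsum_reindex_bij_betw[OF bij_right_mult[OF h], of "\<lambda>y. (f (y \<otimes> inv h) - f y)\<^sup>2"] by simp
  also have "\<dots> = displacement G f h"
    unfolding displacement_def using h by (intro infsum_cong) (simp add: m_assoc power2_commute)
  finally show ?thesis .
qed

lemma displacement_one: "displacement G f \<one> = 0"
  unfolding displacement_def by (rule infsum_0) simp

lemma displacement_bounded:
  "\<exists>B. \<forall>h \<in> carrier G. displacement G f h \<le> B"
proof -
  have s: "(\<lambda>g. (f g)\<^sup>2) summable_on carrier G"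
    by (rule finite_nonzero_values_imp_summable_on, rule finite_subset[OF _ fin]) auto
  have "displacement G f h \<le> 2 * (\<Sum>\<^sub>\<infinity>g\<in>carrier G. (f g)\<^sup>2) + 2 * (\<Sum>\<^sub>\<infinity>g\<in>carrier G. (f g)\<^sup>2)"
    if h: "h \<in> carrier G" for h
  proof -
    have s1: "(\<lambda>g. (f (g \<otimes> h))\<^sup>2) summable_on carrier G"
      using summable_on_reindex_bij_betw[OF bij_right_mult[OF h], of "\<lambda>y. (f y)\<^sup>2"] s by simp
    have "displacement G f h \<le> (\<Sum>\<^sub>\<infinity>g\<in>carrier G. 2 * (f (g \<otimes> h))\<^sup>2 + 2 * (f g)\<^sup>2)"
      unfolding displacement_def
    proof (rule infsum_mono)
      show "(\<lambda>g. 2 * (f (g \<otimes> h))\<^sup>2 + 2 * (f g)\<^sup>2) summable_on carrier G"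
        by (intro summable_on_add summable_on_cmult_right s s1)
      fix g
      show "(f (g \<otimes> h) - f g)\<^sup>2 \<le> 2 * (f (g \<otimes> h))\<^sup>2 + 2 * (f g)\<^sup>2"
        using zero_le_power2[of "f (g \<otimes> h) + f g"] by (simp add: power2_eq_square algebra_simps)
    qed (rule displacement_summable[OF h])
    also have "\<dots> = 2 * (\<Sum>\<^sub>\<infinity>g\<in>carrier G. (f (g \<otimes> h))\<^sup>2) + 2 * (\<Sum>\<^sub>\<infinity>g\<in>carrier G. (f g)\<^sup>2)"
      by (simp add: infsum_add summable_on_cmult_right s s1 infsum_cmult_right')
    also have "(\<Sum>\<^sub>\<infinity>g\<in>carrier G. (f (g \<otimes> h))\<^sup>2) = (\<Sum>\<^sub>\<infinity>g\<in>carrier G. (f g)\<^sup>2)"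
      by (rule infsum_reindex_bij_betw[OF bij_right_mult[OF h], of "\<lambda>y. (f y)\<^sup>2"])
    finally show ?thesis .
  qed
  then show ?thesis by blast
qed

lemma displacement_times_summable:
  assumes "\<And>h. h \<in> carrier G \<Longrightarrow> 0 \<le> \<mu> h" "\<mu> summable_on carrier G"
  shows "(\<lambda>h. displacement G f h * \<mu> h) summable_on carrier G"
proof -
  obtain B where B: "\<And>h. h \<in> carrier G \<Longrightarrow> displacement G f h \<le> B"
    using displacement_bounded by blast
  show ?thesis
  proof (rule summable_on_comparison_test[OF summable_on_cmult_right[OF assms(2), of B]])
    fix h assume h: "h \<in> carrier G"
    show "displacement G f h * \<mu> h \<le> B * \<mu> h" by (rule mult_right_mono[OF B[OF h] assms(1)[OF h]])
    show "0 \<le> displacement G f h * \<mu> h" using displacement_nonneg assms(1)[OF h] by (rule mult_nonneg_nonneg)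
  qed
qed

text \<open>Summing over \<open>g\<close> first. The double sum converges absolutely because displacements are bounded
  and \<open>\<mu>\<close> is summable.\<close>

lemma dirichlet_form_eq:
  assumes \<mu>: "\<And>h. h \<in> carrier G \<Longrightarrow> 0 \<le> \<mu> h" "\<mu> summable_on carrier G"
  shows "dirichlet_form G \<mu> f = 1 / 2 * (\<Sum>\<^sub>\<infinity>h\<in>carrier G. displacement G f h * \<mu> h)"
proof -
  let ?F = "\<lambda>g h. \<bar>f (g \<otimes> h) - f g\<bar>\<^sup>2 * \<mu> h"
  have sum: "(\<lambda>(g, h). ?F g h) summable_on carrier G \<times> carrier G"
  proof (rule nonneg_bdd_above_summable_on)
    show "0 \<le> (case p of (g, h) \<Rightarrow> ?F g h)" if "p \<in> carrier G \<times> carrier G" for p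
      using that \<mu>(1) by auto
    have "(\<Sum>(g, h)\<in>P. ?F g h) \<le> (\<Sum>\<^sub>\<infinity>h\<in>carrier G. displacement G f h * \<mu> h)"
      if P: "finite P" "P \<subseteq> carrier G \<times> carrier G" for P
    proof -
      have fs: "finite (fst ` P)" "finite (snd ` P)" "fst ` P \<subseteq> carrier G" "snd ` P \<subseteq> carrier G"
        using P by auto
      have "(\<Sum>(g, h)\<in>P. ?F g h) \<le> (\<Sum>(g, h)\<in>fst ` P \<times> snd ` P. ?F g h)"
      proof (rule sum_mono2)
        show "finite (fst ` P \<times> snd ` P)" using fs by simp
        show "P \<subseteq> fst ` P \<times> snd ` P" by (rule subset_fst_snd)
        fix p assume "p \<in> fst ` P \<times> snd ` P - P"
        then have "snd p \<in> carrier G" using fs by auto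
        then show "0 \<le> (case p of (g, h) \<Rightarrow> ?F g h)" using \<mu>(1) by (simp add: case_prod_beta)
      qed
      also have "\<dots> = (\<Sum>h\<in>snd ` P. \<Sum>g\<in>fst ` P. ?F g h)"
        by (subst sum.swap) (rule sum.cartesian_product[symmetric])
      also have "\<dots> \<le> (\<Sum>h\<in>snd ` P. displacement G f h * \<mu> h)"
      proof (rule sum_mono)
        fix h assume "h \<in> snd ` P"
        then have h: "h \<in> carrier G" using fs by auto
        have "(\<Sum>g\<in>fst ` P. (f (g \<otimes> h) - f g)\<^sup>2) \<le> displacement G f h"
          unfolding displacement_def using fs by (intro finite_sum_le_infsum displacement_summable h) auto
        then show "(\<Sum>g\<in>fst ` P. ?F g h) \<le> displacement G f h * \<mu> h"
          using \<mu>(1)[OF h] by (simp add: sum_distrib_right[symmetric] mult_right_mono)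
      qed
      also have "\<dots> \<le> (\<Sum>\<^sub>\<infinity>h\<in>carrier G. displacement G f h * \<mu> h)"
        using fs \<mu> displacement_nonneg by (intro finite_sum_le_infsum displacement_times_summable) auto
      finally show ?thesis .
    qed
    then show "bdd_above (sum (\<lambda>(g, h). ?F g h) ` {P. P \<subseteq> carrier G \<times> carrier G \<and> finite P})"
      by (intro bdd_aboveI2) auto
  qed
  have "(\<Sum>\<^sub>\<infinity>(g, h)\<in>carrier G \<times> carrier G. ?F g h) = (\<Sum>\<^sub>\<infinity>g\<in>carrier G. \<Sum>\<^sub>\<infinity>h\<in>carrier G. ?F g h)"
    by (rule infsum_Sigma'_banach[symmetric, OF sum])
  also have "\<dots> = (\<Sum>\<^sub>\<infinity>h\<in>carrier G. \<Sum>\<^sub>\<infinity>g\<in>carrier G. ?F g h)"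
    by (rule infsum_swap_banach[OF sum])
  also have "\<dots> = (\<Sum>\<^sub>\<infinity>h\<in>carrier G. displacement G f h * \<mu> h)"
    unfolding displacement_def by (simp add: infsum_cmult_left')
  finally show ?thesis unfolding dirichlet_form_def by simp
qed

text \<open>A letter of weight zero stands for a single group element, which is how the generators added
  without a power law enter. With this convention both kinds of letters are comparable with the same
  sum over dyadic scales.\<close>

definition power_energy :: "('a \<times> real) \<Rightarrow> real" where
  "power_energy = (\<lambda>(t, w). if w = 0 then displacement G f t
     else \<Sum>\<^sub>\<infinity>a. displacement G f (t [^] (a::int)) * power_weight w a)"

lemma power_energy_nonneg: "0 \<le> power_energy l"
  by (cases l) (auto simp: power_energy_def power_weight_def displacement_nonneg intro!: infsum_nonneg)

lemma displacement_power_energy: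
  assumes t: "t \<in> carrier G" and w: "0 \<le> w"
  shows "summable (\<lambda>k. (1 / 2) ^ k * peak w (\<lambda>a. displacement G f (t [^] a)) k)"
    and "power_energy (t, w) \<le> 3 * 2 powr (1 + w) * (\<Sum>k. (1 / 2) ^ k * peak w (\<lambda>a. displacement G f (t [^] a)) k)"
    and "(\<Sum>k. (1 / 2) ^ k * peak w (\<lambda>a. displacement G f (t [^] a)) k) \<le> 8 * 3 powr (1 + 1 / w) * power_energy (t, w)"
proof -
  let ?\<phi> = "\<lambda>a::int. displacement G f (t [^] a)"
  obtain B where B: "\<And>h. h \<in> carrier G \<Longrightarrow> displacement G f h \<le> B"
    using displacement_bounded by blast
  have \<phi>B: "?\<phi> a \<le> B" for a using t by (intro B) simp
  have add: "?\<phi> (a + b) \<le> 2 * ?\<phi> a + 2 * ?\<phi> b" for a b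
    using t displacement_mult[of "t [^] a" "t [^] b"] by (simp add: int_pow_mult)
  have neg: "?\<phi> (- a) = ?\<phi> a" for a using t by (simp add: int_pow_neg displacement_inv)
  have "summable (\<lambda>k. (1 / 2) ^ k * peak w ?\<phi> k) \<and>
    power_energy (t, w) \<le> 3 * 2 powr (1 + w) * (\<Sum>k. (1 / 2) ^ k * peak w ?\<phi> k) \<and>
    (\<Sum>k. (1 / 2) ^ k * peak w ?\<phi> k) \<le> 8 * 3 powr (1 + 1 / w) * power_energy (t, w)"
  proof (cases "w = 0")
    case False
    then have w: "0 < w" using w by simp
    have e: "power_energy (t, w) = (\<Sum>\<^sub>\<infinity>a. ?\<phi> a * power_weight w a)" using False by (simp add: power_energy_def)
    show ?thesis
      unfolding e using energy_le_peaks(2,3)[where \<phi> = ?\<phi>, OF w displacement_nonneg \<phi>B]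
        peaks_le_energy[where \<phi> = ?\<phi>, OF w displacement_nonneg \<phi>B add neg] by blast
  next
    case True
    have win: "window 0 k = {-1, 0, 1}" for k unfolding window_def by (auto simp: abs_le_iff)
    have "peak w ?\<phi> k = displacement G f t" for k
      unfolding True peak_def win using neg[of 1] t displacement_nonneg[of t]
      by (simp add: displacement_one max_def)
    moreover have "(\<lambda>k. (1 / 2) ^ k * displacement G f t) sums (2 * displacement G f t)"
      using geometric_sums[of "1 / 2 :: real"] by (intro sums_mult2) auto
    ultimately show ?thesis
      using True displacement_nonneg[of t] by (simp add: power_energy_def sums_iff)
  qed
  then show "summable (\<lambda>k. (1 / 2) ^ k * peak w ?\<phi> k)"
    "power_energy (t, w) \<le> 3 * 2 powr (1 + w) * (\<Sum>k. (1 / 2) ^ k * peak w ?\<phi> k)"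
    "(\<Sum>k. (1 / 2) ^ k * peak w ?\<phi> k) \<le> 8 * 3 powr (1 + 1 / w) * power_energy (t, w)" by auto
qed

lemma power_density_displacement:
  assumes t: "t \<in> carrier G" and w: "0 < w"
  defines "D \<equiv> \<lambda>h. \<Sum>\<^sub>\<infinity>a::int. of_bool (h = t [^] a) * power_weight w a"
  shows "(\<lambda>h. displacement G f h * D h) summable_on carrier G"
    and "(\<Sum>\<^sub>\<infinity>h\<in>carrier G. displacement G f h * D h) = power_energy (t, w)"
proof -
  obtain B where B: "\<And>h. h \<in> carrier G \<Longrightarrow> displacement G f h \<le> B"
    using displacement_bounded by blast
  let ?F = "\<lambda>h a. displacement G f h * (of_bool (h = t [^] (a::int)) * power_weight w a)"
  have "(\<lambda>a. displacement G f (t [^] a) * power_weight w a) summable_on UNIV"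
    using t by (intro energy_le_peaks(1)[OF w displacement_nonneg B]) simp
  then have "((\<lambda>(h, a). ?F h a) \<circ> (\<lambda>a. (t [^] a, a))) summable_on UNIV" by (simp add: comp_def)
  then have "(\<lambda>(h, a). ?F h a) summable_on (\<lambda>a. (t [^] a, a)) ` UNIV"
    by (subst summable_on_reindex) (auto intro: inj_onI)
  then have sum: "(\<lambda>(h, a). ?F h a) summable_on carrier G \<times> UNIV"
    by (rule summable_on_cong_neutral[THEN iffD1, rotated -1]) (use t in auto)
  have D: "displacement G f h * D h = (\<Sum>\<^sub>\<infinity>a. ?F h a)" for h
    unfolding D_def by (rule infsum_cmult_right'[symmetric])
  show "(\<lambda>h. displacement G f h * D h) summable_on carrier G"
    unfolding D by (rule summable_on_Sigma_banach[OF sum])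
  have inner: "(\<Sum>\<^sub>\<infinity>h\<in>carrier G. ?F h a) = displacement G f (t [^] a) * power_weight w a" for a
  proof -
    have "(\<Sum>\<^sub>\<infinity>h\<in>carrier G. ?F h a) = (\<Sum>\<^sub>\<infinity>h\<in>{t [^] a}. ?F h a)"
      using t by (intro infsum_cong_neutral) auto
    then show ?thesis by simp
  qed
  have "(\<Sum>\<^sub>\<infinity>h\<in>carrier G. displacement G f h * D h) = (\<Sum>\<^sub>\<infinity>a. \<Sum>\<^sub>\<infinity>h\<in>carrier G. ?F h a)"
    unfolding D by (rule infsum_swap_banach[OF sum])
  also have "\<dots> = power_energy (t, w)" unfolding inner using w by (simp add: power_energy_def)
  finally show "(\<Sum>\<^sub>\<infinity>h\<in>carrier G. displacement G f h * D h) = power_energy (t, w)" .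
qed

end

end

section \<open>Power measures and the comparison of energies\<close>

lemma pmf_summable: "pmf \<mu> summable_on A"
proof (rule nonneg_bdd_above_summable_on)
  have "sum (pmf \<mu>) F \<le> 1" if "finite F" for F
    using measure_pmf.prob_le_1[of \<mu> F] measure_measure_pmf_finite[OF that, of \<mu>] by simp
  then show "bdd_above (sum (pmf \<mu>) ` {F. F \<subseteq> A \<and> finite F})" by (intro bdd_aboveI2) auto
qed simp

text \<open>The index is a scale \<open>k\<close> together with an exponent. Letting the exponent range over the index set
  makes bounds for families uniform over all exponents in the window of scale \<open>k\<close>.\<close>

definition dyadic_scale :: "nat \<times> int \<Rightarrow> real" where
  "dyadic_scale i = 2 ^ fst i"

lemma dyadic_scale_ge_1: "1 \<le> dyadic_scale i" by (simp add: dyadic_scale_def)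

lemma dyadic_scale_powr: "dyadic_scale (k, b) powr w = 2 powr (real k * w)"
  by (simp add: dyadic_scale_def powr_powr flip: powr_realpow)

context group begin

lemma power_density_has_sum:
  assumes fin: "finite {g \<in> carrier G. f g \<noteq> 0}"
    and T: "fst ` set T \<subseteq> carrier G" "\<And>w. w \<in> snd ` set T \<Longrightarrow> 0 < w"
  shows "((\<lambda>h. displacement G f h * power_density G (reciprocal_weights T) h)
    has_sum (\<Sum>l\<leftarrow>T. power_energy f l)) (carrier G)"
  using T
proof (induction T)
  case Nil
  then show ?case by (auto simp: power_density_def reciprocal_weights_def intro: has_sum_0)
next
  case (Cons l T)
  obtain t w where l: "l = (t, w)" by force
  let ?D = "\<lambda>h. \<Sum>\<^sub>\<infinity>a::int. of_bool (h = t [^] a) * power_weight w a"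
  have tw: "t \<in> carrier G" "0 < w" using Cons.prems l by auto
  have "((\<lambda>h. displacement G f h * ?D h) has_sum power_energy f (t, w)) (carrier G)"
    using has_sum_infsum[OF power_density_displacement(1)[OF fin tw]]
    unfolding power_density_displacement(2)[OF fin tw] .
  moreover have "((\<lambda>h. displacement G f h * power_density G (reciprocal_weights T) h)
    has_sum (\<Sum>l\<leftarrow>T. power_energy f l)) (carrier G)"
    using Cons by auto
  ultimately have "((\<lambda>h. displacement G f h * ?D h + displacement G f h * power_density G (reciprocal_weights T) h)
    has_sum (power_energy f (t, w) + (\<Sum>l\<leftarrow>T. power_energy f l))) (carrier G)"
    by (rule has_sum_add)
  moreover have "power_density G (reciprocal_weights (l # T)) h = ?D h + power_density G (reciprocal_weights T) h" for h
    by (simp add: l power_density_def reciprocal_weights_def power_weight_def)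
  ultimately show ?case by (simp add: l distrib_left)
qed

lemma power_measure_form:
  assumes PM: "power_measure G (reciprocal_weights T) \<mu>"
    and T: "fst ` set T \<subseteq> carrier G" "\<And>w. w \<in> snd ` set T \<Longrightarrow> 0 < w"
  shows "\<exists>c>0. \<exists>C>0. \<forall>f. finite {g \<in> carrier G. f g \<noteq> 0} \<longrightarrow>
    c * (\<Sum>l\<leftarrow>T. power_energy f l) \<le> dirichlet_form G (pmf \<mu>) f \<and>
    dirichlet_form G (pmf \<mu>) f \<le> C * (\<Sum>l\<leftarrow>T. power_energy f l)"
proof -
  obtain c C where cC: "0 < c" "0 < C"
    and bounds: "\<And>g. g \<in> carrier G \<Longrightarrow> c * power_density G (reciprocal_weights T) g \<le> pmf \<mu> g \<and>
      pmf \<mu> g \<le> C * power_density G (reciprocal_weights T) g"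
    using PM unfolding power_measure_def by blast
  have "c / 2 * (\<Sum>l\<leftarrow>T. power_energy f l) \<le> dirichlet_form G (pmf \<mu>) f \<and>
    dirichlet_form G (pmf \<mu>) f \<le> C / 2 * (\<Sum>l\<leftarrow>T. power_energy f l)"
    if fin: "finite {g \<in> carrier G. f g \<noteq> 0}" for f
  proof -
    let ?N = "displacement G f" and ?d = "power_density G (reciprocal_weights T)"
    note hs = power_density_has_sum[OF fin T]
    have "(\<lambda>h. ?N h * pmf \<mu> h) summable_on carrier G"
      by (intro displacement_times_summable[OF fin] pmf_summable) simp
    then have hp: "((\<lambda>h. ?N h * pmf \<mu> h) has_sum (\<Sum>\<^sub>\<infinity>h\<in>carrier G. ?N h * pmf \<mu> h)) (carrier G)"
      by (rule has_sum_infsum)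
    have "c * (\<Sum>l\<leftarrow>T. power_energy f l) \<le> (\<Sum>\<^sub>\<infinity>h\<in>carrier G. ?N h * pmf \<mu> h)"
    proof (rule has_sum_mono[OF has_sum_cmult_right[OF hs] hp])
      fix h assume "h \<in> carrier G"
      then show "c * (?N h * ?d h) \<le> ?N h * pmf \<mu> h"
        using mult_left_mono[OF conjunct1[OF bounds] displacement_nonneg[OF fin, of h]] by (simp add: mult.left_commute)
    qed
    moreover have "(\<Sum>\<^sub>\<infinity>h\<in>carrier G. ?N h * pmf \<mu> h) \<le> C * (\<Sum>l\<leftarrow>T. power_energy f l)"
    proof (rule has_sum_mono[OF hp has_sum_cmult_right[OF hs]])
      fix h assume "h \<in> carrier G"
      then show "?N h * pmf \<mu> h \<le> C * (?N h * ?d h)"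
        using mult_left_mono[OF conjunct2[OF bounds] displacement_nonneg[OF fin, of h]] by (simp add: mult.left_commute)
    qed
    ultimately show ?thesis
      using dirichlet_form_eq[OF fin _ pmf_summable, of \<mu>] by simp
  qed
  then show ?thesis using cC by (intro exI[of _ "c / 2"] exI[of _ "C / 2"] conjI) auto
qed

lemma dirichlet_form_add_uniform:
  assumes fin: "finite {g \<in> carrier G. f g \<noteq> 0}" and X: "finite X" "X \<subseteq> carrier G"
  shows "dirichlet_form G (\<lambda>g. pmf \<mu> g + uniform_mass X g) f
    = dirichlet_form G (pmf \<mu>) f + 1 / (2 * real (card X)) * (\<Sum>x\<in>X. power_energy f (x, 0))"
proof -
  let ?N = "displacement G f"
  have su: "uniform_mass X summable_on carrier G"
    by (rule finite_nonzero_values_imp_summable_on, rule finite_subset[OF _ X(1)])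
      (auto simp: uniform_mass_def indicator_def split: if_splits)
  have sp: "(\<lambda>h. ?N h * pmf \<mu> h) summable_on carrier G"
    by (intro displacement_times_summable[OF fin] pmf_summable) simp
  have snu: "(\<lambda>h. ?N h * uniform_mass X h) summable_on carrier G"
    by (intro displacement_times_summable[OF fin] su) (simp add: uniform_mass_def)
  have "(\<Sum>\<^sub>\<infinity>h\<in>carrier G. ?N h * uniform_mass X h) = (\<Sum>\<^sub>\<infinity>h\<in>X. ?N h / real (card X))"
    using X(2) by (intro infsum_cong_neutral) (auto simp: uniform_mass_def)
  also have "\<dots> = 1 / real (card X) * (\<Sum>x\<in>X. power_energy f (x, 0))"
    using X(1) by (simp add: power_energy_def[OF fin] sum_divide_distrib)
  finally have u: "(\<Sum>\<^sub>\<infinity>h\<in>carrier G. ?N h * uniform_mass X h) = 1 / real (card X) * (\<Sum>x\<in>X. power_energy f (x, 0))" .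
  have "dirichlet_form G (\<lambda>g. pmf \<mu> g + uniform_mass X g) f
      = 1 / 2 * (\<Sum>\<^sub>\<infinity>h\<in>carrier G. ?N h * (pmf \<mu> h + uniform_mass X h))"
    by (intro dirichlet_form_eq[OF fin] summable_on_add pmf_summable su) (simp add: uniform_mass_def)
  also have "\<dots> = 1 / 2 * ((\<Sum>\<^sub>\<infinity>h\<in>carrier G. ?N h * pmf \<mu> h) + (\<Sum>\<^sub>\<infinity>h\<in>carrier G. ?N h * uniform_mass X h))"
    by (simp add: distrib_left infsum_add[OF sp snu])
  also have "\<dots> = dirichlet_form G (pmf \<mu>) f + 1 / (2 * real (card X)) * (\<Sum>x\<in>X. power_energy f (x, 0))"
    unfolding u using dirichlet_form_eq[OF fin _ pmf_summable, of \<mu>] by simp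
  finally show ?thesis .
qed

text \<open>An exponent in a multiple of a window is a sum of boundedly many exponents in the window. The
  integer part appears because the summands have to be integers.\<close>

lemma peak_multiple:
  assumes fin: "finite {g \<in> carrier G. f g \<noteq> 0}" and t: "t \<in> carrier G" and w: "0 \<le> w"
    and n: "\<bar>real_of_int n\<bar> \<le> real m * real_of_int \<lfloor>2 powr (real k * w)\<rfloor>"
  shows "displacement G f (t [^] n) \<le> 4 ^ m * peak w (\<lambda>a. displacement G f (t [^] a)) k"
  using n
proof (induction m arbitrary: n)
  case 0
  have "0 \<le> peak w (\<lambda>a. displacement G f (t [^] a)) k"
    using peak_ge[OF zero_in_window, of "\<lambda>a. displacement G f (t [^] a)" w k] by (simp add: displacement_one[OF fin])
  then show ?case using 0 by (simp add: displacement_one[OF fin])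
next
  case (Suc m)
  let ?W = "\<lfloor>2 powr (real k * w)\<rfloor>" and ?p = "peak w (\<lambda>a. displacement G f (t [^] a)) k"
  have W: "0 \<le> ?W" "real_of_int ?W \<le> 2 powr (real k * w)" by simp_all
  have nW: "\<bar>n\<bar> \<le> int (Suc m) * ?W" using Suc.prems by (metis of_int_abs of_int_le_iff of_int_mult of_int_of_nat_eq)
  define b where "b = max (- ?W) (min ?W n)"
  have clamp: "\<bar>max (- W) (min W n)\<bar> \<le> W \<and> \<bar>n - max (- W) (min W n)\<bar> \<le> M"
    if "0 \<le> W" "0 \<le> M" "\<bar>n\<bar> \<le> W + M" for W M :: int
    using that by (auto simp: max_def min_def abs_if)
  have "int (Suc m) * ?W = ?W + int m * ?W" by (simp add: algebra_simps)
  then have b: "\<bar>b\<bar> \<le> ?W" and "\<bar>n - b\<bar> \<le> int m * ?W"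
    using clamp[of ?W "int m * ?W"] nW W(1) unfolding b_def by simp_all
  then have "real_of_int \<bar>n - b\<bar> \<le> real_of_int (int m * ?W)" by (simp only: of_int_le_iff)
  then have IH: "displacement G f (t [^] (n - b)) \<le> 4 ^ m * ?p" by (intro Suc.IH) simp
  have "b \<in> window w k" using b W(2) by (simp add: window_def) linarith
  then have pb: "displacement G f (t [^] b) \<le> ?p" by (rule peak_ge)
  have p0: "0 \<le> ?p" using pb displacement_nonneg[OF fin] by (rule order_trans[rotated])
  have "displacement G f (t [^] n) = displacement G f (t [^] (n - b) \<otimes> t [^] b)"
    using t int_pow_mult[of t "n - b" b] by simp
  also have "\<dots> \<le> 2 * displacement G f (t [^] (n - b)) + 2 * displacement G f (t [^] b)"
    using t by (intro displacement_mult[OF fin]) auto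
  also have "\<dots> \<le> 2 * (4 ^ m * ?p) + 2 * (4 ^ m * ?p)"
    using IH pb mult_right_mono[OF one_le_power[of "4::real" m] p0] by (intro add_mono mult_left_mono) auto
  finally show ?case by simp
qed

text \<open>Displacements are quasi-subadditive, so a bounded product is controlled by its factors, with
  constants that do not depend on \<open>f\<close>.\<close>

lemma bounded_family_displacement:
  assumes A: "finite A" "fst ` A \<subseteq> carrier G" "\<And>w. w \<in> snd ` A \<Longrightarrow> 0 \<le> w"
    and h: "h \<in> bounded_families G dyadic_scale A"
  shows "\<exists>C\<ge>0. \<forall>f k b. finite {g \<in> carrier G. f g \<noteq> 0} \<longrightarrow>
    displacement G f (h (k, b)) \<le> C * (\<Sum>(t, w)\<in>A. peak w (\<lambda>a. displacement G f (t [^] a)) k)"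
proof -
  let ?P = "\<lambda>f k. \<Sum>(t, w)\<in>A. peak w (\<lambda>a. displacement G f (t [^] (a::int))) k"
  have peak0: "0 \<le> peak w (\<lambda>a. displacement G f (t [^] (a::int))) k"
    if "finite {g \<in> carrier G. f g \<noteq> 0}" for f t w k
    using peak_ge[OF zero_in_window, of "\<lambda>a. displacement G f (t [^] a)" w k] by (simp add: displacement_one[OF that])
  have P0: "0 \<le> ?P f k" if "finite {g \<in> carrier G. f g \<noteq> 0}" for f k
    using peak0[OF that] by (intro sum_nonneg) auto
  note gens = bounded_generators_closed[OF A(2), of dyadic_scale]
  have gen: "\<exists>C\<ge>0. \<forall>f k b. finite {g \<in> carrier G. f g \<noteq> 0} \<longrightarrow> displacement G f (h (k, b)) \<le> C * ?P f k"
    if hA: "h \<in> {\<lambda>i. g [^] n i | g a n. (g, a) \<in> A \<and> n \<in> bounded_exponents dyadic_scale a}" for h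
  proof -
    obtain t w n where t: "h = (\<lambda>i. t [^] (n i :: int))" "(t, w) \<in> A" "n \<in> bounded_exponents dyadic_scale w"
      using hA by blast
    have tc: "t \<in> carrier G" and w: "0 \<le> w" using A(2,3) t(2) by force+
    obtain K where K: "0 \<le> K" "\<And>i. \<bar>real_of_int (n i)\<bar> \<le> K * dyadic_scale i powr w"
      using bounded_exponentsE[OF t(3)] by blast
    define m where "m = nat \<lceil>2 * K\<rceil>"
    have "displacement G f (h (k, b)) \<le> 4 ^ m * ?P f k" if fin: "finite {g \<in> carrier G. f g \<noteq> 0}" for f k b
    proof -
      let ?x = "2 powr (real k * w)"
      have x: "1 \<le> ?x" using w by (intro ge_one_powr_ge_zero) auto
      then have "1 \<le> \<lfloor>?x\<rfloor>" by (simp only: one_le_floor)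
      then have fl: "?x \<le> 2 * real_of_int \<lfloor>?x\<rfloor>"
        using real_of_int_floor_add_one_gt[of ?x] by linarith
      have "\<bar>real_of_int (n (k, b))\<bar> \<le> K * ?x" using K(2)[of "(k, b)"] by (simp add: dyadic_scale_powr)
      also have "\<dots> \<le> K * (2 * real_of_int \<lfloor>?x\<rfloor>)" by (rule mult_left_mono[OF fl K(1)])
      also have "\<dots> = 2 * K * real_of_int \<lfloor>?x\<rfloor>" by simp
      also have "\<dots> \<le> real m * real_of_int \<lfloor>?x\<rfloor>"
        unfolding m_def by (intro mult_right_mono real_nat_ceiling_ge) simp
      finally have "displacement G f (h (k, b)) \<le> 4 ^ m * peak w (\<lambda>a. displacement G f (t [^] a)) k"
        unfolding t(1) by (rule peak_multiple[OF fin tc w])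
      also have "\<dots> \<le> 4 ^ m * ?P f k"
      proof (rule mult_left_mono)
        have "(case (t, w) of (t, w) \<Rightarrow> peak w (\<lambda>a. displacement G f (t [^] a)) k) \<le> ?P f k"
          using peak0[OF fin] by (intro member_le_sum A(1) t(2)) auto
        then show "peak w (\<lambda>a. displacement G f (t [^] a)) k \<le> ?P f k" by simp
      qed simp
      finally show ?thesis .
    qed
    then show ?thesis by (intro exI[of _ "4 ^ m"]) auto
  qed
  show ?thesis
    using h unfolding bounded_families_def
  proof induction
    case one
    then show ?case by (intro exI[of _ 0]) (simp add: displacement_one)
  next
    case (incl h)
    then show ?case by (rule gen)
  next
    case (inv h)
    have "h \<in> carrier (fam G)" by (rule subsetD[OF gens inv])
    then have hc: "h i \<in> carrier G" for i unfolding fam_simps by blast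
    show ?case using gen[OF inv] hc by (simp add: inv_fam displacement_inv cong: imp_cong)
  next
    case (eng h1 h2)
    have c: "h1 i \<in> carrier G" "h2 i \<in> carrier G" for i
      using group.generate_in_carrier[OF group_fam gens eng(1)]
        group.generate_in_carrier[OF group_fam gens eng(2)] unfolding fam_simps by blast+
    obtain C1 where C1: "0 \<le> C1" "\<And>f k b. finite {g \<in> carrier G. f g \<noteq> 0} \<Longrightarrow> displacement G f (h1 (k, b)) \<le> C1 * ?P f k"
      using eng.IH(1) by blast
    obtain C2 where C2: "0 \<le> C2" "\<And>f k b. finite {g \<in> carrier G. f g \<noteq> 0} \<Longrightarrow> displacement G f (h2 (k, b)) \<le> C2 * ?P f k"
      using eng.IH(2) by blast
    have "displacement G f ((h1 \<otimes>\<^bsub>fam G\<^esub> h2) (k, b)) \<le> (2 * C1 + 2 * C2) * ?P f k"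
      if fin: "finite {g \<in> carrier G. f g \<noteq> 0}" for f k b
    proof -
      have "displacement G f (h1 (k, b) \<otimes> h2 (k, b)) \<le> 2 * displacement G f (h1 (k, b)) + 2 * displacement G f (h2 (k, b))"
        by (rule displacement_mult[OF fin c])
      also have "\<dots> \<le> 2 * (C1 * ?P f k) + 2 * (C2 * ?P f k)"
        by (intro add_mono mult_left_mono C1(2)[OF fin] C2(2)[OF fin]) auto
      finally show ?thesis by (simp add: distrib_right)
    qed
    then show ?case using C1(1) C2(1) by (intro exI[of _ "2 * C1 + 2 * C2"]) auto
  qed
qed

text \<open>The link between algebra and analysis: if the admissible powers of a letter are admissible
  products of powers of letters from \<open>A\<close>, then its energy is bounded by the energies of \<open>A\<close>. Applied to
  the family of all exponents in all windows, the displacement bound compares maxima scale by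
  scale.\<close>

proposition dominated_power_energy:
  assumes A: "finite A" "fst ` A \<subseteq> carrier G" "\<And>w. w \<in> snd ` A \<Longrightarrow> 0 \<le> w"
    and t: "t \<in> carrier G" and w: "0 \<le> w"
    and dom: "\<And>n. n \<in> bounded_exponents dyadic_scale w \<Longrightarrow> (\<lambda>i. t [^] n i) \<in> bounded_families G dyadic_scale A"
  shows "\<exists>C\<ge>0. \<forall>f. finite {g \<in> carrier G. f g \<noteq> 0} \<longrightarrow> power_energy f (t, w) \<le> C * (\<Sum>l\<in>A. power_energy f l)"
proof -
  let ?pk = "\<lambda>f k l. peak (snd l) (\<lambda>a. displacement G f (fst l [^] (a::int))) k"
  \<comment> \<open>All exponents of all windows occur among the values of this single family.\<close>
  let ?n = "\<lambda>(k, b). if b \<in> window w k then b else 0"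
  have "?n \<in> bounded_exponents dyadic_scale w"
  proof (rule bounded_exponentsI[of _ 1])
    fix i :: "nat \<times> int"
    obtain k b where i: "i = (k, b)" by force
    show "\<bar>real_of_int (?n i)\<bar> \<le> 1 * dyadic_scale i powr w"
      unfolding i by (simp add: dyadic_scale_powr window_def)
  qed
  from bounded_family_displacement[OF A dom[OF this]]
  obtain C where C: "0 \<le> C" "\<And>f k b. finite {g \<in> carrier G. f g \<noteq> 0} \<Longrightarrow>
    displacement G f (t [^] ?n (k, b)) \<le> C * (\<Sum>l\<in>A. ?pk f k l)"
    unfolding case_prod_beta by blast
  define B where "B = (\<Sum>l\<in>A. 8 * 3 powr (1 + 1 / snd l))"
  have B: "0 \<le> B" by (auto simp: B_def intro: sum_nonneg)
  have "power_energy f (t, w) \<le> 3 * 2 powr (1 + w) * (C * B) * (\<Sum>l\<in>A. power_energy f l)"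
    if fin: "finite {g \<in> carrier G. f g \<noteq> 0}" for f
  proof -
    note E = displacement_power_energy[OF fin]
    have lA: "fst l \<in> carrier G" "0 \<le> snd l" if "l \<in> A" for l using A(2,3) that by auto
    have pk: "?pk f k (t, w) \<le> C * (\<Sum>l\<in>A. ?pk f k l)" for k
    proof -
      obtain b where b: "b \<in> window w k" "peak w (\<lambda>a. displacement G f (t [^] a)) k = displacement G f (t [^] b)"
        by (rule peak_attained)
      then show ?thesis using C(2)[OF fin, of k b] by simp
    qed
    have summ: "summable (\<lambda>k. (1 / 2) ^ k * ?pk f k l)" if "l \<in> A" for l by (rule E(1)[OF lA[OF that]])
    have "(\<Sum>k. (1 / 2) ^ k * ?pk f k (t, w)) \<le> (\<Sum>k. C * (\<Sum>l\<in>A. (1 / 2) ^ k * ?pk f k l))"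
    proof (rule suminf_le)
      show "summable (\<lambda>k. (1 / 2) ^ k * ?pk f k (t, w))" using E(1)[OF t w] by simp
      show "summable (\<lambda>k. C * (\<Sum>l\<in>A. (1 / 2) ^ k * ?pk f k l))"
        by (intro summable_mult summable_sum summ)
      fix k
      have "(1 / 2) ^ k * ?pk f k (t, w) \<le> (1 / 2) ^ k * (C * (\<Sum>l\<in>A. ?pk f k l))"
        by (intro mult_left_mono pk) simp
      then show "(1 / 2) ^ k * ?pk f k (t, w) \<le> C * (\<Sum>l\<in>A. (1 / 2) ^ k * ?pk f k l)"
        by (simp add: sum_distrib_left mult_ac)
    qed
    also have "\<dots> = C * (\<Sum>k. \<Sum>l\<in>A. (1 / 2) ^ k * ?pk f k l)"
      by (intro suminf_mult summable_sum summ)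
    also have "(\<Sum>k. \<Sum>l\<in>A. (1 / 2) ^ k * ?pk f k l) = (\<Sum>l\<in>A. \<Sum>k. (1 / 2) ^ k * ?pk f k l)"
      by (rule suminf_sum) (rule summ)
    also have "\<dots> \<le> (\<Sum>l\<in>A. B * power_energy f l)"
    proof (rule sum_mono)
      fix l assume l: "l \<in> A"
      have "(\<Sum>k. (1 / 2) ^ k * ?pk f k l) \<le> 8 * 3 powr (1 + 1 / snd l) * power_energy f l"
        using E(3)[OF lA[OF l]] by simp
      also have "\<dots> \<le> B * power_energy f l"
        unfolding B_def using l A(1) by (intro mult_right_mono power_energy_nonneg[OF fin] member_le_sum) auto
      finally show "(\<Sum>k. (1 / 2) ^ k * ?pk f k l) \<le> B * power_energy f l" .
    qed
    finally have "(\<Sum>k. (1 / 2) ^ k * ?pk f k (t, w)) \<le> C * (B * (\<Sum>l\<in>A. power_energy f l))"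
      using C(1) by (simp add: mult_left_mono sum_distrib_left)
    then have le: "3 * 2 powr (1 + w) * (\<Sum>k. (1 / 2) ^ k * ?pk f k (t, w))
        \<le> 3 * 2 powr (1 + w) * (C * (B * (\<Sum>l\<in>A. power_energy f l)))"
      by (rule mult_left_mono) simp
    have "power_energy f (t, w) \<le> 3 * 2 powr (1 + w) * (\<Sum>k. (1 / 2) ^ k * ?pk f k (t, w))"
      using E(2)[OF t w] by (simp only: fst_conv snd_conv)
    also note le
    finally show ?thesis by (simp only: mult.assoc)
  qed
  then show ?thesis using C(1) B by (intro exI[of _ "3 * 2 powr (1 + w) * (C * B)"]) auto
qed

corollary dominated_tuple_energy:
  assumes A: "finite A" "fst ` A \<subseteq> carrier G" "\<And>w. w \<in> snd ` A \<Longrightarrow> 0 \<le> w"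
    and A': "finite A'" "fst ` A' \<subseteq> carrier G" "\<And>w. w \<in> snd ` A' \<Longrightarrow> 0 \<le> w"
    and dom: "\<And>t w n. (t, w) \<in> A' \<Longrightarrow> n \<in> bounded_exponents dyadic_scale w \<Longrightarrow>
      (\<lambda>i. t [^] n i) \<in> bounded_families G dyadic_scale A"
  shows "\<exists>C\<ge>0. \<forall>f. finite {g \<in> carrier G. f g \<noteq> 0} \<longrightarrow>
    (\<Sum>l\<in>A'. power_energy f l) \<le> C * (\<Sum>l\<in>A. power_energy f l)"
proof -
  have "\<exists>C\<ge>0. \<forall>f. finite {g \<in> carrier G. f g \<noteq> 0} \<longrightarrow> power_energy f l \<le> C * (\<Sum>l\<in>A. power_energy f l)"
    if l: "l \<in> A'" for l
  proof -
    obtain t w where tw: "l = (t, w)" by force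
    have "t \<in> carrier G" "0 \<le> w" using A'(2,3) l tw by force+
    then show ?thesis unfolding tw using dominated_power_energy[OF A] dom l tw by blast
  qed
  then have "\<forall>l\<in>A'. \<exists>C\<ge>0. \<forall>f. finite {g \<in> carrier G. f g \<noteq> 0} \<longrightarrow>
    power_energy f l \<le> C * (\<Sum>l\<in>A. power_energy f l)" by (rule ballI)
  from bchoice[OF this] obtain C where C: "\<forall>l\<in>A'. C l \<ge> 0 \<and> (\<forall>f. finite {g \<in> carrier G. f g \<noteq> 0} \<longrightarrow>
    power_energy f l \<le> C l * (\<Sum>l\<in>A. power_energy f l))" by (rule exE)
  have "(\<Sum>l\<in>A'. power_energy f l) \<le> (\<Sum>l\<in>A'. C l) * (\<Sum>l\<in>A. power_energy f l)"
    if "finite {g \<in> carrier G. f g \<noteq> 0}" for f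
    unfolding sum_distrib_right using C that by (intro sum_mono) simp
  then show ?thesis using C by (intro exI[of _ "\<Sum>l\<in>A'. C l"]) (auto intro: sum_nonneg)
qed

end

lemma sum_le_sum_list:
  fixes e :: "'a \<Rightarrow> real"
  assumes "\<And>x. 0 \<le> e x"
  shows "(\<Sum>x\<in>set xs. e x) \<le> (\<Sum>x\<leftarrow>xs. e x)"
proof (induction xs)
  case (Cons y xs)
  have "(\<Sum>x\<in>set (y # xs). e x) \<le> e y + (\<Sum>x\<in>set xs. e x)"
    by (simp add: sum.insert_if assms)
  then show ?case using Cons by simp
qed simp

lemma sum_list_le_sum:
  fixes e :: "'a \<Rightarrow> real"
  assumes "\<And>x. 0 \<le> e x"
  shows "(\<Sum>x\<leftarrow>xs. e x) \<le> real (length xs) * (\<Sum>x\<in>set xs. e x)"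
proof -
  have "e x \<le> (\<Sum>x\<in>set xs. e x)" if "x \<in> set xs" for x
    using that assms by (intro member_le_sum) auto
  then have "(\<Sum>x\<leftarrow>xs. e x) \<le> (\<Sum>x\<leftarrow>xs. \<Sum>x\<in>set xs. e x)" by (intro sum_list_mono) auto
  then show ?thesis by (simp add: sum_list_triv)
qed

section \<open>Families of bounded powers\<close>

lemma bounded_exponents_scale:
  assumes "n \<in> bounded_exponents sc w"
  shows "(\<lambda>i. c * n i) \<in> bounded_exponents sc w"
proof -
  obtain K where K: "0 \<le> K" "\<And>i. \<bar>real_of_int (n i)\<bar> \<le> K * sc i powr w"
    using bounded_exponentsE[OF assms] by blast
  show ?thesis
    by (rule bounded_exponentsI[of _ "\<bar>real_of_int c\<bar> * K"])
      (use K in \<open>auto simp: abs_mult mult.assoc intro!: mult_left_mono\<close>)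
qed

lemma bounded_exponents_div:
  assumes "n \<in> bounded_exponents sc w" "1 \<le> p"
  shows "(\<lambda>i. n i div int p) \<in> bounded_exponents sc w"
proof -
  obtain K where K: "0 \<le> K" "\<And>i. \<bar>real_of_int (n i)\<bar> \<le> K * sc i powr w"
    using bounded_exponentsE[OF assms(1)] by blast
  have "\<bar>n i div int p\<bar> \<le> \<bar>n i\<bar>" for i
  proof -
    define q where "q = n i div int p"
    have n: "n i = int p * q + n i mod int p" "0 \<le> n i mod int p" "n i mod int p < int p"
      using assms(2) by (simp_all add: q_def)
    show ?thesis
    proof (cases "0 \<le> q")
      case True
      then have "1 * q \<le> int p * q" using assms(2) by (intro mult_right_mono) auto
      then show ?thesis using True n unfolding q_def[symmetric] by linarith
    next
      case False
      then have "int p * (q + 1) \<le> 1 * (q + 1)" using assms(2) by (intro mult_right_mono_neg) auto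
      then show ?thesis using False n unfolding q_def[symmetric] by (simp add: algebra_simps)
    qed
  qed
  then have "\<bar>real_of_int (n i div int p)\<bar> \<le> \<bar>real_of_int (n i)\<bar>" for i
    by (metis of_int_abs of_int_le_iff)
  then show ?thesis
    by (intro bounded_exponentsI[of _ K]) (use K(2) in \<open>blast intro: order_trans\<close>)
qed

context group begin

context
  fixes A :: "('a \<times> real) set" and sc :: "'i \<Rightarrow> real"
  assumes A: "fst ` A \<subseteq> carrier G" and weights: "\<And>w. w \<in> snd ` A \<Longrightarrow> 0 \<le> w"
    and sc: "\<And>i. 1 \<le> sc i"
begin

interpretation B: subgroup "bounded_families G sc A" "fam G"
  by (rule subgroup_bounded_families[OF A])

text \<open>Switching a fixed element on and off with the index is needed for remainders of exponents, which
  are bounded but vary with the index.\<close>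

lemma indicator_family:
  assumes "g \<in> generate G (fst ` A)"
  shows "(\<lambda>i. if P i then g else \<one>) \<in> bounded_families G sc A"
  using assms
proof induction
  case one
  then show ?case using B.one_closed by simp
next
  case (incl g)
  then obtain a where ga: "(g, a) \<in> A" by force
  then have "g \<in> carrier G" "0 \<le> a" using A weights by force+
  then have "(\<lambda>i. g [^] (if P i then 1 else 0 :: int)) \<in> bounded_families G sc A"
    using sc ge_one_powr_ge_zero by (intro bounded_familiesI[OF ga] bounded_exponentsI[of _ 1]) auto
  moreover have "(\<lambda>i. g [^] (if P i then 1 else 0 :: int)) = (\<lambda>i. if P i then g else \<one>)"
    using \<open>g \<in> carrier G\<close> by (intro ext) auto
  ultimately show ?case by simp
next
  case (inv g)
  then obtain a where ga: "(g, a) \<in> A" by force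
  then have "g \<in> carrier G" "0 \<le> a" using A weights by force+
  then have "(\<lambda>i. g [^] (if P i then - 1 else 0 :: int)) \<in> bounded_families G sc A"
    using sc ge_one_powr_ge_zero by (intro bounded_familiesI[OF ga] bounded_exponentsI[of _ 1]) auto
  moreover have "(\<lambda>i. g [^] (if P i then - 1 else 0 :: int)) = (\<lambda>i. if P i then inv g else \<one>)"
    using \<open>g \<in> carrier G\<close> by (intro ext) (auto simp: int_pow_neg)
  ultimately show ?case by simp
next
  case (eng g h)
  have c: "g \<in> carrier G" "h \<in> carrier G" using eng generate_in_carrier[OF A] by auto
  have "(\<lambda>i. (if P i then g else \<one>) \<otimes> (if P i then h else \<one>)) \<in> bounded_families G sc A"
    using bounded_families_mult[OF A eng.IH] .
  moreover have "(\<lambda>i. (if P i then g else \<one>) \<otimes> (if P i then h else \<one>)) = (\<lambda>i. if P i then g \<otimes> h else \<one>)"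
    using c by (intro ext) auto
  ultimately show ?case by simp
qed

lemma constant_family: "g \<in> generate G (fst ` A) \<Longrightarrow> (\<lambda>i. g) \<in> bounded_families G sc A"
  using indicator_family[of g "\<lambda>_. True"] by simp

lemma bounded_power_family:
  assumes g: "g \<in> generate G (fst ` A)" and r: "\<And>i. r i \<le> R"
  shows "(\<lambda>i. g [^] (r i :: nat)) \<in> bounded_families G sc A"
proof -
  have gc: "g \<in> carrier G" using g generate_in_carrier[OF A] by auto
  have "(\<lambda>i. g [^] min (r i) R) \<in> bounded_families G sc A"
  proof (induction R)
    case 0
    then show ?case using B.one_closed by simp
  next
    case (Suc R)
    have "(\<lambda>i. g [^] min (r i) R \<otimes> (if R < r i then g else \<one>)) \<in> bounded_families G sc A"
      by (intro bounded_families_mult[OF A Suc] indicator_family g)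
    moreover have "(\<lambda>i. g [^] min (r i) R \<otimes> (if R < r i then g else \<one>)) = (\<lambda>i. g [^] min (r i) (Suc R))"
      using gc by (intro ext) (auto simp: min_def not_le le_Suc_eq)
    ultimately show ?case by simp
  qed
  then show ?thesis using r by (simp add: min_absorb1)
qed

text \<open>Division with remainder by \<open>p\<close>. In this way statements about a subgroup pass to its isolator.\<close>

lemma power_family_root:
  assumes g: "g \<in> generate G (fst ` A)" and p: "1 \<le> (p::nat)"
    and pow: "\<And>n. n \<in> bounded_exponents sc w \<Longrightarrow> (\<lambda>i. (g [^] p) [^] n i) \<in> bounded_families G sc A"
    and n: "n \<in> bounded_exponents sc w"
  shows "(\<lambda>i. g [^] (n i :: int)) \<in> bounded_families G sc A"
proof -
  have gc: "g \<in> carrier G" using g generate_in_carrier[OF A] by auto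
  have "(\<lambda>i. g [^] nat (n i mod int p)) \<in> bounded_families G sc A"
    using p by (intro bounded_power_family[OF g, of _ p]) (simp add: nat_le_iff less_imp_le)
  from bounded_families_mult[OF A pow[OF bounded_exponents_div[OF n p]] this]
  have "(\<lambda>i. (g [^] p) [^] (n i div int p) \<otimes> g [^] nat (n i mod int p)) \<in> bounded_families G sc A" .
  moreover have "(g [^] p) [^] (n i div int p) \<otimes> g [^] nat (n i mod int p) = g [^] n i" for i
  proof -
    have "(g [^] p) [^] (n i div int p) = g [^] (int p * (n i div int p))"
      using gc by (simp add: int_pow_pow[symmetric] int_pow_int)
    moreover have "g [^] nat (n i mod int p) = g [^] (n i mod int p)"
      using p by (simp flip: int_pow_int)
    ultimately show ?thesis using gc by (simp flip: int_pow_mult)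
  qed
  ultimately show ?thesis by simp
qed

lemma power_family_torsion:
  assumes g: "g \<in> generate G (fst ` A)" and p: "1 \<le> (p::nat)" "g [^] p = \<one>"
  shows "(\<lambda>i. g [^] (n i :: int)) \<in> bounded_families G sc A"
proof -
  have "(\<lambda>i. g [^] nat (n i mod int p)) \<in> bounded_families G sc A"
    using p by (intro bounded_power_family[OF g, of _ p]) (simp add: nat_le_iff less_imp_le)
  moreover have "g [^] nat (n i mod int p) = g [^] n i" for i
  proof -
    have gc: "g \<in> carrier G" using g generate_in_carrier[OF A] by auto
    have "g [^] n i = g [^] (int p * (n i div int p) + n i mod int p)" by simp
    also have "\<dots> = (g [^] int p) [^] (n i div int p) \<otimes> g [^] (n i mod int p)"
      using gc by (simp only: int_pow_mult int_pow_pow)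
    also have "\<dots> = g [^] (n i mod int p)" using p gc by (simp add: int_pow_int)
    also have "\<dots> = g [^] nat (n i mod int p)" using p by (simp flip: int_pow_int)
    finally show ?thesis by simp
  qed
  ultimately show ?thesis by simp
qed

lemma power_family_weight_zero:
  assumes g: "g \<in> generate G (fst ` A)" and n: "n \<in> bounded_exponents sc 0"
  shows "(\<lambda>i. g [^] (n i :: int)) \<in> bounded_families G sc A"
proof -
  obtain K where K: "0 \<le> K" "\<And>i. \<bar>real_of_int (n i)\<bar> \<le> K * sc i powr 0"
    using bounded_exponentsE[OF n] by blast
  have "sc i powr 0 = 1" for i using sc[of i] by simp
  then have K': "\<bar>real_of_int (n i)\<bar> \<le> K" for i using K(2)[of i] by simp
  define R where "R = nat \<lceil>K\<rceil>"
  have R: "nat (n i) \<le> R" "nat (- n i) \<le> R" for i using K'[of i] unfolding R_def by linarith+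
  have gc: "g \<in> carrier G" using g generate_in_carrier[OF A] by auto
  have "(\<lambda>i. g [^] nat (n i)) \<otimes>\<^bsub>fam G\<^esub> inv\<^bsub>fam G\<^esub> (\<lambda>i. g [^] nat (- n i)) \<in> bounded_families G sc A"
    by (intro B.m_closed B.m_inv_closed bounded_power_family[OF g R(1)] bounded_power_family[OF g R(2)])
  moreover have "g [^] nat (n i) \<otimes> inv (g [^] nat (- n i)) = g [^] n i" for i
    using gc by (simp add: int_pow_def2 del: pow_nat)
  ultimately show ?thesis using gc by (simp add: inv_fam)
qed

end

lemma int_pow_conj:
  assumes "x \<in> carrier G" "y \<in> carrier G"
  shows "(x \<otimes> y \<otimes> inv x) [^] (n::int) = x \<otimes> y [^] n \<otimes> inv x"
proof -
  have "(\<lambda>y. x \<otimes> y \<otimes> inv x) \<in> hom G G" using assms by (auto simp: hom_def m_assoc)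
  then show ?thesis using hom_int_pow[of "\<lambda>y. x \<otimes> y \<otimes> inv x" G G y n] assms is_group by simp
qed

lemma finite_order_if_finite_generate:
  assumes "x \<in> carrier G" "finite (generate G {x})"
  obtains p :: nat where "1 \<le> p" "x [^] p = \<one>"
proof -
  have "range (\<lambda>n::nat. x [^] n) \<subseteq> generate G {x}"
  proof
    fix y assume "y \<in> range (\<lambda>n::nat. x [^] n)"
    then obtain n :: nat where "y = x [^] n" by blast
    moreover have "x [^] n \<in> generate G {x}"
      by (induction n) (auto intro: generate.intros)
    ultimately show "y \<in> generate G {x}" by simp
  qed
  then have "finite (range (\<lambda>n::nat. x [^] n))" using assms(2) finite_subset by blast
  then have "\<not> inj (\<lambda>n::nat. x [^] n)" using finite_imageD infinite_UNIV_nat by blast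
  then obtain k l :: nat where "k \<noteq> l" "x [^] k = x [^] l" by (auto simp: inj_def)
  then obtain k l :: nat where kl: "k < l" "x [^] k = x [^] l" by (metis linorder_neqE_nat)
  have "x [^] (l - k) = \<one>" using pow_eq_div2[of x l k] assms(1) kl by simp
  then show ?thesis using kl(1) by (intro that[of "l - k"]) auto
qed

text \<open>A formal commutator of weight exactly \<open>w\<close> is a letter or a bracket of commutators of smaller
  weight.\<close>

lemma weight_subgroup_generated:
  assumes TG: "fst ` set T \<subseteq> carrier G"
  shows "weight_subgroup G T w \<subseteq> generate G ({fc_eval G T (Letter i b) | i b. i < length T \<and> snd (T ! i) = w} \<union>
    \<Union> {weight_subgroup G T v | v. v \<in> formal_weights T \<and> w < v} \<union>
    {gcomm G x y | x y. \<exists>a \<in> formal_weights T. \<exists>b \<in> formal_weights T. a + b = w \<and>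
      x \<in> weight_subgroup G T a \<and> y \<in> weight_subgroup G T b})"
  unfolding weight_subgroup_def[of G T w]
proof (rule mono_generate)
  have mem: "fc_eval G T c \<in> weight_subgroup G T (fc_weight T c)" if "c \<in> fcomms T" for c
    unfolding weight_subgroup_def using that by (intro generate.incl) auto
  have U: "fc_weight T c \<in> formal_weights T" if "c \<in> fcomms T" for c
    using that by (simp add: formal_weights_def)
  have "fc_eval G T c \<in> {fc_eval G T (Letter i b) | i b. i < length T \<and> snd (T ! i) = w} \<union>
    \<Union> {weight_subgroup G T v | v. v \<in> formal_weights T \<and> w < v} \<union>
    {gcomm G x y | x y. \<exists>a \<in> formal_weights T. \<exists>b \<in> formal_weights T. a + b = w \<and>
      x \<in> weight_subgroup G T a \<and> y \<in> weight_subgroup G T b}"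
    if c: "c \<in> fcomms T" "w \<le> fc_weight T c" for c
  proof (cases "fc_weight T c = w")
    case False
    then show ?thesis using mem[OF c(1)] U[OF c(1)] c(2) by fastforce
  next
    case True
    show ?thesis
    proof (cases c)
      case (Letter i b)
      then have "i < length T" "snd (T ! i) = w" using c True by auto
      then show ?thesis unfolding Letter by blast
    next
      case (Br d e)
      have de: "d \<in> fcomms T" "e \<in> fcomms T" using c(1) Br by auto
      have "fc_weight T d + fc_weight T e = w" using True Br by simp
      moreover have "fc_eval G T c = gcomm G (fc_eval G T d) (fc_eval G T e)" using Br by simp
      ultimately show ?thesis using mem[OF de(1)] mem[OF de(2)] U[OF de(1)] U[OF de(2)] by blast
    qed
  qed
  then show "fc_eval G T ` {c \<in> fcomms T. w \<le> fc_weight T c} \<subseteq> {fc_eval G T (Letter i b) | i b. i < length T \<and> snd (T ! i) = w} \<union>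
    \<Union> {weight_subgroup G T v | v. v \<in> formal_weights T \<and> w < v} \<union>
    {gcomm G x y | x y. \<exists>a \<in> formal_weights T. \<exists>b \<in> formal_weights T. a + b = w \<and>
      x \<in> weight_subgroup G T a \<and> y \<in> weight_subgroup G T b}" by blast
qed

end

section \<open>The comparison theorem\<close>

lemma set_conj_power_tuple:
  "set (conj_power_tuple G X \<epsilon> S v) =
    {(X ! j \<otimes>\<^bsub>G\<^esub> (S ! i [^]\<^bsub>G\<^esub> \<epsilon> i) \<otimes>\<^bsub>G\<^esub> inv\<^bsub>G\<^esub> (X ! j), v ! i) | i j.
      j < length X \<and> i < length S \<and> infinite (generate G {S ! i})}"
  unfolding conj_power_tuple_def by (auto simp: atLeast0LessThan)

lemma SUP_weight_attained:
  fixes u :: "nat \<Rightarrow> real"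
  assumes fin: "finite A" and le: "ereal a \<le> (SUP i\<in>A. ereal (u i))"
  obtains i where "i \<in> A" "a \<le> u i"
proof (cases "A = {}")
  case True
  then show ?thesis using le by (simp add: bot_ereal_def)
next
  case False
  have "(SUP i\<in>A. ereal (u i)) \<in> (\<lambda>i. ereal (u i)) ` A"
    using fin False by (intro finite_Sup_in) (auto simp: sup_max max_def)
  then obtain i where "i \<in> A" "(SUP i\<in>A. ereal (u i)) = ereal (u i)" by auto
  then show ?thesis using le by (intro that[of i]) auto
qed

context group begin

lemma weight_filtration_graded_series:
  assumes M: "subgroup M G" and I: "graded_series G M u m I"
  shows "weight_filtration G (range u) I"
proof (intro weight_filtration.intro weight_filtration_axioms.intro)
  have mono: "strict_mono u" and half: "\<And>i. u i > 1 / 2" and add: "\<And>i j. u i + u j \<in> range u"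
    and sub: "\<And>i. subgroup (I (u i)) (G\<lparr>carrier := M\<rparr>)"
    and dec: "\<And>i. i < m \<Longrightarrow> I (u (Suc i)) \<subset> I (u i)" and triv: "\<And>i. m < i \<Longrightarrow> I (u i) = {\<one>}"
    and comm: "\<And>i j. comm_subgroup G (I (u i)) (I (u j)) \<subseteq> I (u i + u j)"
    using I unfolding graded_series_def by auto
  have subG: "subgroup (I (u i)) G" for i by (rule incl_subgroup[OF M sub])
  show "group G" by (rule is_group)
  show "0 < w" if w: "w \<in> range u" for w
  proof -
    obtain i where "w = u i" using w by blast
    then show ?thesis using half[of i] by simp
  qed
  show "a + b \<in> range u" if "a \<in> range u" "b \<in> range u" for a b
    using that add by auto
  show "finite {w \<in> range u. w \<le> t}" for t
  proof -
    have mult: "real (Suc n) * u 0 \<in> range u" for n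
    proof (induction n)
      case (Suc n)
      then obtain j where j: "real (Suc n) * u 0 = u j" by blast
      have "real (Suc (Suc n)) * u 0 = real (Suc n) * u 0 + u 0" by (simp add: algebra_simps)
      then show ?case using add[of j 0] by (simp only: j)
    qed simp
    obtain n where "t / u 0 < real n" using reals_Archimedean2 by blast
    then have "t < real (Suc n) * u 0" using half[of 0] by (simp add: field_simps)
    moreover obtain j where "real (Suc n) * u 0 = u j" using mult by blast
    ultimately have t: "t < u j" by simp
    have "{w \<in> range u. w \<le> t} \<subseteq> u ` {..<j}"
    proof
      fix w assume "w \<in> {w \<in> range u. w \<le> t}"
      then obtain i where i: "w = u i" "u i \<le> t" by auto
      then have "u i < u j" using t by linarith
      then show "w \<in> u ` {..<j}" unfolding i(1) using strict_mono_less[OF mono] by simp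
    qed
    then show ?thesis by (rule finite_subset) simp
  qed
  show "subgroup (I w) G" if "w \<in> range u" for w using that subG by auto
  have Suc: "I (u (Suc i)) \<subseteq> I (u i)" for i
  proof (cases "i < m")
    case False
    then have "I (u (Suc i)) = {\<one>}" by (intro triv) simp
    then show ?thesis using subgroup.one_closed[OF subG[of i]] by simp
  qed (use dec in blast)
  have anti: "I (u j) \<subseteq> I (u i)" if "i \<le> j" for i j
    using that by (rule lift_Suc_antimono_le[of "\<lambda>i. I (u i)", OF Suc])
  show "I b \<subseteq> I a" if ab: "a \<in> range u" "b \<in> range u" "a \<le> b" for a b
  proof -
    obtain i j where "a = u i" "b = u j" using ab by blast
    then show ?thesis using anti[of i j] ab(3) strict_mono_less_eq[OF mono] by simp
  qed
  show "gcomm G x y \<in> I (a + b)" if xy: "a \<in> range u" "b \<in> range u" "x \<in> I a" "y \<in> I b" for a b x y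
  proof -
    obtain i j where "a = u i" "b = u j" using xy by blast
    moreover have "gcomm G x y \<in> comm_subgroup G (I a) (I b)"
      unfolding comm_subgroup_def using xy by (intro generate.incl) blast
    ultimately show ?thesis using comm by blast
  qed
  show "\<exists>t. \<forall>w\<in>range u. t \<le> w \<longrightarrow> I w = {\<one>}"
    using triv strict_mono_less_eq[OF mono] by (intro exI[of _ "u (Suc m)"]) auto
qed

text \<open>The hypothesis of the generation theorem for the series, at the weights of its torsion-free
  quotients.\<close>

lemma graded_series_generated:
  assumes M: "subgroup M G" and I: "graded_series G M u m I" and i: "i < m"
    and Y: "Y \<subseteq> I (u i)" and gen: "generates_graded_piece G u I i Y"
  shows "I (u i) \<subseteq> generate G (Y \<union> I (u (Suc i)) \<union>
    {gcomm G x y | x y. \<exists>a \<in> range u. \<exists>b \<in> range u. a + b = u i \<and> x \<in> I a \<and> y \<in> I b})"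
    (is "_ \<subseteq> generate G (Y \<union> _ \<union> ?K)")
proof -
  interpret weight_filtration G "range u" I by (rule weight_filtration_graded_series[OF M I])
  have comm: "\<And>i. comm_subgroup G M (I (u i)) \<subseteq> I (u (Suc i))"
    and sub: "\<And>i. subgroup (I (u i)) (G\<lparr>carrier := M\<rparr>)"
    and dec: "\<And>i. i < m \<Longrightarrow> I (u (Suc i)) \<subset> I (u i)"
    using I unfolding graded_series_def by auto
  have subG: "subgroup (I (u j)) G" for j by (intro term_subgroup) simp
  have IM: "I (u j) \<subseteq> M" for j using subgroup.subset[OF sub[of j]] by simp
  have Ic: "I (u j) \<subseteq> carrier G" for j by (rule subgroup.subset[OF subG])
  have Kc: "?K \<subseteq> carrier G"
  proof
    fix z assume "z \<in> ?K"
    then obtain x y a b where "z = gcomm G x y" "x \<in> I (u a)" "y \<in> I (u b)" by auto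
    then show "z \<in> carrier G" using term_closed[of "u a" x] term_closed[of "u b" y] by auto
  qed
  have cs: "comm_subgroup G (I (u a)) (I (u b)) \<subseteq> I (u i)" if "u a + u b = u i" for a b
    unfolding comm_subgroup_def
  proof (rule generate_subgroup_incl[OF _ subG])
    show "{gcomm G h k | h k. h \<in> I (u a) \<and> k \<in> I (u b)} \<subseteq> I (u i)"
      using term_gcomm[of "u a" "u b"] that by auto
  qed
  have csK: "comm_subgroup G (I (u a)) (I (u b)) \<subseteq> generate G ?K" if "u a + u b = u i" for a b
    unfolding comm_subgroup_def by (rule mono_generate) (use that in blast)
  have unionC: "(\<Union>{comm_subgroup G (I (u a)) (I (u b)) | a b. a < i \<and> b < i \<and> u a + u b = u i}) \<subseteq> I (u i)"
    using cs by blast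
  have C: "subgroup (series_comm G u I i) G"
    unfolding series_comm_def using unionC Ic by (intro generate_is_subgroup) blast
  have CI: "series_comm G u I i \<subseteq> I (u i)"
    unfolding series_comm_def by (rule generate_subgroup_incl[OF unionC subG])
  have CK: "series_comm G u I i \<subseteq> generate G ?K"
    unfolding series_comm_def
    by (rule generate_subgroup_incl[OF _ generate_is_subgroup[OF Kc]]) (use csK in blast)
  have "I (u i) \<subseteq> generate G (Y \<union> series_comm G u I i \<union> I (u (Suc i)))"
  proof (rule generates_graded_pieceD[OF subG subG _ C CI _ Y gen])
    show "I (u (Suc i)) \<subseteq> I (u i)" using dec[OF i] by blast
    show "gcomm G x y \<in> I (u (Suc i))" if "x \<in> I (u i)" "y \<in> I (u i)" for x y
    proof -
      have "gcomm G x y \<in> comm_subgroup G M (I (u i))"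
        unfolding comm_subgroup_def using that IM by (intro generate.incl) blast
      then show ?thesis using comm by blast
    qed
  qed
  also have "\<dots> \<subseteq> generate G (Y \<union> I (u (Suc i)) \<union> ?K)"
  proof (rule generate_subgroup_incl)
    show "subgroup (generate G (Y \<union> I (u (Suc i)) \<union> ?K)) G"
      using Y Ic Kc by (intro generate_is_subgroup) blast
    have "generate G ?K \<subseteq> generate G (Y \<union> I (u (Suc i)) \<union> ?K)" by (intro mono_generate) blast
    then show "Y \<union> series_comm G u I i \<union> I (u (Suc i)) \<subseteq> generate G (Y \<union> I (u (Suc i)) \<union> ?K)"
      using CK by (auto intro: generate.incl)
  qed
  finally show ?thesis .
qed

text \<open>Each tuple dominates the other. Letters of \<open>\<Xi>\<close> lie in isolators of weight subgroups of \<open>S\<^sub>N\<close> or are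
  torsion, and the letters of \<open>S\<^sub>N\<close> are conjugates of powers of entries of \<open>S\<close>. Conversely an entry of
  \<open>S\<close> has finite order or a power that is a letter of \<open>S\<^sub>N\<close>, hence lies in a term of the series of at
  least the same weight, or in the torsion subgroup; and the series is generated by \<open>\<Xi>\<close> and
  commutators.\<close>

theorem weighted_tuples_comparable:
  assumes normal: "N \<lhd> G" and nil: "nilpotent_group (G\<lparr>carrier := N\<rparr>)"
    and S: "set S \<subseteq> carrier G" "generate G (set S) = carrier G"
    and v: "length v = length S" "\<forall>i<length v. v ! i > 1/2"
    and X: "coset_reps G N X"
    and \<epsilon>: "\<forall>i<length S. infinite (generate G {S ! i}) \<longrightarrow>
           \<epsilon> i \<ge> 1 \<and> generate G {S ! i} \<inter> N = generate G {S ! i [^] \<epsilon> i}"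
    and SN: "S\<^sub>N = conj_power_tuple G X \<epsilon> S v" and M: "M = wgroup G S\<^sub>N"
    and I: "graded_series G M u m I" and \<Xi>: "adapted_tuple G M u m I \<Xi>"
    and \<Xi>1: "finite \<Xi>\<^sub>1" "\<Xi>\<^sub>1 \<subseteq> carrier G" and genG: "generate G (fst ` set \<Xi> \<union> \<Xi>\<^sub>1) = carrier G"
    and red: "reduced_series G S\<^sub>N = map (\<lambda>i. (u i, I (u i))) [0..<m]"
    and PS: "power_measure G (reciprocal_weights (zip S v)) \<mu>\<^sub>S"
    and P\<Xi>: "power_measure G (reciprocal_weights \<Xi>) \<mu>\<^sub>\<Xi>"
  shows "dirichlet_comparable G (pmf \<mu>\<^sub>S) (\<lambda>g. pmf \<mu>\<^sub>\<Xi> g + uniform_mass \<Xi>\<^sub>1 g)"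
proof -
  have N: "subgroup N G" by (rule normal_imp_subgroup[OF normal])
  let ?B = "bounded_families G dyadic_scale"
  define A\<^sub>S where "A\<^sub>S = set (zip S v)"
  define A\<^sub>\<Xi> where "A\<^sub>\<Xi> = set \<Xi> \<union> (\<lambda>x. (x, 0)) ` \<Xi>\<^sub>1"

  have A\<^sub>S_mem: "\<exists>i<length S. t = S ! i \<and> w = v ! i" if "(t, w) \<in> A\<^sub>S" for t w
    using that v by (auto simp: A\<^sub>S_def set_zip)
  have A\<^sub>S_i: "(S ! i, v ! i) \<in> A\<^sub>S" if "i < length S" for i
    using that v by (auto simp: A\<^sub>S_def set_zip)
  have fstS: "fst ` A\<^sub>S = set S" using v(1) by (simp add: A\<^sub>S_def flip: set_map)
  have A\<^sub>S_carrier: "fst ` A\<^sub>S \<subseteq> carrier G" using S fstS by simp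
  have A\<^sub>S_pos: "0 < w" if w: "w \<in> snd ` A\<^sub>S" for w
  proof -
    obtain t where "(t, w) \<in> A\<^sub>S" using w by auto
    then obtain i where "i < length S" "w = v ! i" using A\<^sub>S_mem by blast
    then have "1 / 2 < w" using v by simp
    then show ?thesis by simp
  qed
  have A\<^sub>S_nonneg: "0 \<le> w" if "w \<in> snd ` A\<^sub>S" for w using A\<^sub>S_pos[OF that] by simp
  have genS: "g \<in> generate G (fst ` A\<^sub>S)" if "g \<in> carrier G" for g using that S(2) fstS by simp
  interpret BS: subgroup "?B A\<^sub>S" "fam G" by (rule subgroup_bounded_families[OF A\<^sub>S_carrier])
  note dy = dyadic_scale_ge_1

  have SN_mem: "\<exists>i j. j < length X \<and> i < length S \<and> infinite (generate G {S ! i}) \<and>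
      t = X ! j \<otimes> (S ! i [^] \<epsilon> i) \<otimes> inv (X ! j) \<and> w = v ! i" if "(t, w) \<in> set S\<^sub>N" for t w
    using that unfolding SN set_conj_power_tuple by blast
  have pow_N: "S ! i [^] \<epsilon> i \<in> N" if "i < length S" "infinite (generate G {S ! i})" for i
    using \<epsilon> that generate.incl[of "S ! i [^] \<epsilon> i" "{S ! i [^] \<epsilon> i}" G] by blast
  have Xc: "X ! j \<in> carrier G" if "j < length X" for j
    using X that unfolding coset_reps_def by (auto intro: nth_mem)
  have SN_N: "fst ` set S\<^sub>N \<subseteq> N"
  proof
    fix t assume "t \<in> fst ` set S\<^sub>N"
    then obtain w where "(t, w) \<in> set S\<^sub>N" by auto
    then obtain i j where ij: "j < length X" "i < length S" "infinite (generate G {S ! i})"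
      "t = X ! j \<otimes> (S ! i [^] \<epsilon> i) \<otimes> inv (X ! j)" using SN_mem by blast
    then show "t \<in> N" using normal.inv_op_closed2[OF normal Xc pow_N] by blast
  qed
  have SN_pos: "0 < w" if w: "w \<in> snd ` set S\<^sub>N" for w
  proof -
    obtain t where "(t, w) \<in> set S\<^sub>N" using w by auto
    then obtain i where "i < length S" "w = v ! i" using SN_mem by blast
    then have "w \<in> snd ` A\<^sub>S" using A\<^sub>S_i by force
    then show ?thesis by (rule A\<^sub>S_pos)
  qed
  have SN_carrier: "fst ` set S\<^sub>N \<subseteq> carrier G" using SN_N subgroup.subset[OF N] by blast
  have Msub: "subgroup M G" unfolding M wgroup_def by (rule generate_is_subgroup[OF SN_carrier])
  have Mc: "M \<subseteq> carrier G" by (rule subgroup.subset[OF Msub])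

  have SN_S: "(\<lambda>i. t [^] n i) \<in> ?B A\<^sub>S" if t: "(t, w) \<in> set S\<^sub>N" and n: "n \<in> bounded_exponents dyadic_scale w" for t w n
  proof -
    obtain i j where ij: "j < length X" "i < length S" 
      "t = X ! j \<otimes> (S ! i [^] \<epsilon> i) \<otimes> inv (X ! j)" "w = v ! i" using SN_mem[OF t] by blast
    have c: "X ! j \<in> carrier G" "S ! i \<in> carrier G" using Xc ij S(1) by auto
    have "(\<lambda>k. S ! i [^] (int (\<epsilon> i) * n k)) \<in> ?B A\<^sub>S"
      using bounded_exponents_scale[OF n] ij(4) by (intro bounded_familiesI[OF A\<^sub>S_i[OF ij(2)]]) simp
    moreover have "(\<lambda>k. X ! j) \<in> ?B A\<^sub>S" "(\<lambda>k. inv (X ! j)) \<in> ?B A\<^sub>S"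
      using c by (auto intro!: constant_family[OF A\<^sub>S_carrier A\<^sub>S_nonneg dy] genS)
    ultimately have "(\<lambda>k. X ! j \<otimes> (S ! i [^] (int (\<epsilon> i) * n k)) \<otimes> inv (X ! j)) \<in> ?B A\<^sub>S"
      by (intro bounded_families_mult[OF A\<^sub>S_carrier])
    moreover have "t [^] n k = X ! j \<otimes> (S ! i [^] (int (\<epsilon> i) * n k)) \<otimes> inv (X ! j)" for k
      unfolding ij(3) using c by (simp add: int_pow_conj int_pow_int[symmetric] int_pow_pow)
    ultimately show ?thesis by simp
  qed

  interpret F: scaled_filtration G "formal_weights S\<^sub>N" "weight_subgroup G S\<^sub>N" dyadic_scale
    by (intro scaled_filtration.intro scaled_filtration_axioms.intro
        weight_filtration_formal[OF N nil SN_N SN_pos] dy)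
  have weight_subgroup_S: "(\<lambda>i. g [^] n i) \<in> ?B A\<^sub>S"
    if "w \<in> formal_weights S\<^sub>N" "g \<in> weight_subgroup G S\<^sub>N w" "n \<in> bounded_exponents dyadic_scale w" for g n w
  proof (rule F.power_families_generated[OF BS.subgroup_axioms _ _ weight_subgroup_generated[OF SN_carrier] that])
    fix w y assume w: "w \<in> formal_weights S\<^sub>N"
      and "y \<in> {fc_eval G S\<^sub>N (Letter i b) | i b. i < length S\<^sub>N \<and> snd (S\<^sub>N ! i) = w}"
    then obtain i b where ib: "y = fc_eval G S\<^sub>N (Letter i b)" "i < length S\<^sub>N" "snd (S\<^sub>N ! i) = w" by blast
    show "y \<in> weight_subgroup G S\<^sub>N w"
      unfolding weight_subgroup_def ib(1) using ib(2,3) by (intro generate.incl imageI) simp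
    fix n :: "nat \<times> int \<Rightarrow> int" assume n: "n \<in> bounded_exponents dyadic_scale w"
    have mem: "(fst (S\<^sub>N ! i), w) \<in> set S\<^sub>N" using nth_mem[OF ib(2)] ib(3) by (metis prod.collapse)
    then have c: "fst (S\<^sub>N ! i) \<in> carrier G" using SN_carrier by force
    show "(\<lambda>i. y [^] n i) \<in> ?B A\<^sub>S"
    proof (cases b)
      case True
      then show ?thesis using SN_S[OF mem n] ib(1) by simp
    next
      case False
      then show ?thesis
        using SN_S[OF mem bounded_exponents_uminus[OF n]] ib(1) c by (simp add: int_pow_neg int_pow_inv)
    qed
  qed
  have torsion_S: "(\<lambda>i. g [^] n i) \<in> ?B A\<^sub>S" if g: "g \<in> torsion_part G M" for g and n :: "nat \<times> int \<Rightarrow> int"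
  proof -
    obtain p :: nat where p: "g \<in> M" "1 \<le> p" "g [^] p = \<one>" using g unfolding isolator_def by blast
    then have "g \<in> generate G (fst ` A\<^sub>S)" using Mc genS by blast
    then show ?thesis
      by - (rule power_family_torsion[OF A\<^sub>S_carrier A\<^sub>S_nonneg dy _ p(2,3)])
  qed
  have term_S: "(\<lambda>i. g [^] n i) \<in> ?B A\<^sub>S"
    if i: "i < m" and g: "g \<in> I (u i)" and n: "n \<in> bounded_exponents dyadic_scale (u i)" for g n i
  proof -
    have "(u i, I (u i)) \<in> set (reduced_series G S\<^sub>N)" unfolding red using i by auto
    note r = reduced_series_member[OF N nil SN_N SN_pos this]
    have "g \<in> isolator G M (weight_subgroup G S\<^sub>N (u i))" using g r(2) unfolding M by simp
    then obtain p :: nat where p: "g \<in> M" "1 \<le> p" "g [^] p \<in> weight_subgroup G S\<^sub>N (u i)"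
      unfolding isolator_def by blast
    show ?thesis
      by (rule power_family_root[OF A\<^sub>S_carrier A\<^sub>S_nonneg dy genS p(2) weight_subgroup_S[OF r(1) p(3)] n])
        (use p(1) Mc in auto)
  qed

  obtain Y \<Xi>\<^sub>0 a where Y': "\<forall>i<m. distinct (Y i) \<and> set (Y i) \<subseteq> I (u i) \<and> generates_graded_piece G u I i (set (Y i))"
    and \<Xi>0: "set \<Xi>\<^sub>0 \<subseteq> M" "length a = length \<Xi>\<^sub>0"
      "\<forall>i<length \<Xi>\<^sub>0. a ! i > 1/2 \<and> ereal (a ! i) \<le> series_weight G M u m I (\<Xi>\<^sub>0 ! i)"
    and \<Xi>_eq: "\<Xi> = series_tuple u m Y \<Xi>\<^sub>0 a"
    using \<Xi> unfolding adapted_tuple_def by (elim exE conjE) (rule that)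
  have Y: "set (Y i) \<subseteq> I (u i)" "generates_graded_piece G u I i (set (Y i))" if "i < m" for i
    using Y' that by simp_all
  have set\<Xi>: "set \<Xi> = {(y, u i) | y i. i < m \<and> y \<in> set (Y i)} \<union> {(\<Xi>\<^sub>0 ! k, a ! k) | k. k < length \<Xi>\<^sub>0}"
    unfolding \<Xi>_eq series_tuple_def using \<Xi>0(2) by (auto simp: set_zip)
  have mono: "strict_mono u" and half: "\<And>i. u i > 1 / 2"
    and I_sub: "\<And>i. subgroup (I (u i)) (G\<lparr>carrier := M\<rparr>)"
    and Im: "I (u m) = torsion_part G M" and triv: "\<And>i. m < i \<Longrightarrow> I (u i) = {\<one>}"
    using I unfolding graded_series_def by simp_all
  interpret WI: scaled_filtration G "range u" I dyadic_scale
    by (intro scaled_filtration.intro scaled_filtration_axioms.intro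
        weight_filtration_graded_series[OF Msub I] dy)
  have IM: "I (u i) \<subseteq> M" for i
    using subgroup.subset[OF I_sub[of i]] by simp
  have \<Xi>_M: "fst ` set \<Xi> \<subseteq> M"
  proof
    fix t assume "t \<in> fst ` set \<Xi>"
    then have "(\<exists>i<m. t \<in> set (Y i)) \<or> (\<exists>k<length \<Xi>\<^sub>0. t = \<Xi>\<^sub>0 ! k)" unfolding set\<Xi> by force
    then show "t \<in> M"
    proof (elim disjE exE conjE)
      fix i assume "i < m" "t \<in> set (Y i)"
      then show ?thesis using Y(1) IM by blast
    next
      fix k assume "k < length \<Xi>\<^sub>0" "t = \<Xi>\<^sub>0 ! k"
      then show ?thesis using \<Xi>0(1) nth_mem by blast
    qed
  qed
  have \<Xi>_carrier: "fst ` set \<Xi> \<subseteq> carrier G" using \<Xi>_M Mc by blast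
  have \<Xi>_pos: "0 < w" if "w \<in> snd ` set \<Xi>" for w
  proof -
    have "(\<exists>i. w = u i) \<or> (\<exists>k<length \<Xi>\<^sub>0. w = a ! k)" using that unfolding set\<Xi> by auto
    then show ?thesis
    proof (elim disjE exE conjE)
      fix i assume "w = u i"
      then show ?thesis using half[of i] by simp
    next
      fix k assume k: "k < length \<Xi>\<^sub>0" "w = a ! k"
      then have "a ! k > 1 / 2" using \<Xi>0(3) by blast
      then show ?thesis using k by simp
    qed
  qed
  have A\<^sub>\<Xi>_carrier: "fst ` A\<^sub>\<Xi> \<subseteq> carrier G" using \<Xi>_carrier \<Xi>1(2) by (auto simp: A\<^sub>\<Xi>_def)
  have A\<^sub>\<Xi>_nonneg: "0 \<le> w" if "w \<in> snd ` A\<^sub>\<Xi>" for w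
    using that \<Xi>_pos by (force simp: A\<^sub>\<Xi>_def)
  have "fst ` A\<^sub>\<Xi> = fst ` set \<Xi> \<union> \<Xi>\<^sub>1" by (simp add: A\<^sub>\<Xi>_def image_Un image_image)
  then have gen\<Xi>: "g \<in> generate G (fst ` A\<^sub>\<Xi>)" if "g \<in> carrier G" for g using that genG by simp
  interpret B\<Xi>: subgroup "?B A\<^sub>\<Xi>" "fam G" by (rule subgroup_bounded_families[OF A\<^sub>\<Xi>_carrier])

  have dom1: "(\<lambda>i. t [^] n i) \<in> ?B A\<^sub>S" if t: "(t, w) \<in> A\<^sub>\<Xi>" and n: "n \<in> bounded_exponents dyadic_scale w" for t w n
  proof -
    consider i where "i < m" "t \<in> I (u i)" "w \<le> u i" | "t \<in> torsion_part G M" | "t \<in> \<Xi>\<^sub>1" "w = 0"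
    proof -
      have "(\<exists>i<m. t \<in> I (u i) \<and> w \<le> u i) \<or> t \<in> torsion_part G M" if k: "k < length \<Xi>\<^sub>0" "t = \<Xi>\<^sub>0 ! k" "w = a ! k" for k
      proof (rule disjCI)
        assume nt: "t \<notin> torsion_part G M"
        have "ereal (a ! k) \<le> series_weight G M u m I (\<Xi>\<^sub>0 ! k)" using \<Xi>0(3) k(1) by blast
        then have "ereal w \<le> (SUP i \<in> {i. i < m \<and> t \<in> I (u i)}. ereal (u i))"
          using nt unfolding k(2,3) series_weight_def by simp
        then show "\<exists>i<m. t \<in> I (u i) \<and> w \<le> u i"
          by (rule SUP_weight_attained[rotated]) auto
      qed
      then show ?thesis using t that Y(1) unfolding A\<^sub>\<Xi>_def set\<Xi> by blast
    qed
    then show ?thesis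
    proof cases
      case 1
      show ?thesis by (rule term_S[OF 1(1,2) bounded_exponents_mono[OF n 1(3) dy]])
    next
      case 2
      then show ?thesis by (rule torsion_S)
    next
      case 3
      then have "t \<in> carrier G" "n \<in> bounded_exponents dyadic_scale 0" using \<Xi>1(2) n by auto
      then show ?thesis
        by - (rule power_family_weight_zero[OF A\<^sub>S_carrier A\<^sub>S_nonneg dy genS])
    qed
  qed

  have term_\<Xi>: "(\<lambda>i. g [^] n i) \<in> ?B A\<^sub>\<Xi>"
    if "w \<in> range u" "g \<in> I w" "n \<in> bounded_exponents dyadic_scale w" for g n w
  proof -
    \<comment> \<open>The torsion subgroup is its own generating set: powers of torsion elements are bounded
      families. All later terms are trivial.\<close>
    define Z where "Z w = (if w = u m then torsion_part G M else \<Union>{set (Y i) | i. i < m \<and> w = u i})" for w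
    have inj: "u i = u j \<longleftrightarrow> i = j" for i j using strict_mono_eq[OF mono] .
    have Z_lt: "Z (u i) = set (Y i)" if "i < m" for i using that by (auto simp: Z_def inj)
    have Z_gt: "Z (u i) = {}" if "m < i" for i using that by (auto simp: Z_def inj)
    have Z_m: "Z (u m) = torsion_part G M" by (simp add: Z_def)
    show ?thesis
    proof (rule WI.power_families_generated[OF B\<Xi>.subgroup_axioms _ _ _ that, where Y = Z])
      fix w y assume "w \<in> range u" and y: "y \<in> Z w"
      then obtain i where w: "w = u i" by blast
      consider "i < m" | "i = m" | "m < i" by linarith
      note i = this
      show "y \<in> I w" using i y Y(1) Im unfolding w by cases (auto simp: Z_lt Z_gt Z_m)
      fix n :: "nat \<times> int \<Rightarrow> int" assume n: "n \<in> bounded_exponents dyadic_scale w"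
      show "(\<lambda>i. y [^] n i) \<in> ?B A\<^sub>\<Xi>"
        using i
      proof cases
        case 1
        then have "(y, w) \<in> A\<^sub>\<Xi>" using y unfolding w A\<^sub>\<Xi>_def set\<Xi> by (auto simp: Z_lt)
        then show ?thesis using n by (rule bounded_familiesI)
      next
        case 2
        then have "y \<in> torsion_part G M" using y unfolding w by (simp add: Z_m)
        then obtain p :: nat where p: "y \<in> M" "1 \<le> p" "y [^] p = \<one>" unfolding isolator_def by blast
        then have "y \<in> generate G (fst ` A\<^sub>\<Xi>)" using Mc gen\<Xi> by blast
        then show ?thesis
      by - (rule power_family_torsion[OF A\<^sub>\<Xi>_carrier A\<^sub>\<Xi>_nonneg dy _ p(2,3)])
      next
        case 3
        then show ?thesis using y unfolding w by (simp add: Z_gt)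
      qed
    next
      fix w assume "w \<in> range u"
      then obtain i where w: "w = u i" by blast
      let ?K = "{gcomm G x y | x y. \<exists>a \<in> range u. \<exists>b \<in> range u. a + b = w \<and> x \<in> I a \<and> y \<in> I b}"
      let ?R = "Z w \<union> \<Union> {I v | v. v \<in> range u \<and> w < v} \<union> ?K"
      consider "i < m" | "i = m" | "m < i" by linarith
      then show "I w \<subseteq> generate G ?R"
      proof cases
        case 1
        have "I w \<subseteq> generate G (set (Y i) \<union> I (u (Suc i)) \<union> ?K)"
          unfolding w by (rule graded_series_generated[OF Msub I 1 Y(1)[OF 1] Y(2)[OF 1]])
        also have "\<dots> \<subseteq> generate G ?R"
        proof (rule mono_generate)
          have "u i < u (Suc i)" using strict_mono_less[OF mono] by simp
          then show "set (Y i) \<union> I (u (Suc i)) \<union> ?K \<subseteq> ?R" unfolding w Z_lt[OF 1] by blast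
        qed
        finally show ?thesis .
      next
        case 2
        then show ?thesis unfolding w using Im Z_m by (auto intro: generate.incl)
      next
        case 3
        then show ?thesis unfolding w by (simp add: triv generate.one)
      qed
    qed
  qed

  have dom2: "(\<lambda>i. t [^] n i) \<in> ?B A\<^sub>\<Xi>" if t: "(t, w) \<in> A\<^sub>S" and n: "n \<in> bounded_exponents dyadic_scale w" for t w n
  proof -
    obtain i where i: "i < length S" "t = S ! i" "w = v ! i" using A\<^sub>S_mem[OF t] by blast
    have tc: "t \<in> carrier G" using i S(1) by auto
    show ?thesis
    proof (cases "finite (generate G {t})")
      case True
      obtain p :: nat where "1 \<le> p" "t [^] p = \<one>" by (rule finite_order_if_finite_generate[OF tc True])
      then show ?thesis
        by - (rule power_family_torsion[OF A\<^sub>\<Xi>_carrier A\<^sub>\<Xi>_nonneg dy gen\<Xi>[OF tc]])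
    next
      case False
      define s where "s = t [^] \<epsilon> i"
      have e: "1 \<le> \<epsilon> i" using \<epsilon> i False by blast
      have "s = X ! 0 \<otimes> (S ! i [^] \<epsilon> i) \<otimes> inv (X ! 0)" "0 < length X"
        using X tc i unfolding coset_reps_def s_def by auto
      then have "(s, w) \<in> set S\<^sub>N" unfolding SN set_conj_power_tuple using i False by blast
      then obtain k where k: "k < length S\<^sub>N" "S\<^sub>N ! k = (s, w)" by (metis in_set_conv_nth)
      have ne: "S\<^sub>N \<noteq> []" using k by auto
      have kc: "Letter k True \<in> fcomms S\<^sub>N" using k by simp
      have w: "w \<in> formal_weights S\<^sub>N"
        unfolding formal_weights_def using kc k(2) by (intro image_eqI[of _ _ "Letter k True"]) auto
      have sM: "s \<in> M" unfolding M wgroup_def using nth_mem[OF k(1)] k(2) by (force intro: generate.incl)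
      have sw: "s \<in> weight_subgroup G S\<^sub>N w"
        unfolding weight_subgroup_def using kc k(2)
        by (intro generate.incl image_eqI[of _ _ "Letter k True"]) auto
      from in_reduced_series_term[OF N nil SN_N SN_pos ne w sM[unfolded M] sw]
      consider "s \<in> torsion_part G M" | j where "j < m" "w \<le> u j" "s \<in> I (u j)"
        unfolding red M by auto
      then show ?thesis
      proof cases
        case 1
        then obtain p :: nat where p: "1 \<le> p" "s [^] p = \<one>" unfolding isolator_def by auto
        then have one: "t [^] (\<epsilon> i * p) = \<one>" using tc by (simp add: s_def nat_pow_pow)
        have "1 \<le> \<epsilon> i * p" using e p(1) by simp
        then show ?thesis
          by - (rule power_family_torsion[OF A\<^sub>\<Xi>_carrier A\<^sub>\<Xi>_nonneg dy gen\<Xi>[OF tc] _ one])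
      next
        case 2
        have "(\<lambda>i. s [^] n i) \<in> ?B A\<^sub>\<Xi>" if "n \<in> bounded_exponents dyadic_scale w" for n
          by (rule term_\<Xi>[of "u j"]) (use 2 bounded_exponents_mono[OF that 2(2) dy] in auto)
        then show ?thesis
          unfolding s_def
          by - (rule power_family_root[OF A\<^sub>\<Xi>_carrier A\<^sub>\<Xi>_nonneg dy gen\<Xi>[OF tc] e _ n])
      qed
    qed
  qed

  have finS: "finite A\<^sub>S" and fin\<Xi>: "finite A\<^sub>\<Xi>" using \<Xi>1(1) by (auto simp: A\<^sub>S_def A\<^sub>\<Xi>_def)
  let ?fs = "\<lambda>f :: 'a \<Rightarrow> real. finite {g \<in> carrier G. f g \<noteq> 0}"
  let ?ES = "\<lambda>f. \<Sum>l\<in>A\<^sub>S. power_energy f l" and ?E\<Xi> = "\<lambda>f. \<Sum>l\<in>A\<^sub>\<Xi>. power_energy f l"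
  let ?DS = "dirichlet_form G (pmf \<mu>\<^sub>S)" and ?D\<Xi> = "dirichlet_form G (\<lambda>g. pmf \<mu>\<^sub>\<Xi> g + uniform_mass \<Xi>\<^sub>1 g)"
  have "\<exists>C\<ge>0. \<forall>f. ?fs f \<longrightarrow> ?E\<Xi> f \<le> C * ?ES f"
    by (rule dominated_tuple_energy[OF finS A\<^sub>S_carrier A\<^sub>S_nonneg fin\<Xi> A\<^sub>\<Xi>_carrier A\<^sub>\<Xi>_nonneg dom1])
  then obtain C1 where C1: "0 \<le> C1" "\<forall>f. ?fs f \<longrightarrow> ?E\<Xi> f \<le> C1 * ?ES f" by (elim exE conjE)
  have "\<exists>C\<ge>0. \<forall>f. ?fs f \<longrightarrow> ?ES f \<le> C * ?E\<Xi> f"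
    by (rule dominated_tuple_energy[OF fin\<Xi> A\<^sub>\<Xi>_carrier A\<^sub>\<Xi>_nonneg finS A\<^sub>S_carrier A\<^sub>S_nonneg dom2])
  then obtain C2 where C2: "0 \<le> C2" "\<forall>f. ?fs f \<longrightarrow> ?ES f \<le> C2 * ?E\<Xi> f" by (elim exE conjE)
  have "\<exists>c>0. \<exists>C>0. \<forall>f. ?fs f \<longrightarrow>
    c * (\<Sum>l\<leftarrow>zip S v. power_energy f l) \<le> ?DS f \<and> ?DS f \<le> C * (\<Sum>l\<leftarrow>zip S v. power_energy f l)"
    by (rule power_measure_form[OF PS A\<^sub>S_carrier[unfolded A\<^sub>S_def] A\<^sub>S_pos[unfolded A\<^sub>S_def]])
  then obtain c3 C3 where 3: "0 < c3" "0 < C3" "\<forall>f. ?fs f \<longrightarrow>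
    c3 * (\<Sum>l\<leftarrow>zip S v. power_energy f l) \<le> ?DS f \<and> ?DS f \<le> C3 * (\<Sum>l\<leftarrow>zip S v. power_energy f l)"
    by (elim exE conjE)
  have "\<exists>c>0. \<exists>C>0. \<forall>f. ?fs f \<longrightarrow>
    c * (\<Sum>l\<leftarrow>\<Xi>. power_energy f l) \<le> dirichlet_form G (pmf \<mu>\<^sub>\<Xi>) f \<and>
    dirichlet_form G (pmf \<mu>\<^sub>\<Xi>) f \<le> C * (\<Sum>l\<leftarrow>\<Xi>. power_energy f l)"
    by (rule power_measure_form[OF P\<Xi> \<Xi>_carrier \<Xi>_pos])
  then obtain c4 C4 where 4: "0 < c4" "0 < C4" "\<forall>f. ?fs f \<longrightarrow>
    c4 * (\<Sum>l\<leftarrow>\<Xi>. power_energy f l) \<le> dirichlet_form G (pmf \<mu>\<^sub>\<Xi>) f \<and>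
    dirichlet_form G (pmf \<mu>\<^sub>\<Xi>) f \<le> C4 * (\<Sum>l\<leftarrow>\<Xi>. power_energy f l)"
    by (elim exE conjE)
  \<comment> \<open>If \<open>\<Xi>\<^sub>1\<close> is empty, division by its cardinality gives zero, and the estimates below remain
    valid.\<close>
  define K where "K = 1 / c4 + 2 * real (card \<Xi>\<^sub>1)"
  define L where "L = C4 * real (length \<Xi>) + 1"
  define a where "a = C3 * (real (length (zip S v)) * (C2 * K))"
  define b where "b = L * (C1 * (1 / c3))"
  have KL: "0 \<le> K" "0 \<le> L" using 4 by (auto simp: K_def L_def)
  have ab: "0 \<le> a" "0 \<le> b" using KL 3 C1(1) C2(1) by (auto simp: a_def b_def)
  have main: "?DS f \<le> a * ?D\<Xi> f \<and> ?D\<Xi> f \<le> b * ?DS f \<and> 0 \<le> ?DS f \<and> 0 \<le> ?D\<Xi> f" if f: "?fs f" for f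
  proof -
    note e0 = power_energy_nonneg[OF f]
    define P where "P = (\<Sum>l\<in>set \<Xi>. power_energy f l)"
    define Q where "Q = (\<Sum>x\<in>\<Xi>\<^sub>1. power_energy f (x, 0))"
    define D where "D = dirichlet_form G (pmf \<mu>\<^sub>\<Xi>) f"
    define \<kappa> where "\<kappa> = 1 / (2 * real (card \<Xi>\<^sub>1)) * Q"
    have PQ: "0 \<le> P" "0 \<le> Q" unfolding P_def Q_def by (intro sum_nonneg e0)+
    have "set \<Xi> \<inter> (\<lambda>x. (x, 0)) ` \<Xi>\<^sub>1 = {}" using \<Xi>_pos by force
    then have E\<Xi>: "?E\<Xi> f = P + Q"
      unfolding A\<^sub>\<Xi>_def P_def Q_def using \<Xi>1(1) by (simp add: sum.union_disjoint sum.reindex inj_on_def)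
    have D\<Xi>: "?D\<Xi> f = D + \<kappa>"
      unfolding D_def \<kappa>_def Q_def by (rule dirichlet_form_add_uniform[OF f \<Xi>1])
    have \<kappa>: "0 \<le> \<kappa>" "\<kappa> \<le> Q" "Q \<le> 2 * real (card \<Xi>\<^sub>1) * \<kappa>"
    proof -
      show "0 \<le> \<kappa>" using PQ by (simp add: \<kappa>_def)
      show "\<kappa> \<le> Q"
        unfolding \<kappa>_def using PQ by (intro mult_left_le_one_le) (auto simp: divide_simps)
      show "Q \<le> 2 * real (card \<Xi>\<^sub>1) * \<kappa>"
        using \<Xi>1(1) by (cases "\<Xi>\<^sub>1 = {}") (auto simp: \<kappa>_def Q_def)
    qed
    define LX where "LX = (\<Sum>l\<leftarrow>\<Xi>. power_energy f l)"
    have LX: "P \<le> LX" "LX \<le> real (length \<Xi>) * P"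
      unfolding LX_def P_def by (rule sum_le_sum_list[OF e0], rule sum_list_le_sum[OF e0])
    have LX0: "0 \<le> LX" using PQ(1) LX(1) by linarith
    define LS where "LS = (\<Sum>l\<leftarrow>zip S v. power_energy f l)"
    have LS: "?ES f \<le> LS" "LS \<le> real (length (zip S v)) * ?ES f"
      unfolding LS_def A\<^sub>S_def by (rule sum_le_sum_list[OF e0], rule sum_list_le_sum[OF e0])
    have "0 \<le> ?ES f" by (intro sum_nonneg e0)
    then have LS0: "0 \<le> LS" using LS(1) by linarith
    have DS: "c3 * LS \<le> ?DS f" "?DS f \<le> C3 * LS" unfolding LS_def using 3(3)[rule_format, OF f] by auto
    have D: "c4 * LX \<le> D" "D \<le> C4 * LX" unfolding LX_def D_def using 4(3)[rule_format, OF f] by auto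
    have D0: "0 \<le> D" using D(1) mult_nonneg_nonneg[of c4 LX] 4(1) LX0 by linarith
    have DS0: "0 \<le> ?DS f" using DS(1) mult_nonneg_nonneg[of c3 LS] 3(1) LS0 by linarith
    have D\<Xi>0: "0 \<le> ?D\<Xi> f" using D0 \<kappa>(1) D\<Xi> by simp
    have "LX \<le> 1 / c4 * D" using D(1) 4(1) by (simp add: field_simps)
    then have "?E\<Xi> f \<le> 1 / c4 * D + 2 * real (card \<Xi>\<^sub>1) * \<kappa>" using E\<Xi> LX(1) \<kappa>(3) by linarith
    also have "\<dots> \<le> K * D + K * \<kappa>"
      using 4(1) D0 \<kappa>(1) by (intro add_mono mult_right_mono) (auto simp: K_def)
    also have "\<dots> = K * ?D\<Xi> f" by (simp add: D\<Xi> distrib_left)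
    finally have EK: "?E\<Xi> f \<le> K * ?D\<Xi> f" .
    have "?DS f \<le> C3 * (real (length (zip S v)) * (C2 * (K * ?D\<Xi> f)))"
      using 3(2) C2(1)
      by (intro order_trans[OF DS(2)] mult_left_mono order_trans[OF LS(2)] order_trans[OF C2(2)[rule_format, OF f]] EK) auto
    then have 1: "?DS f \<le> a * ?D\<Xi> f" by (simp add: a_def mult.assoc)
    have "?D\<Xi> f \<le> C4 * (real (length \<Xi>) * P) + Q"
      unfolding D\<Xi> using 4(2) by (intro add_mono \<kappa>(2) order_trans[OF D(2)] mult_left_mono LX(2)) auto
    also have "\<dots> \<le> L * P + L * Q"
      using PQ 4(2) by (intro add_mono) (auto simp: L_def distrib_right)
    also have "\<dots> = L * ?E\<Xi> f" by (simp add: E\<Xi> distrib_left)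
    also have "\<dots> \<le> L * (C1 * (1 / c3 * ?DS f))"
    proof (intro mult_left_mono order_trans[OF C1(2)[rule_format, OF f]] order_trans[OF LS(1)] KL(2) C1(1))
      show "LS \<le> 1 / c3 * ?DS f" using DS(1) 3(1) by (simp add: field_simps)
    qed
    finally have 2: "?D\<Xi> f \<le> b * ?DS f" by (simp add: b_def mult.assoc)
    show ?thesis using 1 2 DS0 D\<Xi>0 by blast
  qed
  have "1 / (b + 1) * ?D\<Xi> f \<le> ?DS f \<and> ?DS f \<le> (a + 1) * ?D\<Xi> f" if f: "?fs f" for f
  proof -
    note m = main[OF f]
    have "?D\<Xi> f \<le> (b + 1) * ?DS f" using m by (simp add: distrib_right)
    then have "1 / (b + 1) * ?D\<Xi> f \<le> ?DS f" using ab by (simp add: field_simps)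
    moreover have "?DS f \<le> (a + 1) * ?D\<Xi> f" using m by (simp add: distrib_right)
    ultimately show ?thesis ..
  qed
  moreover have "0 < 1 / (b + 1)" "0 < a + 1" using ab by auto
  ultimately show ?thesis unfolding dirichlet_comparable_def by blast
qed

end

theorem theorem15:
  fixes G :: "('a, 'b) monoid_scheme"
    and N M \<Xi>\<^sub>1 :: "'a set"
    and S X :: "'a list"
    and v :: "real list"
    and \<epsilon> :: "nat \<Rightarrow> nat"
    and S\<^sub>N \<Xi> :: "'a wtuple"
    and u :: "nat \<Rightarrow> real"
    and m :: nat
    and I :: "real \<Rightarrow> 'a set"
    and \<mu>\<^sub>S \<mu>\<^sub>\<Xi> :: "'a pmf"
  assumes "group G" and "polynomial_growth G"
    and "normal N G" and "nilpotent_group (G\<lparr>carrier := N\<rparr>)" and "finite (rcosets\<^bsub>G\<^esub> N)"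
    and "set S \<subseteq> carrier G" and "generate G (set S) = carrier G"
    and "length v = length S" and "\<forall>i<length v. v ! i > 1/2"
    and "coset_reps G N X"
    and "\<forall>i<length S. infinite (generate G {S ! i}) \<longrightarrow>
           \<epsilon> i \<ge> 1 \<and> generate G {S ! i} \<inter> N = generate G {S ! i [^]\<^bsub>G\<^esub> \<epsilon> i}"
    and "S\<^sub>N = conj_power_tuple G X \<epsilon> S v"
    and "M = wgroup G S\<^sub>N"
    and "graded_series G M u m I"
    and "adapted_tuple G M u m I \<Xi>"
    and "finite \<Xi>\<^sub>1" and "\<Xi>\<^sub>1 \<subseteq> carrier G" and "generate G (fst ` set \<Xi> \<union> \<Xi>\<^sub>1) = carrier G"
    and "reduced_series G S\<^sub>N = map (\<lambda>i. (u i, I (u i))) [0..<m]"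
    and "power_measure G (reciprocal_weights (zip S v)) \<mu>\<^sub>S"
    and "power_measure G (reciprocal_weights \<Xi>) \<mu>\<^sub>\<Xi>"
  shows "dirichlet_comparable G (pmf \<mu>\<^sub>S) (\<lambda>g. pmf \<mu>\<^sub>\<Xi> g + uniform_mass \<Xi>\<^sub>1 g)"
  by (rule group.weighted_tuples_comparable[OF assms(1,3,4,6-21)])

end
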